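(* Let $X=(X_i)_{i\ge1}$ be a stationary process with values in a measurable space $E$, let $d\ge1$, and for each $n\ge1$ let $S_n\Phi(X)$ be a measurable function of $(X,TX,\dots,T^{n-1}X)$ taking values in $\mathbb R^d$. Let $(k(n))_{n\ge1}$ be an increasing sequence of positive integers, and let $\Lambda_n$, $\mu_n^\omega$, $\Lambda_n^\omega$ be as defined in the context. Assume: (i) there exists a convex open set $\mathcal D\subset\mathbb R^d$ such that $\Lambda(\lambda)=\lim_{n\to\infty}\Lambda_n(\lambda)$ exists and is finite for each $\lambda\in\mathcal D$; (ii) $M_h=\int_0^1(\alpha_X^{-1}(u))^h\,du<\infty$ for all $h>0$; (iii) there exists a sequence $(S_n\Phi_n)_{n\ge1}$ of functions from $E^{\mathbb N_+}$ to $\mathbb R^d$ such that each $S_n\Phi_n$ depends only on the first $2n$ coordinates and $\delta_n=\sup_{z\in E^{\mathbb N_+}}\|S_n\Phi(z)-S_n\Phi_n(z)\|/n=o(1)$ as $n\to\infty$. Let $\lambda_0\in\mathring{\mathcal D}$ be a point at which $\Lambda$ is differentiable and denote $\nabla\Lambda(\lambda_0)$ by $x_0$. (1) If $\liminf_{n\to\infty}\frac{\log k(n)}n>\Lambda^*(x_0)$ then there exists $r>0$ such that $B(\lambda_0,r)\subset\mathcal D$ and, with probability 1, $\Lambda_n^\omega$ converges uniformly to $\Lambda$ over $B(\lambda_0,r)$. (2) If $\liminf_{n\to\infty}\frac{\log k(n)}n>\Lambda^*(x_0)$ then, with probability 1, $$\lim_{\epsilon\to0}\lim_{n\to\infty}\frac1n\log\mu_n^\omega\big(B(x_0,\epsilon)\big)=-\Lambda^*(x_0).$$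 If $\limsup_{n\to\infty}\frac{\log k(n)}n<\Lambda^*(x_0)$, there exists $\epsilon>0$ such that, with probability 1, for $n$ large enough the set $\{1\le j\le k(n):S_n\Phi(T^{(j-1)n}X(\omega))/n\in B(x_0,\epsilon)\}$ is empty. (3) If $\lim_{n\to\infty}\frac{\log k(n)}n=\Lambda^*(x_0)$ and $t\ge0\mapsto\Lambda(t\lambda_0)$ is strictly convex at $1$ then, with probability 1, for all $t\ge1$ we have $$\lim_{n\to\infty}\Lambda_n^\omega(t\lambda_0)=\Lambda(\lambda_0)+(t-1)\langle\lambda_0,x_0\rangle.$$
   Context: $\mathbb N_+$ is the set of positive integers; $X$ is defined on a probability space $(\Omega,\mathcal A,\mathbb P)$; $T(x_1,x_2,\dots)=(x_2,x_3,\dots)$ is the shift on $E^{\mathbb N_+}$; $\langle\cdot,\cdot\rangle$ is the canonical scalar product on $\mathbb R^d$; $B(x,r)$ is the closed ball of center $x$ and radius $r$; $\mathring{\mathcal D}$ is the interior of $\mathcal D$. A typical example of $S_n\Phi(X)$ is the Birkhoff sum $\sum_{j=0}^{n-1}\Phi(T^jX)$ of a measurable function $\Phi:E^{\mathbb N_+}\to\mathbb R^d$. $\Lambda_n(\lambda)=\frac1n\log\mathbb E\exp(\langle\lambda,S_n\Phi(X)\rangle)$, $\lambda\in\mathbb R^d$. $\mu_n^\omega=\frac1{k(n)}\sum_{j=1}^{k(n)}\delta_{x_{n,j}(\omega)}$ with $x_{n,j}(\omega)=S_n\Phi(T^{(j-1)n}X(\omega))/n$, and $\Lambda_n^\omega(\lambda)=\frac1n\log\int_{\mathbb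 R^d}\exp(n\langle\lambda,x\rangle)\,d\mu_n^\omega(x)$. $\Lambda^*(x)=\sup\{\langle\lambda,x\rangle-\Lambda(\lambda)\}$ is the Fenchel-Legendre transform of $\Lambda$, the supremum being over the $\lambda\in\mathbb R^d$ at which $\Lambda$ is defined. Mixing: for sub-$\sigma$-algebras $\mathcal U,\mathcal V$ of $\mathcal A$, $\alpha(\mathcal U,\mathcal V)=\sup\{|\mathbb P(U)\mathbb P(V)-\mathbb P(U\cap V)|:U\in\mathcal U,V\in\mathcal V\}$. Set $\alpha_{X,0}=1/2$ and, for $m\ge1$, $\alpha_{X,m}=\sup\{\alpha(\sigma(X_k:k\le i),\sigma(X_j:j\ge i+m)):i\ge1\}$. For $u\in[0,1]$, $\alpha_X^{-1}(u)=\inf\{m:\alpha_{X,m}\le u\}$.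
   Formalization: In (2), the inner limit over n need not exist for fixed ε, so the iterated limit is stated as: the liminf and the limsup over n of (1/n) log μ_n^ω(B(x_0,ε)) both tend to -Λ*(x_0) as ε→0. *)

theory Defs
  imports "HOL-Probability.Probability"
begin

text \<open>
  Sequences in \<open>E\<close> are indexed by the positive integers: they are the points of the product
  space over the index set \<open>{1..}\<close>, hence functions that are \<open>undefined\<close> at \<open>0\<close>.
\<close>

definition seq_space :: "'e measure \<Rightarrow> (nat \<Rightarrow> 'e) measure"
  where "seq_space E = (\<Pi>\<^sub>M i\<in>{1..}. E)"

definition shift :: "(nat \<Rightarrow> 'e) \<Rightarrow> nat \<Rightarrow> 'e"
  where "shift z = (\<lambda>i\<in>{1..}. z (Suc i))"

definition path :: "(nat \<Rightarrow> 'a \<Rightarrow> 'e) \<Rightarrow> 'a \<Rightarrow> nat \<Rightarrow> 'e"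
  where "path X \<omega> = (\<lambda>i\<in>{1..}. X i \<omega>)"

definition stationary_process :: "'a measure \<Rightarrow> 'e measure \<Rightarrow> (nat \<Rightarrow> 'a \<Rightarrow> 'e) \<Rightarrow> bool"
  where "stationary_process M E X \<longleftrightarrow>
    (\<forall>i\<ge>1. X i \<in> M \<rightarrow>\<^sub>M E) \<and>
    distr M (seq_space E) (\<lambda>\<omega>. shift (path X \<omega>)) = distr M (seq_space E) (path X)"

text \<open>\<open>f z\<close> is a measurable function of the orbit segment \<open>(z, T z, \<dots>, T^(n-1) z)\<close>, \<open>T\<close> the shift.\<close>

definition orbit_function ::
    "'e measure \<Rightarrow> nat \<Rightarrow> ((nat \<Rightarrow> 'e) \<Rightarrow> 'v::topological_space) \<Rightarrow> bool"
  where "orbit_function E n f \<longleftrightarrow>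
    (\<exists>g \<in> borel_measurable (\<Pi>\<^sub>M i\<in>{..<n}. seq_space E).
      \<forall>z \<in> space (seq_space E). f z = g (\<lambda>i\<in>{..<n}. (shift ^^ i) z))"

definition depends_on_first ::
    "'e measure \<Rightarrow> nat \<Rightarrow> ((nat \<Rightarrow> 'e) \<Rightarrow> 'v) \<Rightarrow> bool"
  where "depends_on_first E m f \<longleftrightarrow>
    (\<forall>z \<in> space (seq_space E). \<forall>z' \<in> space (seq_space E).
      (\<forall>i\<in>{1..m}. z i = z' i) \<longrightarrow> f z = f z')"

definition elog :: "ennreal \<Rightarrow> ereal"
  where "elog x = (if x = 0 then -\<infinity> else if x = \<infinity> then \<infinity> else ereal (ln (enn2real x)))"

text \<open>
  In the following, \<open>S n z\<close> is the value of \<open>S\<^sub>n\<Phi>\<close> at the sequence \<open>z\<close>. The function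
  \<open>\<Lambda>\<^sub>n\<close> takes values in \<open>(-\<infinity>, \<infinity>]\<close>, since the exponential moment may be infinite.
\<close>

definition log_mgf ::
    "'a measure \<Rightarrow> (nat \<Rightarrow> 'a \<Rightarrow> 'e) \<Rightarrow> (nat \<Rightarrow> (nat \<Rightarrow> 'e) \<Rightarrow> 'v::euclidean_space) \<Rightarrow> nat \<Rightarrow> 'v \<Rightarrow> ereal"
  where "log_mgf M X S n \<theta> =
    ereal (1 / real n) * elog (\<integral>\<^sup>+\<omega>. ennreal (exp (\<theta> \<bullet> S n (path X \<omega>))) \<partial>M)"

text \<open>The points at which \<open>\<Lambda>\<close> is defined, and \<open>\<Lambda>\<close> itself (meaningful at these points only).\<close>

definition lim_log_mgf_dom ::
    "'a measure \<Rightarrow> (nat \<Rightarrow> 'a \<Rightarrow> 'e) \<Rightarrow> (nat \<Rightarrow> (nat \<Rightarrow> 'e) \<Rightarrow> 'v::euclidean_space) \<Rightarrow> 'v set"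
  where "lim_log_mgf_dom M X S = {\<theta>. \<exists>l::real. (\<lambda>n. log_mgf M X S n \<theta>) \<longlonglongrightarrow> ereal l}"

definition lim_log_mgf ::
    "'a measure \<Rightarrow> (nat \<Rightarrow> 'a \<Rightarrow> 'e) \<Rightarrow> (nat \<Rightarrow> (nat \<Rightarrow> 'e) \<Rightarrow> 'v::euclidean_space) \<Rightarrow> 'v \<Rightarrow> real"
  where "lim_log_mgf M X S \<theta> = real_of_ereal (lim (\<lambda>n. log_mgf M X S n \<theta>))"

definition legendre :: "'v::euclidean_space set \<Rightarrow> ('v \<Rightarrow> real) \<Rightarrow> 'v \<Rightarrow> ereal"
  where "legendre A f x = (SUP \<theta>\<in>A. ereal (\<theta> \<bullet> x - f \<theta>))"

definition rate ::
    "'a measure \<Rightarrow> (nat \<Rightarrow> 'a \<Rightarrow> 'e) \<Rightarrow> (nat \<Rightarrow> (nat \<Rightarrow> 'e) \<Rightarrow> 'v::euclidean_space) \<Rightarrow> 'v \<Rightarrow> ereal"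
  where "rate M X S x = legendre (lim_log_mgf_dom M X S) (lim_log_mgf M X S) x"

definition emp_point ::
    "(nat \<Rightarrow> 'a \<Rightarrow> 'e) \<Rightarrow> (nat \<Rightarrow> (nat \<Rightarrow> 'e) \<Rightarrow> 'v::euclidean_space) \<Rightarrow> nat \<Rightarrow> nat \<Rightarrow> 'a \<Rightarrow> 'v"
  where "emp_point X S n j \<omega> = S n ((shift ^^ ((j - 1) * n)) (path X \<omega>)) /\<^sub>R real n"

text \<open>The image of the uniform probability on \<open>{1..k n}\<close>, i.e. the average of \<open>k n\<close> Dirac masses.\<close>

definition emp_measure ::
    "(nat \<Rightarrow> 'a \<Rightarrow> 'e) \<Rightarrow> (nat \<Rightarrow> (nat \<Rightarrow> 'e) \<Rightarrow> 'v::euclidean_space) \<Rightarrow> (nat \<Rightarrow> nat) \<Rightarrow> nat \<Rightarrow> 'a \<Rightarrow> 'v measure"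
  where "emp_measure X S k n \<omega> =
    distr (uniform_count_measure {1..k n}) borel (\<lambda>j. emp_point X S n j \<omega>)"

definition emp_log_mgf ::
    "(nat \<Rightarrow> 'a \<Rightarrow> 'e) \<Rightarrow> (nat \<Rightarrow> (nat \<Rightarrow> 'e) \<Rightarrow> 'v::euclidean_space) \<Rightarrow> (nat \<Rightarrow> nat) \<Rightarrow> nat \<Rightarrow> 'a \<Rightarrow> 'v \<Rightarrow> real"
  where "emp_log_mgf X S k n \<omega> \<theta> =
    ln (\<integral>x. exp (real n * (\<theta> \<bullet> x)) \<partial>emp_measure X S k n \<omega>) / real n"

definition alpha_coeff :: "'a measure \<Rightarrow> 'a set set \<Rightarrow> 'a set set \<Rightarrow> real"
  where "alpha_coeff M \<U> \<V> =
    (SUP (U, V) \<in> \<U> \<times> \<V>. \<bar>measure M U * measure M V - measure M (U \<inter> V)\<bar>)"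

definition sigma_process ::
    "'a measure \<Rightarrow> 'e measure \<Rightarrow> (nat \<Rightarrow> 'a \<Rightarrow> 'e) \<Rightarrow> nat set \<Rightarrow> 'a set set"
  where "sigma_process M E X I =
    sigma_sets (space M) (\<Union>i\<in>I. {X i -` A \<inter> space M | A. A \<in> sets E})"

definition alpha_mixing ::
    "'a measure \<Rightarrow> 'e measure \<Rightarrow> (nat \<Rightarrow> 'a \<Rightarrow> 'e) \<Rightarrow> nat \<Rightarrow> real"
  where "alpha_mixing M E X m =
    (if m = 0 then 1 / 2
     else SUP i\<in>{1..}. alpha_coeff M (sigma_process M E X {1..i}) (sigma_process M E X {i + m..}))"

text \<open>Extended-valued: the infimum of the empty set is \<open>\<infinity>\<close>.\<close>

definition alpha_inv ::
    "'a measure \<Rightarrow> 'e measure \<Rightarrow> (nat \<Rightarrow> 'a \<Rightarrow> 'e) \<Rightarrow> real \<Rightarrow> ennreal"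
  where "alpha_inv M E X u = (INF m \<in> {m. alpha_mixing M E X m \<le> u}. of_nat m)"

text \<open>Used for \<open>h > 0\<close> only, so that \<open>0\<close> to the power \<open>h\<close> is \<open>0\<close>.\<close>

definition ennreal_powr :: "ennreal \<Rightarrow> real \<Rightarrow> ennreal"
  where "ennreal_powr a h = (if a = \<infinity> then \<infinity> else ennreal (enn2real a powr h))"

definition mixing_moment ::
    "'a measure \<Rightarrow> 'e measure \<Rightarrow> (nat \<Rightarrow> 'a \<Rightarrow> 'e) \<Rightarrow> real \<Rightarrow> ennreal"
  where "mixing_moment M E X h =
    (\<integral>\<^sup>+u\<in>{0..1}. ennreal_powr (alpha_inv M E X u) h \<partial>lborel)"

text \<open>
  Strict convexity of \<open>f\<close> on the convex set \<open>I\<close> at the single point \<open>a\<close>: the convexity inequality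
  is strict for every segment that starts at \<open>a\<close>.
\<close>

definition strictly_convex_at :: "real set \<Rightarrow> (real \<Rightarrow> real) \<Rightarrow> real \<Rightarrow> bool"
  where "strictly_convex_at I f a \<longleftrightarrow>
    (\<forall>b\<in>I. b \<noteq> a \<longrightarrow> (\<forall>s\<in>{0<..<1}. f ((1 - s) * a + s * b) < (1 - s) * f a + s * f b))"

text \<open>
  \<open>lim\<^bsub>\<epsilon>\<rightarrow>0\<^esub> lim\<^bsub>n\<rightarrow>\<infinity>\<^esub> f \<epsilon> n = l\<close> in the sense customary for local large deviation estimates: the inner
  lower and upper limits both tend to \<open>l\<close>. The inner limit need not exist for fixed \<open>\<epsilon>\<close>.
\<close>

definition iterated_limit :: "(real \<Rightarrow> nat \<Rightarrow> ereal) \<Rightarrow> ereal \<Rightarrow> bool"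
  where "iterated_limit f l \<longleftrightarrow>
    ((\<lambda>\<epsilon>. liminf (f \<epsilon>)) \<longlongrightarrow> l) (at_right 0) \<and> ((\<lambda>\<epsilon>. limsup (f \<epsilon>)) \<longlongrightarrow> l) (at_right 0)"

end

theory Submission
  imports Defs
begin

text \<open>
  For every \<open>\<omega>\<close> the empirical function \<open>\<Lambda>\<^sub>n\<^sup>\<omega>\<close> is a normalised log-sum-exp of the points
  \<open>x\<^sub>n\<^sub>,\<^sub>j(\<omega>)\<close>, hence convex, and \<open>exp (n \<Lambda>\<^sub>n\<^sup>\<omega>(\<theta>))\<close> is the mean of \<open>k(n)\<close> identically distributed
  variables with expectation \<open>exp (n \<Lambda>\<^sub>n(\<theta>))\<close>. Two almost sure comparisons with \<open>\<Lambda>\<close>, each at a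
  single parameter \<open>\<theta>\<close>, carry the whole proof.

  Upper bound (\<open>AE_emp_log_mgf_upper\<close>): by Markov's inequality and the Borel-Cantelli lemma,
  \<open>limsup \<Lambda>\<^sub>n\<^sup>\<omega>(\<theta>) \<le> \<Lambda>(\<theta>)\<close>, whatever the growth of \<open>k\<close>.

  Lower bound (\<open>AE_emp_log_mgf_lower\<close>): the mean is close to its expectation if enough blocks
  contribute to it. If \<open>\<Lambda>((1 + \<delta>) \<theta>) - \<Lambda>(\<theta>) < \<delta> b\<close>, then by the exponential Chebyshev inequality
  the exponential moment at \<open>\<theta>\<close> is carried by the event \<open>\<theta> \<bullet> S\<^sub>n \<le> n b\<close>. The variables cut off there
  are at most \<open>exp (n b)\<close>, so that the second-moment method applies as soon as \<open>k(n)\<close> grows faster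
  than \<open>exp (n (b - \<Lambda>(\<theta>)))\<close>. The blocks are not independent, but finiteness of all the moments of
  \<open>\<alpha>\<inverse>\<close> makes the mixing coefficients decay faster than every power, so that the covariances
  of blocks at index distance \<open>exp (n \<eta>)\<close> are exponentially small of any prescribed order; the
  closer pairs of blocks are too few to matter.

  At \<open>\<theta>\<^sub>0\<close> the difference quotient \<open>(\<Lambda>((1 + \<delta>) \<theta>\<^sub>0) - \<Lambda>(\<theta>\<^sub>0)) / \<delta>\<close> tends to \<open>\<theta>\<^sub>0 \<bullet> x\<^sub>0\<close>, hence the
  critical growth rate of \<open>k\<close> there is \<open>\<theta>\<^sub>0 \<bullet> x\<^sub>0 - \<Lambda>(\<theta>\<^sub>0)\<close>, which is \<open>\<Lambda>\<^sup>*(x\<^sub>0)\<close> by convexity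
  (\<open>rate_at_gradient\<close>). The rest is convex analysis for fixed \<open>\<omega>\<close>.

  Above the critical rate, the lower bound applies in a whole neighbourhood of \<open>\<theta>\<^sub>0\<close>; convergence on
  a countable dense set becomes uniform by convexity (\<open>convex_converges_uniformly_on_compact\<close>), and
  tilting by \<open>\<theta>\<^sub>0\<close> turns it into the local large deviation estimate (\<open>card_near_gradient_ge\<close>).
  Below the critical rate, the upper bound at \<open>\<theta>\<^sub>0\<close> controls the maximum of \<open>\<theta>\<^sub>0 \<bullet> x\<^sub>n\<^sub>,\<^sub>j\<close>
  (\<open>inner_le_free_energy\<close>) and excludes points near \<open>x\<^sub>0\<close>. At the critical rate this maximum is
  asymptotically at most \<open>\<theta>\<^sub>0 \<bullet> x\<^sub>0\<close>, so the slope of \<open>t \<mapsto> \<Lambda>\<^sub>n\<^sup>\<omega>(t \<theta>\<^sub>0)\<close> beyond \<open>1\<close> cannot exceed this value;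
  strict convexity makes the parameters \<open>t < 1\<close> supercritical, and the slopes there bound it
  from below (\<open>free_energy_freezes\<close>).
\<close>

section \<open>Convex functions\<close>

text \<open>
  A dense subset of an open convex set has that set as its convex hull, because a convex set and
  its closure have the same interior.
\<close>

lemma open_convex_subset_hull_dense:
  fixes V :: "'v::euclidean_space set"
  assumes V: "open V" "convex V" and Q: "V \<subseteq> closure (Q \<inter> V)"
  shows "V \<subseteq> convex hull (Q \<inter> V)"
proof -
  have "V \<subseteq> closure (convex hull (Q \<inter> V))"
    using Q closure_mono[OF hull_subset] by blast
  then have "V \<subseteq> interior (closure (convex hull (Q \<inter> V)))"
    using V(1) interior_maximal by blast
  also have "\<dots> = interior (convex hull (Q \<inter> V))"
    by (rule convex_interior_closure) (rule convex_convex_hull)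
  finally show ?thesis
    using interior_subset by blast
qed

text \<open>
  Every point has a neighbourhood on which a convex function is bounded by its maximum over
  finitely many prescribed points; this is what turns pointwise upper bounds into uniform ones.
\<close>

lemma neighbourhood_in_finite_hull:
  fixes V :: "'v::euclidean_space set"
  assumes V: "open V" "convex V" and Q: "V \<subseteq> closure (Q \<inter> V)" and x: "x \<in> V"
  obtains F r where "finite F" "F \<subseteq> Q \<inter> V" "0 < r" "ball x r \<subseteq> convex hull F"
proof -
  obtain e where e: "0 < e" "cball x e \<subseteq> V"
    using V(1) x open_contains_cball by blast
  define d where "d = e / real DIM('v)"
  have d: "d > 0" using e by (simp add: d_def)
  obtain C :: "'v set" where C: "finite C"
    "cbox (x - (\<Sum>i\<in>Basis. d *\<^sub>R i)) (x + (\<Sum>i\<in>Basis. d *\<^sub>R i)) = convex hull C"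
    using cube_convex_hull[OF d] by blast
  have coord: "(\<Sum>i\<in>Basis. d *\<^sub>R i) \<bullet> j = d" if "j \<in> Basis" for j :: 'v
    using that by (simp add: inner_sum_left inner_Basis sum.delta if_distrib cong: if_cong)
  have "convex hull C \<subseteq> cball x e"
  proof
    fix y assume "y \<in> convex hull C"
    then have "\<bar>(y - x) \<bullet> b\<bar> \<le> d" if "b \<in> Basis" for b
      using that unfolding C(2)[symmetric] mem_box
      by (auto simp: inner_diff_left inner_add_left coord abs_le_iff algebra_simps)
    then have "(\<Sum>b\<in>Basis. \<bar>(y - x) \<bullet> b\<bar>) \<le> real DIM('v) * d"
      by (intro order_trans[OF sum_bounded_above[where K = d]]) auto
    then have "norm (y - x) \<le> e"
      using norm_le_l1[of "y - x"] by (simp add: d_def)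
    then show "y \<in> cball x e" by (simp add: dist_norm norm_minus_commute)
  qed
  then have "C \<subseteq> V" using e(2) hull_subset[of C convex] by (metis order_trans)
  then have "C \<subseteq> convex hull (Q \<inter> V)"
    using open_convex_subset_hull_dense[OF V Q] by (rule order_trans)
  then have "\<forall>c\<in>C. \<exists>F. finite F \<and> F \<subseteq> Q \<inter> V \<and> c \<in> convex hull F"
  proof (intro ballI)
    fix c assume "c \<in> C"
    with \<open>C \<subseteq> convex hull (Q \<inter> V)\<close>
    have "c \<in> {x. \<exists>F. finite F \<and> F \<subseteq> Q \<inter> V \<and> card F \<le> DIM('v) + 1 \<and> x \<in> convex hull F}"
      using caratheodory[of "Q \<inter> V"] by (simp only: subset_iff)
    then show "\<exists>F. finite F \<and> F \<subseteq> Q \<inter> V \<and> c \<in> convex hull F"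
      by (elim CollectE exE conjE) (intro exI conjI)
  qed
  from bchoice[OF this] obtain G
    where G: "\<forall>c\<in>C. finite (G c) \<and> G c \<subseteq> Q \<inter> V \<and> c \<in> convex hull (G c)" ..
  define F where "F = (\<Union>c\<in>C. G c)"
  have "C \<subseteq> convex hull F"
  proof
    fix c assume c: "c \<in> C"
    have "convex hull (G c) \<subseteq> convex hull F"
      by (rule hull_mono) (use c in \<open>auto simp: F_def\<close>)
    then show "c \<in> convex hull F" using G c by blast
  qed
  then have hull: "convex hull C \<subseteq> convex hull F"
    by (simp add: hull_minimal)
  have "ball x d \<subseteq> convex hull C"
  proof
    fix y assume y: "y \<in> ball x d"
    have "\<bar>(y - x) \<bullet> b\<bar> \<le> d" if "b \<in> Basis" for b
      using Basis_le_norm[OF that, of "y - x"] y by (simp add: dist_norm norm_minus_commute)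
    then show "y \<in> convex hull C"
      unfolding C(2)[symmetric] mem_box
      by (force simp: inner_diff_left inner_add_left coord abs_le_iff algebra_simps)
  qed
  then have "ball x d \<subseteq> convex hull F" using hull by (rule order_trans)
  moreover have "finite F" "F \<subseteq> Q \<inter> V" using C(1) G by (auto simp: F_def)
  ultimately show ?thesis using that d by blast
qed

text \<open>
  Near a point \<open>x\<close>, the upper bound is the maximum over a finite hull; reflecting at a
  point \<open>q\<close> of convergence, the midpoint inequality for \<open>y\<close>, \<open>2 q - y\<close> then yields the lower bound.
\<close>

lemma convex_converges_locally_uniformly:
  fixes f :: "nat \<Rightarrow> 'v::euclidean_space \<Rightarrow> real"
  assumes U: "open U" and f: "\<And>n. convex_on UNIV (f n)" and g: "continuous_on U g"
    and Q: "U \<subseteq> closure (Q \<inter> U)" and lim: "\<And>q. q \<in> Q \<inter> U \<Longrightarrow> (\<lambda>n. f n q) \<longlonglongrightarrow> g q"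
    and x: "x \<in> U" and e: "e > 0"
  shows "\<exists>r>0. \<forall>\<^sub>F n in sequentially. \<forall>y\<in>ball x r. dist (f n y) (g y) < e"
proof -
  \<comment> \<open>the reflection step below accumulates an error of seven times \<open>\<eta>\<close>\<close>
  define \<eta> where "\<eta> = e / 16"
  have \<eta>: "\<eta> > 0" using e by (simp add: \<eta>_def)
  obtain s where s: "s > 0" "ball x s \<subseteq> U" "\<And>y. y \<in> ball x s \<Longrightarrow> \<bar>g y - g x\<bar> < \<eta>"
  proof -
    have "isCont g x" using g U x continuous_on_eq_continuous_at by blast
    then obtain s1 where s1: "s1 > 0" "\<And>y. dist y x < s1 \<Longrightarrow> dist (g y) (g x) < \<eta>"
      using \<eta> unfolding continuous_at_eps_delta by metis
    obtain s2 where s2: "s2 > 0" "ball x s2 \<subseteq> U" using U x open_contains_ball by blast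
    show ?thesis
      by (rule that[of "min s1 s2"]) (use s1 s2 in \<open>auto simp: dist_real_def dist_commute\<close>)
  qed
  define V where "V = ball x s"
  have V: "open V" "convex V" "x \<in> V" using s(1) by (auto simp: V_def)
  have dense: "V \<subseteq> closure (Q \<inter> V)"
  proof -
    have "V \<subseteq> closure (Q \<inter> U) \<inter> V" using Q s(2) V_def by blast
    also have "\<dots> \<subseteq> closure ((Q \<inter> U) \<inter> V)"
      using open_Int_closure_subset[OF V(1)] by (metis inf_commute)
    also have "\<dots> \<subseteq> closure (Q \<inter> V)" by (rule closure_mono) blast
    finally show ?thesis .
  qed
  obtain F r where F: "finite F" "F \<subseteq> Q \<inter> V" "0 < r" "ball x r \<subseteq> convex hull F"
    using neighbourhood_in_finite_hull[OF V(1,2) dense V(3)] by blast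
  have near: "\<forall>\<^sub>F n in sequentially. \<bar>f n q - g x\<bar> < 2 * \<eta>" if "q \<in> Q \<inter> V" for q
  proof -
    have "\<forall>\<^sub>F n in sequentially. dist (f n q) (g q) < \<eta>"
      by (rule tendstoD[OF lim \<eta>]) (use that s(2) V_def in blast)
    then show ?thesis
      by eventually_elim (use s(3)[of q] that in \<open>auto simp: V_def dist_real_def\<close>)
  qed
  define r' where "r' = min r s / 3"
  have r': "r' > 0" using F(3) s(1) by (simp add: r'_def)
  obtain q where q: "q \<in> Q \<inter> V" "dist q x < r'"
    using dense V(3) r' closure_approachable[of x "Q \<inter> V"] by blast
  have "\<forall>\<^sub>F n in sequentially. (\<forall>p\<in>F. \<bar>f n p - g x\<bar> < 2 * \<eta>) \<and> \<bar>f n q - g x\<bar> < 2 * \<eta>"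
    using near F(1,2) q(1) by (auto intro!: eventually_conj eventually_ball_finite)
  then have "\<forall>\<^sub>F n in sequentially. \<forall>y\<in>ball x r'. dist (f n y) (g y) < e"
  proof eventually_elim
    case (elim n)
    have "convex_on (convex hull F) (f n)"
      using f[of n] convex_on_subset convex_convex_hull by blast
    then have "\<forall>y\<in>convex hull F. f n y \<le> g x + 2 * \<eta>"
      by (rule convex_on_convex_hull_bound) (use elim in \<open>auto simp: abs_less_iff intro: less_imp_le\<close>)
    then have up: "f n y \<le> g x + 2 * \<eta>" if "dist y x < r" for y
      using F(4) that by (auto simp: dist_commute)
    show ?case
    proof
      fix y assume y: "y \<in> ball x r'"
      have yr: "dist y x < r" "y \<in> ball x s"
        using y r' by (auto simp: r'_def dist_commute)
      define y' where "y' = 2 *\<^sub>R q - y"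
      have "y' - x = 2 *\<^sub>R (q - x) - (y - x)" by (simp add: y'_def algebra_simps scaleR_2)
      then have "norm (y' - x) \<le> 2 * norm (q - x) + norm (y - x)"
        by (metis norm_triangle_ineq4 norm_scaleR abs_numeral)
      then have "dist y' x < r"
        using q(2) y by (auto simp: dist_norm norm_minus_commute r'_def)
      then have y': "f n y' \<le> g x + 2 * \<eta>" by (rule up)
      have "q = (1 - 1/2) *\<^sub>R y + (1/2) *\<^sub>R y'"
        by (simp add: y'_def algebra_simps flip: scaleR_add_left)
      then have "f n q \<le> (1 - 1/2) * f n y + (1/2) * f n y'"
        using convex_onD[OF f[of n], of "1/2" y y'] by simp
      moreover have "\<bar>g y - g x\<bar> < \<eta>" using s(3) yr by blast
      moreover have "f n y \<le> g x + 2 * \<eta>" using up yr by blast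
      ultimately show "dist (f n y) (g y) < e"
        using elim y' unfolding dist_real_def \<eta>_def abs_less_iff by (simp add: field_simps)
    qed
  qed
  then show ?thesis using r' by blast
qed

lemma convex_converges_uniformly_on_compact:
  fixes f :: "nat \<Rightarrow> 'v::euclidean_space \<Rightarrow> real"
  assumes "open U" "\<And>n. convex_on UNIV (f n)" "continuous_on U g"
    and "U \<subseteq> closure (Q \<inter> U)" "\<And>q. q \<in> Q \<inter> U \<Longrightarrow> (\<lambda>n. f n q) \<longlonglongrightarrow> g q"
    and K: "compact K" "K \<subseteq> U"
  shows "uniform_limit K f g sequentially"
  unfolding uniform_limit_iff
proof safe
  fix e :: real assume e: "e > 0"
  have "\<exists>r>0. \<forall>\<^sub>F n in sequentially. \<forall>y\<in>ball x r. dist (f n y) (g y) < e"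
    if x: "x \<in> K" for x
  proof -
    have xU: "x \<in> U" using x K(2) by blast
    show ?thesis
      by (rule convex_converges_locally_uniformly[of U f g Q x e]) (fact assms(1-5) xU e)+
  qed
  then have "\<forall>x\<in>K. \<exists>r. r > 0 \<and> (\<forall>\<^sub>F n in sequentially. \<forall>y\<in>ball x r. dist (f n y) (g y) < e)"
    by (intro ballI)
  from bchoice[OF this] obtain r where r: "\<forall>x\<in>K. r x > 0 \<and>
    (\<forall>\<^sub>F n in sequentially. \<forall>y\<in>ball x (r x). dist (f n y) (g y) < e)" ..
  obtain C where C: "C \<subseteq> K" "finite C" "K \<subseteq> (\<Union>x\<in>C. ball x (r x))"
  proof (rule compactE_image[OF K(1), where C = K and f = "\<lambda>x. ball x (r x)"])
    show "K \<subseteq> (\<Union>x\<in>K. ball x (r x))" using r by force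
  qed auto
  have "\<forall>\<^sub>F n in sequentially. \<forall>x\<in>C. \<forall>y\<in>ball x (r x). dist (f n y) (g y) < e"
    by (rule eventually_ball_finite[OF C(2)]) (use r C(1) in auto)
  then show "\<forall>\<^sub>F n in sequentially. \<forall>y\<in>K. dist (f n y) (g y) < e"
    by eventually_elim (use C(3) in blast)
qed

section \<open>Free energy of a sequence of finite configurations\<close>

text \<open>
  The logarithmic Laplace transform of the uniform distribution on the points
  \<open>x n 1, \<dots>, x n (k n)\<close>, taken at \<open>n \<theta>\<close> and divided by \<open>n\<close>.
\<close>

definition free_energy :: "(nat \<Rightarrow> nat) \<Rightarrow> (nat \<Rightarrow> nat \<Rightarrow> 'v::euclidean_space) \<Rightarrow> nat \<Rightarrow> 'v \<Rightarrow> real"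
  where "free_energy k x n \<theta> =
    ln ((\<Sum>j\<in>{1..k n}. exp (real n * (\<theta> \<bullet> x n j))) / real (k n)) / real n"

lemma exp_free_energy:
  assumes "n \<ge> 1" "k n > 0"
  shows "exp (real n * free_energy k x n \<theta>) = (\<Sum>j\<in>{1..k n}. exp (real n * (\<theta> \<bullet> x n j))) / real (k n)"
proof -
  have "(\<Sum>j\<in>{1..k n}. exp (real n * (\<theta> \<bullet> x n j))) > 0"
    by (rule sum_pos) (use assms in auto)
  then show ?thesis using assms by (simp add: free_energy_def)
qed

text \<open>A single summand is at most the whole sum.\<close>

lemma inner_le_free_energy:
  assumes "n \<ge> 1" "j \<in> {1..k n}"
  shows "\<theta> \<bullet> x n j \<le> ln (real (k n)) / real n + free_energy k x n \<theta>"
proof -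
  have k: "k n > 0" using assms by auto
  have "exp (real n * (\<theta> \<bullet> x n j)) \<le> (\<Sum>j\<in>{1..k n}. exp (real n * (\<theta> \<bullet> x n j)))"
    by (rule member_le_sum) (use assms in auto)
  also have "\<dots> = real (k n) * exp (real n * free_energy k x n \<theta>)"
    using exp_free_energy[of n k x \<theta>, OF assms(1) k] k by simp
  also have "\<dots> = exp (ln (real (k n)) + real n * free_energy k x n \<theta>)"
    using k by (simp add: exp_add)
  finally show ?thesis using assms by (simp add: field_simps)
qed

text \<open>
  Convexity in \<open>\<theta>\<close> without Hoelder's inequality: after normalising the two exponential sums to
  \<open>1\<close>, convexity of \<open>exp\<close> bounds the intermediate one by \<open>1\<close>.
\<close>

lemma convex_on_free_energy:
  assumes k: "\<And>n. n \<ge> 1 \<Longrightarrow> k n > 0"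
  shows "convex_on UNIV (free_energy k x n)"
proof (cases "n = 0")
  case True
  \<comment> \<open>division by \<open>0\<close>\<close>
  then have "free_energy k x n = (\<lambda>_. 0)" by (simp add: free_energy_def fun_eq_iff)
  then show ?thesis by (simp add: convex_on_const)
next
  case False
  then have n: "n \<ge> 1" by simp
  let ?F = "free_energy k x n"
  have Z: "(\<Sum>j\<in>{1..k n}. exp (real n * (\<theta> \<bullet> x n j))) = real (k n) * exp (real n * ?F \<theta>)" for \<theta>
    using k[OF n] exp_free_energy[of n k x, OF n k[OF n]] by simp
  show ?thesis
  proof (rule convex_onI)
    fix u :: real and a b :: 'a assume u: "0 < u" "u < 1"
    define c where "c = (1 - u) *\<^sub>R a + u *\<^sub>R b"
    define m where "m = (1 - u) * ?F a + u * ?F b"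
    have "exp (real n * (c \<bullet> y)) / exp (real n * m)
        \<le> (1 - u) * (exp (real n * (a \<bullet> y)) / exp (real n * ?F a))
          + u * (exp (real n * (b \<bullet> y)) / exp (real n * ?F b))" for y
    proof -
      have "exp (real n * (c \<bullet> y)) / exp (real n * m)
        = exp ((1 - u) *\<^sub>R (real n * (a \<bullet> y) - real n * ?F a) + u *\<^sub>R (real n * (b \<bullet> y) - real n * ?F b))"
        unfolding exp_diff[symmetric] c_def m_def by (simp add: inner_add_left algebra_simps)
      also have "\<dots> \<le> (1 - u) * exp (real n * (a \<bullet> y) - real n * ?F a)
          + u * exp (real n * (b \<bullet> y) - real n * ?F b)"
        by (rule convex_onD[OF exp_convex]) (use u in auto)
      finally show ?thesis by (simp add: exp_diff)
    qed
    then have "(\<Sum>j\<in>{1..k n}. exp (real n * (c \<bullet> x n j)) / exp (real n * m))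
        \<le> (\<Sum>j\<in>{1..k n}. (1 - u) * (exp (real n * (a \<bullet> x n j)) / exp (real n * ?F a))
          + u * (exp (real n * (b \<bullet> x n j)) / exp (real n * ?F b)))"
      by (intro sum_mono)
    also have "\<dots> = (1 - u) * ((\<Sum>j\<in>{1..k n}. exp (real n * (a \<bullet> x n j))) / exp (real n * ?F a))
          + u * ((\<Sum>j\<in>{1..k n}. exp (real n * (b \<bullet> x n j))) / exp (real n * ?F b))"
      by (simp add: sum.distrib sum_distrib_left sum_divide_distrib)
    also have "\<dots> = real (k n)"
      unfolding Z by (simp add: algebra_simps)
    finally have "(\<Sum>j\<in>{1..k n}. exp (real n * (c \<bullet> x n j))) / real (k n) \<le> exp (real n * m)"
      using k[OF n] by (simp add: field_simps flip: sum_divide_distrib)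
    then have "exp (real n * ?F c) \<le> exp (real n * m)"
      using exp_free_energy[of n k x, OF n k[OF n]] by simp
    then show "?F ((1 - u) *\<^sub>R a + u *\<^sub>R b) \<le> (1 - u) * ?F a + u * ?F b"
      using n unfolding c_def m_def by simp
  qed simp
qed

lemma exp_scale_mono: "a \<le> b \<Longrightarrow> exp (real n * a) \<le> exp (real n * b)"
  by (simp add: mult_left_mono)

lemma eventually_le_exp:
  fixes a C :: real
  assumes "a > 0"
  shows "\<forall>\<^sub>F n in sequentially. C \<le> exp (real n * a)"
proof -
  obtain N :: nat where N: "C / a < real N" using reals_Archimedean2 by blast
  show ?thesis
    using eventually_ge_at_top[of N]
  proof eventually_elim
    case (elim n)
    have "C < real N * a" using N assms by (simp add: field_simps)
    also have "\<dots> \<le> real n * a" using elim assms by simp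
    also have "\<dots> \<le> exp (real n * a)" using exp_ge_add_one_self[of "real n * a"] by linarith
    finally show ?case by simp
  qed
qed

text \<open>
  Chernoff tilting: the weight \<open>exp (n \<theta>\<^sub>0 \<bullet> x)\<close> of the points at distance more than \<open>\<epsilon>\<close> from \<open>x\<^sub>0\<close> is
  dominated by the partition functions at the parameters \<open>\<theta>\<^sub>0 + \<delta> u\<close>, where \<open>u\<close> runs over the
  coordinate directions. Differentiability makes these exponentially smaller than the total
  weight, so the points near \<open>x\<^sub>0\<close> carry it.
\<close>

lemma card_near_gradient_ge:
  fixes x :: "nat \<Rightarrow> nat \<Rightarrow> 'v::euclidean_space"
  assumes k: "\<And>n. n \<ge> 1 \<Longrightarrow> k n > 0"
    and lim: "r > 0" "\<And>\<theta>. \<theta> \<in> cball \<theta>\<^sub>0 r \<Longrightarrow> (\<lambda>n. free_energy k x n \<theta>) \<longlonglongrightarrow> g \<theta>"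
    and D: "GDERIV g \<theta>\<^sub>0 :> x\<^sub>0" and \<epsilon>: "\<epsilon> > 0" and \<eta>: "\<eta> > 0"
  shows "\<forall>\<^sub>F n in sequentially. exp (- (real n * (\<theta>\<^sub>0 \<bullet> x\<^sub>0 - g \<theta>\<^sub>0 + \<epsilon> * norm \<theta>\<^sub>0 + \<eta>)))
    \<le> real (card {j \<in> {1..k n}. x n j \<in> cball x\<^sub>0 \<epsilon>}) / real (k n)"
proof -
  let ?F = "free_energy k x"
  define B :: "'v set" where "B = Basis \<union> uminus ` Basis"
  have B: "finite B" and norm_B: "\<And>u. u \<in> B \<Longrightarrow> norm u = 1" by (auto simp: B_def)
  \<comment> \<open>a vector of norm larger than \<open>\<epsilon>\<close> has a coordinate of modulus larger than \<open>e\<close>\<close>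
  define e where "e = \<epsilon> / real DIM('v)"
  have e: "e > 0" using \<epsilon> by (simp add: e_def)
  obtain d where d: "d > 0" "\<And>y. norm (y - \<theta>\<^sub>0) < d \<Longrightarrow>
      norm (g y - g \<theta>\<^sub>0 - (y - \<theta>\<^sub>0) \<bullet> x\<^sub>0) \<le> e / 4 * norm (y - \<theta>\<^sub>0)"
    using D e unfolding gderiv_def has_derivative_at_alt by (metis divide_pos_pos zero_less_numeral)
  define \<delta> where "\<delta> = min (d / 2) r"
  have \<delta>: "\<delta> > 0" "\<delta> < d" "\<delta> \<le> r" using d(1) lim(1) by (auto simp: \<delta>_def)
  define a where "a = \<delta> * e"
  have a: "a > 0" using \<delta> e by (simp add: a_def)
  have tilt: "g (\<theta>\<^sub>0 + \<delta> *\<^sub>R u) - \<delta> * (u \<bullet> x\<^sub>0) - a < g \<theta>\<^sub>0 - a / 2" if "u \<in> B" for u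
  proof -
    have "norm (\<delta> *\<^sub>R u) = \<delta>" using norm_B[OF that] \<delta>(1) by simp
    then have "\<bar>g (\<theta>\<^sub>0 + \<delta> *\<^sub>R u) - g \<theta>\<^sub>0 - \<delta> * (u \<bullet> x\<^sub>0)\<bar> \<le> a / 4"
      using d(2)[of "\<theta>\<^sub>0 + \<delta> *\<^sub>R u"] \<delta>(2) by (simp add: a_def mult_ac)
    then show ?thesis using a by linarith
  qed
  define \<eta>' where "\<eta>' = min (\<eta> / 2) (a / 4)"
  have \<eta>': "\<eta>' > 0" "\<eta>' \<le> \<eta> / 2" "\<eta>' \<le> a / 4" using \<eta> a by (auto simp: \<eta>'_def)
  have split: "exp (real n * ?F n \<theta>\<^sub>0)
      \<le> real (card {j \<in> {1..k n}. x n j \<in> cball x\<^sub>0 \<epsilon>}) / real (k n)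
          * exp (real n * (\<theta>\<^sub>0 \<bullet> x\<^sub>0 + \<epsilon> * norm \<theta>\<^sub>0))
        + (\<Sum>u\<in>B. exp (real n * (?F n (\<theta>\<^sub>0 + \<delta> *\<^sub>R u) - \<delta> * (u \<bullet> x\<^sub>0) - a)))" if n: "n \<ge> 1" for n
  proof -
    let ?E = "exp (real n * (\<theta>\<^sub>0 \<bullet> x\<^sub>0 + \<epsilon> * norm \<theta>\<^sub>0))"
    let ?t = "\<lambda>u y. exp (real n * ((\<theta>\<^sub>0 + \<delta> *\<^sub>R u) \<bullet> y)) * exp (- (real n * (\<delta> * (u \<bullet> x\<^sub>0) + a)))"
    have pt: "exp (real n * (\<theta>\<^sub>0 \<bullet> y)) \<le> (if y \<in> cball x\<^sub>0 \<epsilon> then ?E else 0) + (\<Sum>u\<in>B. ?t u y)" for y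
    proof (cases "y \<in> cball x\<^sub>0 \<epsilon>")
      case True
      have "\<theta>\<^sub>0 \<bullet> (y - x\<^sub>0) \<le> norm \<theta>\<^sub>0 * norm (y - x\<^sub>0)" by (rule norm_cauchy_schwarz)
      also have "\<dots> \<le> norm \<theta>\<^sub>0 * \<epsilon>"
        using True by (intro mult_left_mono) (auto simp: dist_norm norm_minus_commute)
      finally have "\<theta>\<^sub>0 \<bullet> y \<le> \<theta>\<^sub>0 \<bullet> x\<^sub>0 + \<epsilon> * norm \<theta>\<^sub>0" by (simp add: inner_diff_right mult.commute)
      then have "exp (real n * (\<theta>\<^sub>0 \<bullet> y)) \<le> ?E" by (simp add: mult_left_mono)
      moreover have "0 \<le> (\<Sum>u\<in>B. ?t u y)" by (rule sum_nonneg) simp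
      ultimately show ?thesis using True by (simp only: if_True)
    next
      case False
      have "\<exists>u\<in>B. u \<bullet> (y - x\<^sub>0) > e"
      proof (rule ccontr)
        assume "\<not> ?thesis"
        then have small: "u \<bullet> (y - x\<^sub>0) \<le> e" if "u \<in> B" for u using that by (auto simp: not_less)
        have "b \<bullet> (y - x\<^sub>0) \<le> e \<and> (- b) \<bullet> (y - x\<^sub>0) \<le> e" if "b \<in> Basis" for b
          using small[of b] small[of "- b"] that by (simp add: B_def)
        then have "\<And>b. b \<in> Basis \<Longrightarrow> \<bar>(y - x\<^sub>0) \<bullet> b\<bar> \<le> e"
          by (auto simp: inner_commute abs_le_iff)
        then have "(\<Sum>b\<in>Basis. \<bar>(y - x\<^sub>0) \<bullet> b\<bar>) \<le> real DIM('v) * e"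
          by (intro order_trans[OF sum_bounded_above[where K = e]]) auto
        then have "norm (y - x\<^sub>0) \<le> \<epsilon>"
          using norm_le_l1[of "y - x\<^sub>0"] by (simp add: e_def)
        with False show False by (simp add: dist_norm norm_minus_commute)
      qed
      then obtain u where u: "u \<in> B" "u \<bullet> (y - x\<^sub>0) > e" by blast
      have "a \<le> \<delta> * (u \<bullet> (y - x\<^sub>0))"
        unfolding a_def using u(2) \<delta>(1) by (intro mult_left_mono) auto
      then have "\<theta>\<^sub>0 \<bullet> y \<le> (\<theta>\<^sub>0 + \<delta> *\<^sub>R u) \<bullet> y - (\<delta> * (u \<bullet> x\<^sub>0) + a)"
        by (simp add: inner_diff_right inner_add_left algebra_simps)
      then have "real n * (\<theta>\<^sub>0 \<bullet> y) \<le> real n * ((\<theta>\<^sub>0 + \<delta> *\<^sub>R u) \<bullet> y - (\<delta> * (u \<bullet> x\<^sub>0) + a))"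
        by (intro mult_left_mono) simp_all
      then have "exp (real n * (\<theta>\<^sub>0 \<bullet> y)) \<le> ?t u y"
        unfolding exp_add[symmetric] by (simp add: right_diff_distrib)
      also have "\<dots> \<le> (\<Sum>u\<in>B. ?t u y)"
        by (rule member_le_sum) (use u(1) B in auto)
      finally show ?thesis using False by simp
    qed
    have "(\<Sum>j\<in>{1..k n}. exp (real n * (\<theta>\<^sub>0 \<bullet> x n j)))
        \<le> (\<Sum>j\<in>{1..k n}. (if x n j \<in> cball x\<^sub>0 \<epsilon> then ?E else 0) + (\<Sum>u\<in>B. ?t u (x n j)))"
      by (intro sum_mono pt)
    also have "\<dots> = real (card {j \<in> {1..k n}. x n j \<in> cball x\<^sub>0 \<epsilon>}) * ?E
        + (\<Sum>u\<in>B. (\<Sum>j\<in>{1..k n}. exp (real n * ((\<theta>\<^sub>0 + \<delta> *\<^sub>R u) \<bullet> x n j)))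
            * exp (- (real n * (\<delta> * (u \<bullet> x\<^sub>0) + a))))"
      unfolding sum.distrib sum.swap[of _ B] sum_distrib_right
      by (simp add: sum.If_cases Int_def)
    finally have "(\<Sum>j\<in>{1..k n}. exp (real n * (\<theta>\<^sub>0 \<bullet> x n j))) / real (k n)
        \<le> (real (card {j \<in> {1..k n}. x n j \<in> cball x\<^sub>0 \<epsilon>}) * ?E
          + (\<Sum>u\<in>B. (\<Sum>j\<in>{1..k n}. exp (real n * ((\<theta>\<^sub>0 + \<delta> *\<^sub>R u) \<bullet> x n j)))
            * exp (- (real n * (\<delta> * (u \<bullet> x\<^sub>0) + a))))) / real (k n)"
      by (rule divide_right_mono) simp
    also have "\<dots> = real (card {j \<in> {1..k n}. x n j \<in> cball x\<^sub>0 \<epsilon>}) / real (k n) * ?E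
        + (\<Sum>u\<in>B. (\<Sum>j\<in>{1..k n}. exp (real n * ((\<theta>\<^sub>0 + \<delta> *\<^sub>R u) \<bullet> x n j))) / real (k n)
            * exp (- (real n * (\<delta> * (u \<bullet> x\<^sub>0) + a))))"
      unfolding add_divide_distrib sum_divide_distrib[of _ B] by simp
    finally have "(\<Sum>j\<in>{1..k n}. exp (real n * (\<theta>\<^sub>0 \<bullet> x n j))) / real (k n)
        \<le> real (card {j \<in> {1..k n}. x n j \<in> cball x\<^sub>0 \<epsilon>}) / real (k n) * ?E
        + (\<Sum>u\<in>B. (\<Sum>j\<in>{1..k n}. exp (real n * ((\<theta>\<^sub>0 + \<delta> *\<^sub>R u) \<bullet> x n j))) / real (k n)
            * exp (- (real n * (\<delta> * (u \<bullet> x\<^sub>0) + a))))" .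
    then show ?thesis
      unfolding exp_free_energy[of n k x, OF n k[OF n], symmetric] exp_add[symmetric]
      by (simp add: algebra_simps)
  qed
  have ev_tilt: "\<forall>\<^sub>F n in sequentially. \<forall>u\<in>B. ?F n (\<theta>\<^sub>0 + \<delta> *\<^sub>R u) - \<delta> * (u \<bullet> x\<^sub>0) - a < g \<theta>\<^sub>0 - a / 2"
  proof (rule eventually_ball_finite[OF B], intro ballI)
    fix u assume u: "u \<in> B"
    have "\<theta>\<^sub>0 + \<delta> *\<^sub>R u \<in> cball \<theta>\<^sub>0 r"
      using norm_B[OF u] \<delta> by (simp add: dist_norm)
    then have "(\<lambda>n. ?F n (\<theta>\<^sub>0 + \<delta> *\<^sub>R u) - \<delta> * (u \<bullet> x\<^sub>0) - a) \<longlonglongrightarrow> g (\<theta>\<^sub>0 + \<delta> *\<^sub>R u) - \<delta> * (u \<bullet> x\<^sub>0) - a"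
      by (intro tendsto_intros lim(2))
    then show "\<forall>\<^sub>F n in sequentially. ?F n (\<theta>\<^sub>0 + \<delta> *\<^sub>R u) - \<delta> * (u \<bullet> x\<^sub>0) - a < g \<theta>\<^sub>0 - a / 2"
      by (rule order_tendstoD(2)) (rule tilt[OF u])
  qed
  have ev0: "\<forall>\<^sub>F n in sequentially. g \<theta>\<^sub>0 - \<eta>' < ?F n \<theta>\<^sub>0"
    by (rule order_tendstoD(1)[OF lim(2)]) (use lim(1) \<eta>' in auto)
  have ev1: "\<forall>\<^sub>F n in sequentially. 2 * real (card B) \<le> exp (real n * (a / 4))"
    by (rule eventually_le_exp) (use a in simp)
  have ev2: "\<forall>\<^sub>F n in sequentially. 2 \<le> exp (real n * (\<eta> / 2))"
    by (rule eventually_le_exp) (use \<eta> in simp)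
  show ?thesis
    using ev_tilt ev0 ev1 ev2 eventually_ge_at_top[of 1]
  proof eventually_elim
    case (elim n)
    let ?\<mu> = "real (card {j \<in> {1..k n}. x n j \<in> cball x\<^sub>0 \<epsilon>}) / real (k n)"
    let ?m = "exp (real n * (g \<theta>\<^sub>0 - \<eta>'))"
    have "(\<Sum>u\<in>B. exp (real n * (?F n (\<theta>\<^sub>0 + \<delta> *\<^sub>R u) - \<delta> * (u \<bullet> x\<^sub>0) - a)))
        \<le> (\<Sum>u\<in>B. exp (real n * (g \<theta>\<^sub>0 - a / 2)))"
      using elim(1) by (intro sum_mono exp_scale_mono) (auto intro: less_imp_le)
    also have "\<dots> = real (card B) * exp (real n * (g \<theta>\<^sub>0 - a / 2))" by simp
    also have "\<dots> \<le> exp (real n * (a / 4)) / 2 * exp (real n * (g \<theta>\<^sub>0 - a / 2))"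
      using elim(3) by (intro mult_right_mono) auto
    also have "\<dots> = exp (real n * (g \<theta>\<^sub>0 - a / 4)) / 2"
      by (simp add: algebra_simps flip: exp_add)
    also have "\<dots> \<le> ?m / 2"
      using \<eta>'(3) by (auto intro!: mult_left_mono)
    finally have out: "(\<Sum>u\<in>B. exp (real n * (?F n (\<theta>\<^sub>0 + \<delta> *\<^sub>R u) - \<delta> * (u \<bullet> x\<^sub>0) - a))) \<le> ?m / 2" .
    have "?m \<le> exp (real n * ?F n \<theta>\<^sub>0)"
      using elim(2) by (auto intro!: mult_left_mono)
    then have "?m / 2 \<le> ?\<mu> * exp (real n * (\<theta>\<^sub>0 \<bullet> x\<^sub>0 + \<epsilon> * norm \<theta>\<^sub>0))"
      using split[OF elim(5)] out by linarith
    then have "?m / 2 * exp (- (real n * (\<theta>\<^sub>0 \<bullet> x\<^sub>0 + \<epsilon> * norm \<theta>\<^sub>0)))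
        \<le> ?\<mu> * exp (real n * (\<theta>\<^sub>0 \<bullet> x\<^sub>0 + \<epsilon> * norm \<theta>\<^sub>0)) * exp (- (real n * (\<theta>\<^sub>0 \<bullet> x\<^sub>0 + \<epsilon> * norm \<theta>\<^sub>0)))"
      by (rule mult_right_mono) simp
    also have "\<dots> = ?\<mu>" by (simp add: exp_minus)
    finally have main: "?m / 2 * exp (- (real n * (\<theta>\<^sub>0 \<bullet> x\<^sub>0 + \<epsilon> * norm \<theta>\<^sub>0))) \<le> ?\<mu>" .
    have half: "exp (real n * (g \<theta>\<^sub>0 - \<eta>)) \<le> ?m / 2"
    proof -
      have "2 * exp (real n * (g \<theta>\<^sub>0 - \<eta>)) \<le> exp (real n * (\<eta> / 2)) * exp (real n * (g \<theta>\<^sub>0 - \<eta>))"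
        using elim(4) by (intro mult_right_mono) auto
      also have "\<dots> = exp (real n * (g \<theta>\<^sub>0 - \<eta> / 2))"
        by (simp add: algebra_simps flip: exp_add)
      also have "\<dots> \<le> ?m"
        using \<eta>'(2) by (intro exp_scale_mono) simp
      finally show ?thesis by simp
    qed
    have "exp (- (real n * (\<theta>\<^sub>0 \<bullet> x\<^sub>0 - g \<theta>\<^sub>0 + \<epsilon> * norm \<theta>\<^sub>0 + \<eta>)))
        = exp (real n * (g \<theta>\<^sub>0 - \<eta>)) * exp (- (real n * (\<theta>\<^sub>0 \<bullet> x\<^sub>0 + \<epsilon> * norm \<theta>\<^sub>0)))"
      by (simp add: algebra_simps flip: exp_add)
    also have "\<dots> \<le> ?m / 2 * exp (- (real n * (\<theta>\<^sub>0 \<bullet> x\<^sub>0 + \<epsilon> * norm \<theta>\<^sub>0)))"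
      by (rule mult_right_mono[OF half]) simp
    finally show ?case using main by (rule order_trans)
  qed
qed

lemma card_near_le:
  fixes x :: "nat \<Rightarrow> nat \<Rightarrow> 'v::euclidean_space"
  assumes n: "n \<ge> 1" "k n > 0"
  shows "real (card {j \<in> {1..k n}. x n j \<in> cball x\<^sub>0 \<epsilon>}) / real (k n)
    \<le> exp (real n * (free_energy k x n \<theta> - \<theta> \<bullet> x\<^sub>0 + \<epsilon> * norm \<theta>))"
proof -
  let ?J = "{j \<in> {1..k n}. x n j \<in> cball x\<^sub>0 \<epsilon>}"
  let ?E = "exp (real n * (\<theta> \<bullet> x\<^sub>0 - \<epsilon> * norm \<theta>))"
  have near: "\<theta> \<bullet> x\<^sub>0 - \<epsilon> * norm \<theta> \<le> \<theta> \<bullet> x n j" if "j \<in> ?J" for j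
  proof -
    have "\<theta> \<bullet> (x\<^sub>0 - x n j) \<le> norm \<theta> * norm (x\<^sub>0 - x n j)" by (rule norm_cauchy_schwarz)
    also have "\<dots> \<le> norm \<theta> * \<epsilon>"
      using that by (intro mult_left_mono) (auto simp: dist_norm)
    finally show ?thesis by (simp add: inner_diff_right mult.commute)
  qed
  have "real (card ?J) * ?E = (\<Sum>j\<in>?J. ?E)" by simp
  also have "\<dots> \<le> (\<Sum>j\<in>?J. exp (real n * (\<theta> \<bullet> x n j)))"
    using near by (intro sum_mono) (auto intro!: mult_left_mono)
  also have "\<dots> \<le> (\<Sum>j\<in>{1..k n}. exp (real n * (\<theta> \<bullet> x n j)))"
    by (rule sum_mono2) auto
  finally have "real (card ?J) / real (k n) * ?E \<le> exp (real n * free_energy k x n \<theta>)"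
    unfolding exp_free_energy[of n k x, OF n] using n by (simp add: divide_right_mono)
  then have "real (card ?J) / real (k n) \<le> exp (real n * free_energy k x n \<theta>) / ?E"
    by (simp add: pos_le_divide_eq)
  also have "\<dots> = exp (real n * (free_energy k x n \<theta> - \<theta> \<bullet> x\<^sub>0 + \<epsilon> * norm \<theta>))"
    unfolding exp_diff[symmetric] by (simp add: algebra_simps)
  finally show ?thesis .
qed

lemma free_energy_scale_le:
  fixes x :: "nat \<Rightarrow> nat \<Rightarrow> 'v::euclidean_space"
  assumes n: "n \<ge> 1" "k n > 0" and t: "t \<ge> 1"
  shows "free_energy k x n (t *\<^sub>R \<theta>)
    \<le> free_energy k x n \<theta> + (t - 1) * (ln (real (k n)) / real n + free_energy k x n \<theta>)"
proof -
  define m where "m = ln (real (k n)) / real n + free_energy k x n \<theta>"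
  have "exp (real n * free_energy k x n (t *\<^sub>R \<theta>))
      = (\<Sum>j\<in>{1..k n}. exp (real n * ((t *\<^sub>R \<theta>) \<bullet> x n j))) / real (k n)"
    by (rule exp_free_energy) fact+
  also have "\<dots> \<le> (\<Sum>j\<in>{1..k n}. exp (real n * (\<theta> \<bullet> x n j)) * exp (real n * ((t - 1) * m))) / real (k n)"
  proof (intro divide_right_mono sum_mono)
    fix j assume "j \<in> {1..k n}"
    then have "\<theta> \<bullet> x n j \<le> m" using inner_le_free_energy[of n j k \<theta> x] n(1) by (simp add: m_def)
    then have "(t - 1) * (\<theta> \<bullet> x n j) \<le> (t - 1) * m" using t by (intro mult_left_mono) auto
    then have "real n * ((t *\<^sub>R \<theta>) \<bullet> x n j) \<le> real n * (\<theta> \<bullet> x n j + (t - 1) * m)"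
      by (intro mult_left_mono) (auto simp: algebra_simps)
    then show "exp (real n * ((t *\<^sub>R \<theta>) \<bullet> x n j)) \<le> exp (real n * (\<theta> \<bullet> x n j)) * exp (real n * ((t - 1) * m))"
      by (simp add: distrib_left flip: exp_add)
  qed simp
  also have "\<dots> = exp (real n * free_energy k x n \<theta>) * exp (real n * ((t - 1) * m))"
    unfolding exp_free_energy[of n k x, OF n] by (simp add: sum_distrib_right)
  also have "\<dots> = exp (real n * (free_energy k x n \<theta> + (t - 1) * m))"
    by (simp add: distrib_left exp_add)
  finally show ?thesis using n unfolding m_def by simp
qed

text \<open>
  Freezing. At the critical growth of \<open>k\<close> the largest value of \<open>\<theta> \<bullet> x n j\<close> is asymptotically at most
  \<open>v\<close>, which bounds the slope beyond \<open>t = 1\<close> from above; convexity propagates the slopes at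
  parameters below \<open>1\<close>, which tend to \<open>v\<close> as well, and bounds it from below.
\<close>

lemma free_energy_freezes:
  fixes x :: "nat \<Rightarrow> nat \<Rightarrow> 'v::euclidean_space"
  assumes k: "\<And>n. n \<ge> 1 \<Longrightarrow> k n > 0"
    and growth: "(\<lambda>n. ln (real (k n)) / real n) \<longlonglongrightarrow> v - \<phi> 1"
    and upper: "\<And>\<eta>. \<eta> > 0 \<Longrightarrow> \<forall>\<^sub>F n in sequentially. free_energy k x n \<theta> \<le> \<phi> 1 + \<eta>"
    and below: "\<forall>\<^sub>F m in sequentially. \<forall>t\<in>{1 - 1 / real m, 1 - 2 / real m}.
      (\<lambda>n. free_energy k x n (t *\<^sub>R \<theta>)) \<longlonglongrightarrow> \<phi> t"
    and deriv: "(\<phi> has_real_derivative v) (at 1)"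
    and t: "t \<ge> 1"
  shows "(\<lambda>n. free_energy k x n (t *\<^sub>R \<theta>)) \<longlonglongrightarrow> \<phi> 1 + (t - 1) * v"
proof (rule order_tendstoI)
  let ?F = "free_energy k x"
  fix a assume a: "\<phi> 1 + (t - 1) * v < a"
  define \<eta> where "\<eta> = (a - (\<phi> 1 + (t - 1) * v)) / (2 * t)"
  have \<eta>: "\<eta> > 0" using a t by (simp add: \<eta>_def)
  have "\<forall>\<^sub>F n in sequentially. ln (real (k n)) / real n < v - \<phi> 1 + \<eta>"
    by (rule order_tendstoD(2)[OF growth]) (use \<eta> in simp)
  with upper[OF \<eta>] eventually_ge_at_top[of 1]
  show "\<forall>\<^sub>F n in sequentially. ?F n (t *\<^sub>R \<theta>) < a"
  proof eventually_elim
    case (elim n)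
    have "?F n (t *\<^sub>R \<theta>) \<le> ?F n \<theta> + (t - 1) * (ln (real (k n)) / real n + ?F n \<theta>)"
      by (rule free_energy_scale_le) (use elim k t in auto)
    also have "\<dots> \<le> (\<phi> 1 + \<eta>) + (t - 1) * ((v - \<phi> 1 + \<eta>) + (\<phi> 1 + \<eta>))"
      using elim t by (intro add_mono mult_left_mono) auto
    also have "\<dots> = \<phi> 1 + (t - 1) * v + (2 * t) * \<eta> - \<eta>" by (simp add: algebra_simps)
    also have "\<dots> < a" using \<eta> t by (simp add: \<eta>_def)
    finally show ?case .
  qed
next
  let ?F = "free_energy k x"
  fix a assume a: "a < \<phi> 1 + (t - 1) * v"
  \<comment> \<open>the value at \<open>t\<close> of the secant of \<open>\<phi>\<close> through \<open>1 - 2 h\<close> and \<open>1 - h\<close>\<close>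
  define L where "L h = \<phi> (1 - h) + (t - (1 - h)) * ((\<phi> (1 - h) - \<phi> (1 - 2 * h)) / h)" for h
  have inv: "(\<lambda>m. 1 / real m) \<longlonglongrightarrow> 0" by (rule lim_1_over_n)
  have quot: "(\<lambda>m. (\<phi> (1 - c / real m) - \<phi> 1) / (- (c / real m))) \<longlonglongrightarrow> v" if "c > 0" for c
  proof -
    have "((\<lambda>h. (\<phi> (1 + h) - \<phi> 1) / h) \<longlongrightarrow> v) (at 0)"
      using deriv by (simp add: DERIV_def)
    moreover have "filterlim (\<lambda>m. - (c / real m)) (at 0) sequentially"
      unfolding filterlim_at
    proof
      show "\<forall>\<^sub>F m in sequentially. - (c / real m) \<in> UNIV \<and> - (c / real m) \<noteq> 0"
        using eventually_gt_at_top[of 0] by eventually_elim (use that in simp)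
      show "(\<lambda>m. - (c / real m)) \<longlonglongrightarrow> 0"
        using tendsto_mult[OF tendsto_const[of "- c"] inv] by simp
    qed
    ultimately show ?thesis
      using filterlim_compose[of "\<lambda>h. (\<phi> (1 + h) - \<phi> 1) / h" "nhds v" "at 0"] by force
  qed
  have "isCont \<phi> 1" using deriv by (rule DERIV_isCont)
  then have cont: "(\<lambda>m. \<phi> (1 - 1 / real m)) \<longlonglongrightarrow> \<phi> 1"
    by (rule isCont_tendsto_compose) (use tendsto_diff[OF tendsto_const[of 1] inv] in simp)
  have "(\<lambda>m. \<phi> (1 - 1 / real m) + (t - (1 - 1 / real m))
      * (2 * ((\<phi> (1 - 2 / real m) - \<phi> 1) / (- (2 / real m))) - (\<phi> (1 - 1 / real m) - \<phi> 1) / (- (1 / real m))))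
    \<longlonglongrightarrow> \<phi> 1 + (t - (1 - 0)) * (2 * v - v)"
    by (intro tendsto_intros cont inv quot) auto
  moreover have "\<forall>\<^sub>F m in sequentially. \<phi> (1 - 1 / real m) + (t - (1 - 1 / real m))
      * (2 * ((\<phi> (1 - 2 / real m) - \<phi> 1) / (- (2 / real m))) - (\<phi> (1 - 1 / real m) - \<phi> 1) / (- (1 / real m)))
    = L (1 / real m)"
    using eventually_gt_at_top[of 0] by eventually_elim (simp add: L_def field_simps)
  ultimately have "(\<lambda>m. L (1 / real m)) \<longlonglongrightarrow> \<phi> 1 + (t - 1) * v"
    using tendsto_cong by force
  from order_tendstoD(1)[OF this a] below eventually_gt_at_top[of 0]
  have "\<forall>\<^sub>F m in sequentially. a < L (1 / real m) \<and> m > 0 \<and>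
      (\<forall>t\<in>{1 - 1 / real m, 1 - 2 / real m}. (\<lambda>n. ?F n (t *\<^sub>R \<theta>)) \<longlonglongrightarrow> \<phi> t)"
    by eventually_elim simp
  from eventually_happens[OF this] obtain m where m: "a < L (1 / real m)" "m > 0"
    "(\<lambda>n. ?F n ((1 - 1 / real m) *\<^sub>R \<theta>)) \<longlonglongrightarrow> \<phi> (1 - 1 / real m)"
    "(\<lambda>n. ?F n ((1 - 2 / real m) *\<^sub>R \<theta>)) \<longlonglongrightarrow> \<phi> (1 - 2 / real m)"
    by auto
  define h where "h = 1 / real m"
  have h: "h > 0" using m(2) by (simp add: h_def)
  have "(\<lambda>n. ?F n ((1 - h) *\<^sub>R \<theta>) + (t - (1 - h)) * ((?F n ((1 - h) *\<^sub>R \<theta>) - ?F n ((1 - 2 * h) *\<^sub>R \<theta>)) / h))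
      \<longlonglongrightarrow> L h"
    unfolding L_def using m(3,4) h by (intro tendsto_intros) (auto simp: h_def)
  note lower = order_tendstoD(1)[OF this m(1)[folded h_def]]
  have cancel: "p + c / h \<le> q" if "h * p + c \<le> h * q" for p q c
    using that h by (simp add: field_simps)
  from lower
  show "\<forall>\<^sub>F n in sequentially. a < ?F n (t *\<^sub>R \<theta>)"
  proof eventually_elim
    case (elim n)
    define l where "l = t - 1 + 2 * h"
    have l: "l > 0" "h \<le> l" using h t by (auto simp: l_def)
    have "h / l \<ge> 0" "h / l \<le> 1" using h l by auto
    moreover have "(1 - h / l) *\<^sub>R ((1 - 2 * h) *\<^sub>R \<theta>) + (h / l) *\<^sub>R (t *\<^sub>R \<theta>) = (1 - h) *\<^sub>R \<theta>"
    proof -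
      have "(1 - h / l) * (1 - 2 * h) + h / l * t = 1 - h"
        using l(1) by (simp add: field_simps) (simp add: l_def algebra_simps)
      then show ?thesis by (simp flip: scaleR_add_left)
    qed
    ultimately have "?F n ((1 - h) *\<^sub>R \<theta>)
        \<le> (1 - h / l) * ?F n ((1 - 2 * h) *\<^sub>R \<theta>) + h / l * ?F n (t *\<^sub>R \<theta>)"
      using convex_onD[OF convex_on_free_energy[of k x n, OF k], of "h / l" "(1 - 2 * h) *\<^sub>R \<theta>" "t *\<^sub>R \<theta>"]
      by simp
    then have "l * ?F n ((1 - h) *\<^sub>R \<theta>) \<le> (l - h) * ?F n ((1 - 2 * h) *\<^sub>R \<theta>) + h * ?F n (t *\<^sub>R \<theta>)"
      using l(1) by (simp add: field_simps)
    then have "h * ?F n ((1 - h) *\<^sub>R \<theta>)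
        + (t - (1 - h)) * (?F n ((1 - h) *\<^sub>R \<theta>) - ?F n ((1 - 2 * h) *\<^sub>R \<theta>)) \<le> h * ?F n (t *\<^sub>R \<theta>)"
      by (simp add: l_def left_diff_distrib right_diff_distrib distrib_right)
    then have "?F n ((1 - h) *\<^sub>R \<theta>)
        + (t - (1 - h)) * ((?F n ((1 - h) *\<^sub>R \<theta>) - ?F n ((1 - 2 * h) *\<^sub>R \<theta>)) / h) \<le> ?F n (t *\<^sub>R \<theta>)"
      using cancel by simp
    then show ?case using elim by simp
  qed
qed

section \<open>Covariances of weakly dependent variables\<close>

lemma staircase_bounds:
  fixes u :: real
  assumes u: "0 \<le> u" "u \<le> 1" and N: "N > 0"
  shows "(\<Sum>i\<in>{1..N}. of_bool (real i / real N \<le> u)) / real N \<le> u"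
    and "u \<le> (\<Sum>i\<in>{1..N}. of_bool (real i / real N \<le> u)) / real N + 1 / real N"
proof -
  define c where "c = nat \<lfloor>u * real N\<rfloor>"
  have c: "real c \<le> u * real N" "u * real N < real c + 1"
    using u by (auto simp: c_def of_nat_nat floor_less_iff)
  have "c \<le> N"
    using c(1) u N by (metis mult.commute mult_left_le of_nat_0_le_iff of_nat_le_iff order_trans)
  have "real i / real N \<le> u \<longleftrightarrow> i \<le> c" for i
    using N u by (simp add: c_def le_nat_floor pos_divide_le_eq le_nat_iff le_floor_iff)
  then have "(\<Sum>i\<in>{1..N}. of_bool (real i / real N \<le> u)) = (\<Sum>i\<in>{1..N}. of_bool (i \<le> c) :: real)"
    by simp
  also have "\<dots> = real (card ({1..N} \<inter> {i. i \<le> c}))"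
    by (simp add: of_bool_def sum.If_cases)
  also have "{1..N} \<inter> {i. i \<le> c} = {1..c}" using \<open>c \<le> N\<close> by auto
  finally have "(\<Sum>i\<in>{1..N}. of_bool (real i / real N \<le> u)) = real c" by simp
  then show "(\<Sum>i\<in>{1..N}. of_bool (real i / real N \<le> u)) / real N \<le> u"
    and "u \<le> (\<Sum>i\<in>{1..N}. of_bool (real i / real N \<le> u)) / real N + 1 / real N"
    using c N by (simp_all add: field_simps)
qed

context prob_space
begin

lemma expectation_sum_indicator:
  assumes "\<And>i. i \<in> I \<Longrightarrow> A i \<in> events"
  shows "expectation (\<lambda>\<omega>. \<Sum>i\<in>I. indicator (A i) \<omega>) = (\<Sum>i\<in>I. prob (A i))"
proof -
  have "expectation (\<lambda>\<omega>. \<Sum>i\<in>I. indicat_real (A i) \<omega>) = (\<Sum>i\<in>I. expectation (indicator (A i)))"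
    using assms by (intro Bochner_Integration.integral_sum integrable_real_indicator)
      (simp_all add: emeasure_eq_measure)
  also have "\<dots> = (\<Sum>i\<in>I. prob (A i))"
    using assms sets.sets_into_space by (intro sum.cong) (auto simp: Int_absorb2)
  finally show ?thesis .
qed

text \<open>
  The staircase functions \<open>N\<inverse> \<Sum>\<^sub>i 1{U \<ge> i/N}\<close> approximate \<open>U\<close> from below within \<open>1/N\<close>, so a bound
  for the covariances of level sets passes to \<open>U\<close> and \<open>V\<close>.
\<close>

lemma expectation_mult_le_of_level_sets:
  fixes U V :: "'a \<Rightarrow> real"
  assumes [measurable]: "U \<in> borel_measurable M" "V \<in> borel_measurable M"
    and U: "\<And>\<omega>. 0 \<le> U \<omega>" "\<And>\<omega>. U \<omega> \<le> 1" and V: "\<And>\<omega>. 0 \<le> V \<omega>" "\<And>\<omega>. V \<omega> \<le> 1"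
    and level: "\<And>s t. prob ({\<omega>\<in>space M. s \<le> U \<omega>} \<inter> {\<omega>\<in>space M. t \<le> V \<omega>})
      \<le> prob {\<omega>\<in>space M. s \<le> U \<omega>} * prob {\<omega>\<in>space M. t \<le> V \<omega>} + a"
  shows "expectation (\<lambda>\<omega>. U \<omega> * V \<omega>) \<le> expectation U * expectation V + a"
proof (rule field_le_epsilon)
  fix e :: real assume e: "e > 0"
  obtain N :: nat where N: "N > 0" "3 / real N < e"
  proof -
    obtain N :: nat where "3 / e < real N" using reals_Archimedean2 by blast
    then show ?thesis using that[of N] e by (cases "N = 0") (auto simp: field_simps)
  qed
  define st where "st W = (\<lambda>\<omega>. (\<Sum>i\<in>{1..N}. of_bool (real i / real N \<le> W \<omega>)) / real N)"
    for W :: "'a \<Rightarrow> real"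
  have st: "st W \<omega> \<le> W \<omega>" "W \<omega> \<le> st W \<omega> + 1 / real N" if "0 \<le> W \<omega>" "W \<omega> \<le> 1" for W \<omega>
    unfolding st_def by (rule staircase_bounds[OF that N(1)])+
  have st_nonneg: "0 \<le> st W \<omega>" for W \<omega> unfolding st_def by (intro divide_nonneg_nonneg sum_nonneg) auto
  have st_ind: "st W \<omega> = (\<Sum>i\<in>{1..N}. indicator {\<omega>\<in>space M. real i / real N \<le> W \<omega>} \<omega>) / real N"
    if "\<omega> \<in> space M" for W \<omega>
    unfolding st_def using that by (intro arg_cong2[where f = "(/)"] sum.cong) (auto simp: indicator_def)
  have [measurable]: "st U \<in> borel_measurable M" "st V \<in> borel_measurable M"
    unfolding st_def by measurable
  have intg: "integrable M f" if "f \<in> borel_measurable M" "\<And>\<omega>. 0 \<le> f \<omega>" "\<And>\<omega>. f \<omega> \<le> 1" for f :: "'a \<Rightarrow> real"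
    by (rule integrable_const_bound[where B = 1]) (use that in auto)
  have st1: "st U \<omega> \<le> 1" "st V \<omega> \<le> 1" for \<omega>
    using st(1)[of U \<omega>] st(1)[of V \<omega>] U V by (meson order_trans)+
  have iU: "integrable M U" "integrable M V" "integrable M (st U)" "integrable M (st V)"
    using U V st1 st_nonneg by (auto intro!: intg)
  have iUV: "integrable M (\<lambda>\<omega>. U \<omega> * V \<omega>)" "integrable M (\<lambda>\<omega>. st U \<omega> * st V \<omega>)"
    using U V st1 st_nonneg by (auto intro!: intg mult_le_one)
  have E_st: "expectation (st W) = (\<Sum>i\<in>{1..N}. prob {\<omega>\<in>space M. real i / real N \<le> W \<omega>}) / real N"
    if [measurable]: "W \<in> borel_measurable M" for W
  proof -
    have "expectation (st W)
        = expectation (\<lambda>\<omega>. (\<Sum>i\<in>{1..N}. indicator {\<omega>\<in>space M. real i / real N \<le> W \<omega>} \<omega>) / real N)"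
      by (rule Bochner_Integration.integral_cong) (auto simp: st_ind)
    also have "\<dots> = expectation (\<lambda>\<omega>. \<Sum>i\<in>{1..N}. indicator {\<omega>\<in>space M. real i / real N \<le> W \<omega>} \<omega>) / real N"
      by (rule integral_divide_zero)
    also have "\<dots> = (\<Sum>i\<in>{1..N}. prob {\<omega>\<in>space M. real i / real N \<le> W \<omega>}) / real N"
      by (subst expectation_sum_indicator) auto
    finally show ?thesis .
  qed
  let ?C = "\<lambda>(i, j). {\<omega>\<in>space M. real i / real N \<le> U \<omega>} \<inter> {\<omega>\<in>space M. real j / real N \<le> V \<omega>}"
  have "st U \<omega> * st V \<omega> = (\<Sum>ij\<in>{1..N}\<times>{1..N}. indicator (?C ij) \<omega>) / (real N * real N)"
    if "\<omega> \<in> space M" for \<omega>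
    unfolding st_ind[OF that] times_divide_times_eq sum_product sum.cartesian_product
    by (simp only: indicator_inter_arith split_def)
  then have "expectation (\<lambda>\<omega>. st U \<omega> * st V \<omega>)
      = expectation (\<lambda>\<omega>. (\<Sum>ij\<in>{1..N}\<times>{1..N}. indicator (?C ij) \<omega>) / (real N * real N))"
    by (intro Bochner_Integration.integral_cong) auto
  also have "\<dots> = expectation (\<lambda>\<omega>. \<Sum>ij\<in>{1..N}\<times>{1..N}. indicator (?C ij) \<omega>) / (real N * real N)"
    by (rule integral_divide_zero)
  also have "\<dots> = (\<Sum>ij\<in>{1..N}\<times>{1..N}. prob (?C ij)) / (real N * real N)"
    by (subst expectation_sum_indicator) auto
  also have "\<dots> = (\<Sum>i\<in>{1..N}. \<Sum>j\<in>{1..N}. prob (?C (i, j))) / (real N * real N)"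
    by (simp only: sum.cartesian_product split_def prod.collapse)
  also have "\<dots> \<le> (\<Sum>i\<in>{1..N}. \<Sum>j\<in>{1..N}. prob {\<omega>\<in>space M. real i / real N \<le> U \<omega>}
          * prob {\<omega>\<in>space M. real j / real N \<le> V \<omega>} + a) / (real N * real N)"
    using level by (intro divide_right_mono sum_mono) auto
  also have "\<dots> = expectation (st U) * expectation (st V) + a"
    using N(1) by (simp add: E_st sum.distrib sum_product add_divide_distrib)
  finally have cov: "expectation (\<lambda>\<omega>. st U \<omega> * st V \<omega>) \<le> expectation (st U) * expectation (st V) + a" .
  have "U \<omega> * V \<omega> \<le> st U \<omega> * st V \<omega> + 3 / real N" for \<omega>
  proof -
    have "U \<omega> * V \<omega> \<le> (st U \<omega> + 1 / real N) * (st V \<omega> + 1 / real N)"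
      by (intro mult_mono st) (use U V st_nonneg in auto)
    also have "\<dots> = st U \<omega> * st V \<omega> + (st U \<omega> + st V \<omega> + 1 / real N) / real N"
      using N by (simp add: field_simps)
    also have "\<dots> \<le> st U \<omega> * st V \<omega> + 3 / real N"
    proof (intro add_left_mono divide_right_mono)
      have "1 / real N \<le> 1" using N(1) by simp
      then show "st U \<omega> + st V \<omega> + 1 / real N \<le> 3" using st1[of \<omega>] by linarith
    qed simp
    finally show ?thesis .
  qed
  then have "expectation (\<lambda>\<omega>. U \<omega> * V \<omega>) \<le> expectation (\<lambda>\<omega>. st U \<omega> * st V \<omega> + 3 / real N)"
    using iUV by (intro integral_mono) auto
  also have "\<dots> = expectation (\<lambda>\<omega>. st U \<omega> * st V \<omega>) + 3 / real N"
    using iUV by (simp add: prob_space)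
  also have "\<dots> \<le> expectation (st U) * expectation (st V) + a + e"
    using cov N(2) by linarith
  also have "expectation (st U) * expectation (st V) \<le> expectation U * expectation V"
    by (intro mult_mono integral_mono iU st integral_nonneg) (use U V st_nonneg in auto)
  finally show "expectation (\<lambda>\<omega>. U \<omega> * V \<omega>) \<le> expectation U * expectation V + a + e" by simp
qed

text \<open>
  Chebyshev's inequality. Pairs of indices closer than \<open>L\<close> contribute at most \<open>2 L K p\<close> to the
  second moment because the variables are at most \<open>1\<close>; the other pairs are nearly uncorrelated.
\<close>

lemma prob_sum_small_le:
  fixes U :: "nat \<Rightarrow> 'a \<Rightarrow> real"
  assumes meas: "\<And>j. j \<in> {1..K} \<Longrightarrow> U j \<in> borel_measurable M"
    and U: "\<And>j \<omega>. 0 \<le> U j \<omega>" "\<And>j \<omega>. U j \<omega> \<le> 1"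
    and p: "\<And>j. j \<in> {1..K} \<Longrightarrow> expectation (U j) = p" "p > 0" and K: "K > 0"
    and cov: "\<And>i j. i \<in> {1..K} \<Longrightarrow> j \<in> {1..K} \<Longrightarrow> i + L \<le> j \<Longrightarrow>
      expectation (\<lambda>\<omega>. U i \<omega> * U j \<omega>) \<le> p * p + a"
    and a: "a \<ge> 0"
  shows "prob {\<omega>\<in>space M. (\<Sum>j\<in>{1..K}. U j \<omega>) \<le> real K * p / 2}
    \<le> 8 * real L / (real K * p) + 4 * a / p\<^sup>2"
proof -
  define W where "W = (\<lambda>\<omega>. \<Sum>j\<in>{1..K}. U j \<omega>)"
  have [measurable]: "W \<in> borel_measurable M" unfolding W_def using meas by (intro borel_measurable_sum)
  have intg: "integrable M f" if "f \<in> borel_measurable M" "\<And>\<omega>. \<bar>f \<omega>\<bar> \<le> B" for f :: "'a \<Rightarrow> real" and B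
    by (rule integrable_const_bound[where B = B]) (use that in auto)
  have iU: "integrable M (U j)" if "j \<in> {1..K}" for j
    by (rule intg[of _ 1]) (use meas[OF that] U in auto)
  have iUU: "integrable M (\<lambda>\<omega>. U i \<omega> * U j \<omega>)" if "i \<in> {1..K}" "j \<in> {1..K}" for i j
    by (rule intg[of _ 1]) (use meas[OF that(1)] meas[OF that(2)] U in \<open>auto simp: abs_mult intro!: mult_le_one\<close>)
  have iW: "integrable M W" unfolding W_def using iU by (intro Bochner_Integration.integrable_sum)
  have EW: "expectation W = real K * p"
    unfolding W_def using iU p(1) by (simp add: Bochner_Integration.integral_sum)
  have WW: "(\<lambda>\<omega>. (W \<omega>)\<^sup>2) = (\<lambda>\<omega>. \<Sum>i\<in>{1..K}. \<Sum>j\<in>{1..K}. U i \<omega> * U j \<omega>)"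
    by (simp add: W_def power2_eq_square sum_product)
  have iWW: "integrable M (\<lambda>\<omega>. (W \<omega>)\<^sup>2)"
    unfolding WW using iUU by (intro Bochner_Integration.integrable_sum)
  have pair: "expectation (\<lambda>\<omega>. U i \<omega> * U j \<omega>) \<le> (p * p + a) + of_bool (i < j + L \<and> j < i + L) * p"
    if ij: "i \<in> {1..K}" "j \<in> {1..K}" for i j
  proof -
    consider "i + L \<le> j" | "j + L \<le> i" | "i < j + L" "j < i + L" by linarith
    then show ?thesis
    proof cases
      case 1 then show ?thesis using cov[OF ij] p(2) by simp
    next
      case 2 then show ?thesis using cov[OF ij(2,1)] p(2) by (simp add: mult.commute)
    next
      case 3
      have "expectation (\<lambda>\<omega>. U i \<omega> * U j \<omega>) \<le> expectation (U i)"
        by (intro integral_mono iU iUU ij) (use U in \<open>auto intro: mult_left_le\<close>)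
      moreover have "p * p + a \<ge> 0" using p(2) a by simp
      ultimately show ?thesis using 3 p(1)[OF ij(1)] by simp
    qed
  qed
  have row: "(\<Sum>j\<in>{1..K}. of_bool (i < j + L \<and> j < i + L) :: real) \<le> 2 * real L" for i
  proof -
    have "{1..K} \<inter> {j. i < j + L \<and> j < i + L} \<subseteq> {Suc i - L..<i + L}" by auto
    then have "card ({1..K} \<inter> {j. i < j + L \<and> j < i + L}) \<le> card {Suc i - L..<i + L}"
      by (rule card_mono[rotated]) simp
    also have "\<dots> \<le> 2 * L" by simp
    finally show ?thesis by (simp add: of_bool_def sum.If_cases)
  qed
  have "expectation (\<lambda>\<omega>. (W \<omega>)\<^sup>2) = (\<Sum>i\<in>{1..K}. \<Sum>j\<in>{1..K}. expectation (\<lambda>\<omega>. U i \<omega> * U j \<omega>))"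
    unfolding WW
    by (subst Bochner_Integration.integral_sum; (intro Bochner_Integration.integrable_sum iUU sum.cong refl)?;
        (subst Bochner_Integration.integral_sum)?; (intro iUU refl)?)
  also have "\<dots> \<le> (\<Sum>i\<in>{1..K}. \<Sum>j\<in>{1..K}. (p * p + a) + of_bool (i < j + L \<and> j < i + L) * p)"
    by (intro sum_mono pair)
  also have "\<dots> = (\<Sum>i\<in>{1..K}. real K * (p * p + a) + (\<Sum>j\<in>{1..K}. of_bool (i < j + L \<and> j < i + L)) * p)"
    by (intro sum.cong refl)
      (simp only: sum.distrib[of "\<lambda>_. p * p + a"] sum_distrib_right sum_constant card_atLeastAtMost, simp)
  also have "\<dots> \<le> (\<Sum>i\<in>{1..K}. real K * (p * p + a) + 2 * real L * p)"
    by (intro sum_mono add_left_mono mult_right_mono row) (use p(2) in simp)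
  also have "\<dots> = (real K * p)\<^sup>2 + (real K)\<^sup>2 * a + 2 * real K * real L * p"
    by (simp add: power2_eq_square algebra_simps)
  finally have "variance W \<le> (real K)\<^sup>2 * a + 2 * real K * real L * p"
    using variance_eq[OF iW iWW] EW by simp
  moreover have Kp: "real K * p / 2 > 0" using K p(2) by simp
  moreover have "prob {\<omega>\<in>space M. real K * p / 2 \<le> \<bar>W \<omega> - expectation W\<bar>} \<le> variance W / (real K * p / 2)\<^sup>2"
    by (rule Chebyshev_inequality) (use iWW Kp in auto)
  ultimately have "prob {\<omega>\<in>space M. real K * p / 2 \<le> \<bar>W \<omega> - expectation W\<bar>}
      \<le> ((real K)\<^sup>2 * a + 2 * real K * real L * p) / (real K * p / 2)\<^sup>2"
    by (meson divide_right_mono order_trans zero_le_power2)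
  also have "\<dots> = 8 * real L / (real K * p) + 4 * a / p\<^sup>2"
    using K p(2) by (simp add: power2_eq_square field_simps)
  finally have "prob {\<omega>\<in>space M. real K * p / 2 \<le> \<bar>W \<omega> - expectation W\<bar>} \<le> 8 * real L / (real K * p) + 4 * a / p\<^sup>2" .
  moreover have "prob {\<omega>\<in>space M. W \<omega> \<le> real K * p / 2} \<le> prob {\<omega>\<in>space M. real K * p / 2 \<le> \<bar>W \<omega> - expectation W\<bar>}"
  proof (rule finite_measure_mono)
    have "real K * p / 2 \<le> \<bar>w - real K * p\<bar>" if "w \<le> real K * p / 2" for w
      using that by linarith
    then show "{\<omega>\<in>space M. W \<omega> \<le> real K * p / 2} \<subseteq> {\<omega>\<in>space M. real K * p / 2 \<le> \<bar>W \<omega> - expectation W\<bar>}"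
      unfolding EW by auto
  qed auto
  ultimately show ?thesis by (simp add: W_def)
qed

end

section \<open>Mixing coefficients\<close>

lemma sigma_process_mono: "I \<subseteq> J \<Longrightarrow> sigma_process M E X I \<subseteq> sigma_process M E X J"
  unfolding sigma_process_def by (intro sigma_sets_mono') blast

context prob_space
begin

lemma abs_cov_le_1: "\<bar>prob A * prob B - prob (A \<inter> B)\<bar> \<le> 1"
proof -
  have "0 \<le> prob A * prob B" "prob A * prob B \<le> 1" by (auto intro: mult_le_one)
  then show ?thesis using prob_le_1[of "A \<inter> B"] measure_nonneg[of M "A \<inter> B"] by linarith
qed

lemma alpha_coeff_upper:
  assumes "U \<in> \<U>" "V \<in> \<V>"
  shows "\<bar>prob U * prob V - prob (U \<inter> V)\<bar> \<le> alpha_coeff M \<U> \<V>"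
  unfolding alpha_coeff_def using assms abs_cov_le_1
  by (intro cSUP_upper2[where x = "(U, V)"] bdd_aboveI2[where M = 1]) auto

lemma alpha_coeff_least:
  assumes "U0 \<in> \<U>" "V0 \<in> \<V>" "\<And>U V. U \<in> \<U> \<Longrightarrow> V \<in> \<V> \<Longrightarrow> \<bar>prob U * prob V - prob (U \<inter> V)\<bar> \<le> c"
  shows "alpha_coeff M \<U> \<V> \<le> c"
  unfolding alpha_coeff_def using assms by (intro cSUP_least) auto

lemma empty_in_sigma_process: "{} \<in> sigma_process M E X I"
  unfolding sigma_process_def by (rule sigma_sets.Empty)

lemma alpha_mixing_upper:
  assumes "i \<ge> 1" "m \<ge> 1" "U \<in> sigma_process M E X {1..i}" "V \<in> sigma_process M E X {i + m..}"
  shows "\<bar>prob U * prob V - prob (U \<inter> V)\<bar> \<le> alpha_mixing M E X m"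
proof -
  have "\<bar>prob U * prob V - prob (U \<inter> V)\<bar>
      \<le> alpha_coeff M (sigma_process M E X {1..i}) (sigma_process M E X {i + m..})"
    using assms(3,4) by (rule alpha_coeff_upper)
  also have "\<dots> \<le> (SUP i\<in>{1..}. alpha_coeff M (sigma_process M E X {1..i}) (sigma_process M E X {i + m..}))"
    by (rule cSUP_upper)
      (use assms(1) in \<open>auto intro!: bdd_aboveI2[where M = 1] alpha_coeff_least empty_in_sigma_process abs_cov_le_1\<close>)
  finally show ?thesis using assms(2) by (simp add: alpha_mixing_def)
qed

lemma alpha_mixing_least:
  assumes "m \<ge> 1"
    and "\<And>i U V. i \<ge> 1 \<Longrightarrow> U \<in> sigma_process M E X {1..i} \<Longrightarrow> V \<in> sigma_process M E X {i + m..} \<Longrightarrow>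
      \<bar>prob U * prob V - prob (U \<inter> V)\<bar> \<le> c"
  shows "alpha_mixing M E X m \<le> c"
proof -
  have "(SUP i\<in>{1..}. alpha_coeff M (sigma_process M E X {1..i}) (sigma_process M E X {i + m..})) \<le> c"
    by (rule cSUP_least) (use assms(2) in \<open>auto intro!: alpha_coeff_least empty_in_sigma_process\<close>)
  then show ?thesis using assms(1) by (simp add: alpha_mixing_def)
qed

lemma alpha_mixing_antimono:
  assumes "1 \<le> m" "m \<le> m'"
  shows "alpha_mixing M E X m' \<le> alpha_mixing M E X m"
proof (rule alpha_mixing_least)
  fix i U V assume *: "i \<ge> 1" "U \<in> sigma_process M E X {1..i}" "V \<in> sigma_process M E X {i + m'..}"
  have "V \<in> sigma_process M E X {i + m..}"
    using *(3) sigma_process_mono[of "{i + m'..}" "{i + m..}"] assms(2) by auto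
  then show "\<bar>prob U * prob V - prob (U \<inter> V)\<bar> \<le> alpha_mixing M E X m"
    using alpha_mixing_upper assms(1) * by blast
qed (use assms in simp)

lemma alpha_mixing_le_1: "alpha_mixing M E X m \<le> 1"
  by (cases "m = 0") (auto intro!: alpha_mixing_least abs_cov_le_1 simp: alpha_mixing_def[of M E X 0])

text \<open>
  Markov's inequality for the integral defining the moment: \<open>\<alpha>\<inverse>(u)\<close> is at least \<open>m\<close> for all \<open>u\<close>
  below \<open>\<alpha>\<^sub>m\<close> and below \<open>\<alpha>\<^sub>0 = 1/2\<close>, in particular on \<open>[0, \<alpha>\<^sub>m / 3]\<close>.
\<close>

lemma alpha_mixing_polynomial_decay:
  assumes h: "h > 0" and fin: "mixing_moment M E X h < \<infinity>"
  obtains C where "C \<ge> 0" "\<And>m. m \<ge> 1 \<Longrightarrow> alpha_mixing M E X m \<le> C * real m powr (- h)"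
proof -
  define C where "C = 3 * enn2real (mixing_moment M E X h)"
  have C: "C \<ge> 0" by (simp add: C_def)
  have "alpha_mixing M E X m \<le> C * real m powr (- h)" if m: "m \<ge> 1" for m
  proof (cases "alpha_mixing M E X m \<le> 0")
    case True
    moreover have "0 \<le> C * real m powr (- h)" using C by simp
    ultimately show ?thesis by linarith
  next
    case False
    define A where "A = alpha_mixing M E X m"
    have A: "0 < A" "A \<le> 1" using False alpha_mixing_le_1 by (auto simp: A_def)
    have inv: "of_nat m \<le> alpha_inv M E X u" if "u \<le> A / 3" for u
      unfolding alpha_inv_def
    proof (rule INF_greatest)
      fix m' assume m': "m' \<in> {m. alpha_mixing M E X m \<le> u}"
      have "m \<le> m'"
      proof (rule ccontr)
        assume "\<not> m \<le> m'"
        moreover have "m' \<noteq> 0"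
        proof
          assume "m' = 0"
          then have "1 / 2 \<le> u" using m' by (simp add: alpha_mixing_def)
          then show False using that A by linarith
        qed
        ultimately have "A \<le> alpha_mixing M E X m'"
          unfolding A_def by (intro alpha_mixing_antimono) auto
        then show False using m' that A by auto
      qed
      then show "of_nat m \<le> (of_nat m' :: ennreal)" by simp
    qed
    have pw: "ennreal (real m powr h) \<le> ennreal_powr (alpha_inv M E X u) h" if "u \<le> A / 3" for u
    proof (cases "alpha_inv M E X u")
      case (real r)
      then have "real m \<le> r" using inv[OF that] by (simp add: ennreal_of_nat_eq_real_of_nat)
      then show ?thesis using real h by (auto simp: ennreal_powr_def intro!: ennreal_leI powr_mono2)
    qed (simp add: ennreal_powr_def)
    have "ennreal (real m powr h * (A / 3)) = ennreal (real m powr h) * emeasure lborel {0..A / 3}"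
      using A by (subst ennreal_mult) simp_all
    also have "\<dots> = (\<integral>\<^sup>+u. ennreal (real m powr h) * indicator {0..A / 3} u \<partial>lborel)"
      by (simp add: nn_integral_cmult_indicator)
    also have "\<dots> \<le> mixing_moment M E X h"
      unfolding mixing_moment_def
      by (rule nn_integral_mono) (use pw A in \<open>auto simp: indicator_def\<close>)
    finally have "real m powr h * (A / 3) \<le> enn2real (mixing_moment M E X h)"
      using fin A by (metis enn2real_ennreal enn2real_mono divide_nonneg_pos infinity_ennreal_def
          less_eq_real_def mult_nonneg_nonneg powr_ge_zero zero_less_numeral)
    then have "real m powr h * A \<le> C" by (simp add: C_def)
    then have "A \<le> C / real m powr h" using m by (simp add: pos_le_divide_eq mult.commute)
    then show ?thesis by (simp add: A_def powr_minus divide_inverse)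
  qed
  then show ?thesis using that C by blast
qed

lemma AE_eventually_notin:
  assumes A: "\<And>n. A n \<in> events" and a: "a > 0"
    and le: "\<forall>\<^sub>F n in sequentially. prob (A n) \<le> C * exp (- (real n * a))"
  shows "AE \<omega> in M. \<forall>\<^sub>F n in sequentially. \<omega> \<notin> A n"
proof -
  have "summable (\<lambda>n. exp (- a) ^ n)" using a by (intro summable_geometric) simp
  then have "summable (\<lambda>n. C * exp (- (real n * a)))"
    by (intro summable_mult) (simp add: exp_of_nat_mult[symmetric])
  then have "summable (\<lambda>n. prob (A n))"
    by (rule summable_comparison_test_ev[rotated]) (use le in \<open>auto elim: eventually_mono\<close>)
  then have "AE \<omega> in M. \<forall>\<^sub>F n in sequentially. \<omega> \<in> space M - A n"
    using A by (intro borel_cantelli_AE1) (auto simp: emeasure_eq_measure)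
  then show ?thesis by eventually_elim (auto elim: eventually_mono)
qed

text \<open>By monotonicity, countably many errors \<open>\<eta>\<close> suffice.\<close>

lemma AE_all_errors:
  assumes mono: "\<And>\<eta> \<eta>' \<omega>. \<eta> \<le> \<eta>' \<Longrightarrow> P \<eta> \<omega> \<Longrightarrow> P \<eta>' \<omega>"
    and P: "\<And>\<eta>::real. \<eta> > 0 \<Longrightarrow> AE \<omega> in M. P \<eta> \<omega>"
  shows "AE \<omega> in M. \<forall>\<eta>>0. P \<eta> \<omega>"
proof -
  have "AE \<omega> in M. \<forall>i. P (inverse (real (Suc i))) \<omega>"
    unfolding AE_all_countable using P by simp
  then show ?thesis
  proof eventually_elim
    case (elim \<omega>)
    show ?case
    proof safe
      fix \<eta> :: real assume "\<eta> > 0"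
      then obtain i where "inverse (real (Suc i)) < \<eta>" using reals_Archimedean by blast
      then show "P \<eta> \<omega>" using mono elim by (meson less_imp_le)
    qed
  qed
qed

end

section \<open>Blocks of a stationary process\<close>

lemma shift_measurable [measurable]: "shift \<in> seq_space E \<rightarrow>\<^sub>M seq_space E"
  unfolding seq_space_def shift_def by (intro measurable_restrict measurable_component_singleton) auto

lemma shift_funpow_measurable [measurable]: "(shift ^^ m) \<in> seq_space E \<rightarrow>\<^sub>M seq_space E"
  by (induction m) (auto intro: measurable_comp[of _ _ "seq_space E"] shift_measurable simp: id_def)

lemma shift_funpow_path: "(shift ^^ m) (path X \<omega>) = (\<lambda>i\<in>{1..}. X (i + m) \<omega>)"
  by (induction m) (auto simp: path_def shift_def fun_eq_iff)

text \<open>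
  If a measurable function is close to one that depends on the first \<open>m\<close> coordinates only, then
  composing it with this map changes it little and yields a function of these coordinates. Unlike
  the approximating function, the composition is measurable.
\<close>

definition truncate_seq :: "(nat \<Rightarrow> 'e) \<Rightarrow> nat \<Rightarrow> (nat \<Rightarrow> 'e) \<Rightarrow> nat \<Rightarrow> 'e"
  where "truncate_seq c m z = (\<lambda>i\<in>{1..}. if i \<le> m then z i else c i)"

lemma truncate_seq_measurable:
  assumes "c \<in> space (seq_space E)"
  shows "truncate_seq c m \<in> seq_space E \<rightarrow>\<^sub>M seq_space E"
  unfolding seq_space_def truncate_seq_def
proof (rule measurable_restrict)
  fix i :: nat assume i: "i \<in> {1..}"
  show "(\<lambda>z. if i \<le> m then z i else c i) \<in> Pi\<^sub>M {1..} (\<lambda>i. E) \<rightarrow>\<^sub>M E"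
    using i assms by (cases "i \<le> m") (auto simp: seq_space_def space_PiM PiE_iff)
qed

lemma truncate_seq_close:
  fixes S S' :: "nat \<Rightarrow> (nat \<Rightarrow> 'e) \<Rightarrow> 'v::euclidean_space"
  assumes dep: "\<And>n. n \<ge> 1 \<Longrightarrow> depends_on_first E (2 * n) (S' n)"
    and approx: "(\<lambda>n. SUP z \<in> space (seq_space E). ereal (norm (S n z - S' n z) / real n)) \<longlonglongrightarrow> 0"
    and c: "c \<in> space (seq_space E)" and \<eta>: "\<eta> > 0"
  shows "\<forall>\<^sub>F n in sequentially. \<forall>z\<in>space (seq_space E).
    \<bar>\<theta> \<bullet> S n z - \<theta> \<bullet> S n (truncate_seq c (2 * n) z)\<bar> \<le> real n * \<eta>"
proof -
  define e where "e = \<eta> / (2 * (norm \<theta> + 1))"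
  have pos: "norm \<theta> + 1 > 0" using norm_ge_zero[of \<theta>] by linarith
  have "2 * e * norm \<theta> = \<eta> * (norm \<theta> / (norm \<theta> + 1))"
    using pos by (simp add: e_def field_simps)
  also have "\<dots> \<le> \<eta> * 1" using \<eta> pos by (intro mult_left_mono) auto
  finally have e: "e > 0" "2 * e * norm \<theta> \<le> \<eta>"
    using \<eta> pos by (simp_all add: e_def)
  have "\<forall>\<^sub>F n in sequentially. (SUP z \<in> space (seq_space E). ereal (norm (S n z - S' n z) / real n)) < ereal e"
    by (rule order_tendstoD(2)[OF approx]) (use e in simp)
  then show ?thesis
    using eventually_ge_at_top[of 1]
  proof eventually_elim
    case (elim n)
    have close: "norm (S n z - S' n z) \<le> real n * e" if "z \<in> space (seq_space E)" for z
    proof -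
      have "ereal (norm (S n z - S' n z) / real n) < ereal e"
        by (rule le_less_trans[OF SUP_upper elim(1)]) (rule that)
      then show ?thesis using elim(2) by (simp add: field_simps)
    qed
    show ?case
    proof
      fix z assume z: "z \<in> space (seq_space E)"
      let ?z = "truncate_seq c (2 * n) z"
      have z': "?z \<in> space (seq_space E)"
        using measurable_space[OF truncate_seq_measurable[OF c] z] .
      have "S' n z = S' n ?z"
      proof -
        have "\<forall>i\<in>{1..2 * n}. z i = ?z i" by (simp add: truncate_seq_def)
        then show ?thesis using dep[OF elim(2), unfolded depends_on_first_def, rule_format, OF z z'] by blast
      qed
      then have "S n z - S n ?z = (S n z - S' n z) - (S n ?z - S' n ?z)" by simp
      then have "norm (S n z - S n ?z) \<le> norm (S n z - S' n z) + norm (S n ?z - S' n ?z)"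
        by (simp only: norm_triangle_ineq4)
      also have "\<dots> \<le> 2 * (real n * e)" using close[OF z] close[OF z'] by linarith
      finally have "norm \<theta> * norm (S n z - S n ?z) \<le> norm \<theta> * (2 * (real n * e))"
        by (rule mult_left_mono) (rule norm_ge_zero)
      also have "\<dots> = real n * (2 * e * norm \<theta>)" by (simp only: mult_ac)
      also have "\<dots> \<le> real n * \<eta>" by (rule mult_left_mono[OF e(2)]) simp
      finally have bound: "norm \<theta> * norm (S n z - S n ?z) \<le> real n * \<eta>" .
      have "\<bar>\<theta> \<bullet> (S n z - S n ?z)\<bar> \<le> norm \<theta> * norm (S n z - S n ?z)"
        by (rule Cauchy_Schwarz_ineq2)
      then show "\<bar>\<theta> \<bullet> S n z - \<theta> \<bullet> S n ?z\<bar> \<le> real n * \<eta>"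
        using bound unfolding inner_diff_right by (rule order_trans)
    qed
  qed
qed

lemma emp_log_mgf_eq_free_energy:
  assumes "k n > 0"
  shows "emp_log_mgf X S k n \<omega> \<theta> = free_energy k (\<lambda>n j. emp_point X S n j \<omega>) n \<theta>"
proof -
  have "(\<lambda>j. emp_point X S n j \<omega>) \<in> uniform_count_measure {1..k n} \<rightarrow>\<^sub>M borel"
    by (simp add: measurable_def sets_uniform_count_measure space_uniform_count_measure)
  then show ?thesis
    using assms unfolding emp_log_mgf_def free_energy_def emp_measure_def
    by (subst integral_distr) (auto simp: integral_uniform_count_measure)
qed

lemma emeasure_emp_measure:
  assumes "k n > 0" "B \<in> sets borel"
  shows "emeasure (emp_measure X S k n \<omega>) B
    = ennreal (real (card {j \<in> {1..k n}. emp_point X S n j \<omega> \<in> B}) / real (k n))"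
proof -
  have m: "(\<lambda>j. emp_point X S n j \<omega>) \<in> uniform_count_measure {1..k n} \<rightarrow>\<^sub>M borel"
    by (simp add: measurable_def sets_uniform_count_measure space_uniform_count_measure)
  have "(\<lambda>j. emp_point X S n j \<omega>) -` B \<inter> {1..k n} = {j \<in> {1..k n}. emp_point X S n j \<omega> \<in> B}" by auto
  then show ?thesis
    unfolding emp_measure_def using assms
    by (subst emeasure_distr[OF m], simp, simp only: space_uniform_count_measure,
        subst emeasure_uniform_count_measure) auto
qed

locale stationary_sums = prob_space M for M :: "'a measure" +
  fixes E :: "'e measure" and X :: "nat \<Rightarrow> 'a \<Rightarrow> 'e"
    and S :: "nat \<Rightarrow> (nat \<Rightarrow> 'e) \<Rightarrow> 'v::euclidean_space"
  assumes stationary: "stationary_process M E X"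
    and orbit: "\<And>n. n \<ge> 1 \<Longrightarrow> orbit_function E n (S n)"
begin

lemma X_measurable: "i \<ge> 1 \<Longrightarrow> X i \<in> M \<rightarrow>\<^sub>M E"
  using stationary by (auto simp: stationary_process_def)

lemma path_measurable [measurable]: "path X \<in> M \<rightarrow>\<^sub>M seq_space E"
  unfolding seq_space_def path_def using X_measurable by (intro measurable_restrict) auto

definition later_path :: "nat \<Rightarrow> 'a \<Rightarrow> nat \<Rightarrow> 'e"
  where "later_path m \<omega> = (shift ^^ m) (path X \<omega>)"

lemma later_path_measurable [measurable]: "later_path m \<in> M \<rightarrow>\<^sub>M seq_space E"
  unfolding later_path_def by measurable

lemma later_path_space: "\<omega> \<in> space M \<Longrightarrow> later_path m \<omega> \<in> space (seq_space E)"
  using later_path_measurable by (rule measurable_space)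

lemma distr_later_path: "distr M (seq_space E) (later_path m) = distr M (seq_space E) (path X)"
proof (induction m)
  case (Suc m)
  have "distr M (seq_space E) (later_path (Suc m))
      = distr (distr M (seq_space E) (later_path m)) (seq_space E) shift"
    by (subst distr_distr) (auto simp: later_path_def[abs_def] o_def)
  also have "\<dots> = distr (distr M (seq_space E) (path X)) (seq_space E) shift"
    by (simp only: Suc)
  also have "\<dots> = distr M (seq_space E) (path X)"
    using stationary by (subst distr_distr) (auto simp: stationary_process_def o_def)
  finally show ?case .
qed (simp add: later_path_def)

lemma nn_integral_later_path:
  assumes "f \<in> borel_measurable (seq_space E)"
  shows "(\<integral>\<^sup>+\<omega>. f (later_path m \<omega>) \<partial>M) = (\<integral>\<^sup>+\<omega>. f (path X \<omega>) \<partial>M)"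
proof -
  have "(\<integral>\<^sup>+\<omega>. f (later_path m \<omega>) \<partial>M) = (\<integral>\<^sup>+z. f z \<partial>distr M (seq_space E) (later_path m))"
    using assms by (simp add: nn_integral_distr)
  also have "\<dots> = (\<integral>\<^sup>+\<omega>. f (path X \<omega>) \<partial>M)"
    unfolding distr_later_path using assms by (simp add: nn_integral_distr)
  finally show ?thesis .
qed

lemma expectation_later_path:
  fixes f :: "(nat \<Rightarrow> 'e) \<Rightarrow> real"
  assumes "f \<in> borel_measurable (seq_space E)"
  shows "expectation (\<lambda>\<omega>. f (later_path m \<omega>)) = expectation (\<lambda>\<omega>. f (path X \<omega>))"
proof -
  have "expectation (\<lambda>\<omega>. f (later_path m \<omega>)) = integral\<^sup>L (distr M (seq_space E) (later_path m)) f"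
    using assms by (simp add: integral_distr)
  also have "\<dots> = expectation (\<lambda>\<omega>. f (path X \<omega>))"
    unfolding distr_later_path using assms by (simp add: integral_distr)
  finally show ?thesis .
qed

lemma S_measurable:
  assumes "n \<ge> 1"
  shows "S n \<in> borel_measurable (seq_space E)"
proof -
  obtain g where g: "g \<in> borel_measurable (\<Pi>\<^sub>M i\<in>{..<n}. seq_space E)"
    "\<And>z. z \<in> space (seq_space E) \<Longrightarrow> S n z = g (\<lambda>i\<in>{..<n}. (shift ^^ i) z)"
    using orbit[OF assms] unfolding orbit_function_def by blast
  have "(\<lambda>z. \<lambda>i\<in>{..<n}. (shift ^^ i) z) \<in> seq_space E \<rightarrow>\<^sub>M (\<Pi>\<^sub>M i\<in>{..<n}. seq_space E)"
    by (intro measurable_restrict) simp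
  from measurable_compose[OF this g(1)] show ?thesis
    using g(2) by (simp cong: measurable_cong)
qed

lemma exp_inner_S_measurable:
  "n \<ge> 1 \<Longrightarrow> (\<lambda>z. exp (\<theta> \<bullet> S n z)) \<in> borel_measurable (seq_space E)"
  using S_measurable[of n] by measurable

text \<open>A function of \<open>(X\<^sub>m\<^sub>+\<^sub>1, \<dots>, X\<^sub>m\<^sub>+\<^sub>l)\<close> generates no more than these variables do.\<close>

lemma level_set_in_sigma_process:
  fixes f :: "(nat \<Rightarrow> 'e) \<Rightarrow> real"
  assumes f: "f \<in> borel_measurable (seq_space E)" and c: "c \<in> space (seq_space E)"
  shows "{\<omega>\<in>space M. s \<le> f (truncate_seq c l (later_path m \<omega>))} \<in> sigma_process M E X {m + 1..m + l}"
proof -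
  define G where "G = (\<Union>i\<in>{m + 1..m + l}. {X i -` A \<inter> space M | A. A \<in> sets E})"
  define F where "F = sigma (space M) G"
  have G: "G \<subseteq> Pow (space M)" by (auto simp: G_def)
  have F: "space F = space M" "sets F = sigma_process M E X {m + 1..m + l}"
    using G by (simp_all add: F_def space_measure_of sets_measure_of sigma_process_def G_def)
  have X_F: "X i \<in> F \<rightarrow>\<^sub>M E" if "i \<in> {m + 1..m + l}" for i
  proof (rule measurableI)
    show "X i \<omega> \<in> space E" if "\<omega> \<in> space F" for \<omega>
      using that \<open>i \<in> _\<close> X_measurable[of i] F(1) by (auto dest: measurable_space)
    show "X i -` A \<inter> space F \<in> sets F" if "A \<in> sets E" for A
      unfolding F sigma_process_def using that \<open>i \<in> _\<close> by (intro sigma_sets.Basic UN_I[of i]) auto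
  qed
  have "(\<lambda>\<omega>. truncate_seq c l (later_path m \<omega>)) \<in> F \<rightarrow>\<^sub>M seq_space E"
    unfolding seq_space_def truncate_seq_def later_path_def shift_funpow_path
  proof (rule measurable_restrict)
    fix i :: nat assume i: "i \<in> {1..}"
    show "(\<lambda>\<omega>. if i \<le> l then (\<lambda>i\<in>{1..}. X (i + m) \<omega>) i else c i) \<in> F \<rightarrow>\<^sub>M E"
      using i c X_F[of "i + m"] by (cases "i \<le> l") (auto simp: seq_space_def space_PiM PiE_iff)
  qed
  from measurable_compose[OF this f]
  have "{\<omega>\<in>space F. s \<le> f (truncate_seq c l (later_path m \<omega>))} \<in> sets F" by measurable
  then show ?thesis unfolding F .
qed

text \<open>
  The two factors depend on \<open>X\<^sub>m\<^sub>+\<^sub>1, \<dots>, X\<^sub>m\<^sub>+\<^sub>l\<close> and on \<open>X\<^sub>i\<close> for \<open>i > m'\<close>, and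
  \<open>m' + 1\<close> exceeds \<open>m + l\<close> by at least \<open>g\<close>.
\<close>

lemma expectation_mult_blocks_le:
  fixes f :: "(nat \<Rightarrow> 'e) \<Rightarrow> real"
  assumes f: "f \<in> borel_measurable (seq_space E)" "\<And>z. 0 \<le> f z" "\<And>z. f z \<le> 1"
    and c: "c \<in> space (seq_space E)" and l: "l \<ge> 1" and g: "g \<ge> 1" "m + l + g \<le> m' + 1"
  defines "U \<equiv> \<lambda>m \<omega>. f (truncate_seq c l (later_path m \<omega>))"
  shows "expectation (\<lambda>\<omega>. U m \<omega> * U m' \<omega>) \<le> expectation (U m) * expectation (U m') + alpha_mixing M E X g"
proof (rule expectation_mult_le_of_level_sets)
  have U_meas: "U m \<in> borel_measurable M" for m
    unfolding U_def
    by (rule measurable_compose[OF measurable_compose[OF later_path_measurable truncate_seq_measurable[OF c]] f(1)])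
  show "U m \<in> borel_measurable M" "U m' \<in> borel_measurable M" by (rule U_meas)+
  show "0 \<le> U m \<omega>" "U m \<omega> \<le> 1" "0 \<le> U m' \<omega>" "U m' \<omega> \<le> 1" for \<omega>
    using f by (auto simp: U_def)
  fix s t
  let ?A = "{\<omega>\<in>space M. s \<le> U m \<omega>}" and ?B = "{\<omega>\<in>space M. t \<le> U m' \<omega>}"
  have "?A \<in> sigma_process M E X {1..m + l}"
    using level_set_in_sigma_process[OF f(1) c, of s l m] sigma_process_mono[of "{m + 1..m + l}" "{1..m + l}"]
    unfolding U_def by fastforce
  moreover have "?B \<in> sigma_process M E X {m + l + g..}"
    using level_set_in_sigma_process[OF f(1) c, of t l m'] g(2)
      sigma_process_mono[of "{m' + 1..m' + l}" "{m + l + g..}"]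
    unfolding U_def by fastforce
  ultimately have "\<bar>prob ?A * prob ?B - prob (?A \<inter> ?B)\<bar> \<le> alpha_mixing M E X g"
    using l g by (intro alpha_mixing_upper) auto
  then show "prob (?A \<inter> ?B) \<le> prob ?A * prob ?B + alpha_mixing M E X g" by linarith
qed

definition exp_moment :: "nat \<Rightarrow> 'v \<Rightarrow> ennreal"
  where "exp_moment n \<theta> = (\<integral>\<^sup>+\<omega>. ennreal (exp (\<theta> \<bullet> S n (path X \<omega>))) \<partial>M)"

lemma exp_moment_bounds:
  assumes lim: "(\<lambda>n. log_mgf M X S n \<theta>) \<longlonglongrightarrow> ereal l" and \<eta>: "\<eta> > 0"
  shows "\<forall>\<^sub>F n in sequentially. ennreal (exp (real n * (l - \<eta>))) \<le> exp_moment n \<theta> \<and>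
    exp_moment n \<theta> \<le> ennreal (exp (real n * (l + \<eta>)))"
proof -
  have ev1: "\<forall>\<^sub>F n in sequentially. ereal (l - \<eta>) < log_mgf M X S n \<theta>"
    by (rule order_tendstoD(1)[OF lim]) (use \<eta> in simp)
  have ev2: "\<forall>\<^sub>F n in sequentially. log_mgf M X S n \<theta> < ereal (l + \<eta>)"
    by (rule order_tendstoD(2)[OF lim]) (use \<eta> in simp)
  show ?thesis
    using ev1 ev2 eventually_ge_at_top[of 1]
  proof eventually_elim
    case (elim n)
    have log: "log_mgf M X S n \<theta> = ereal (1 / real n) * elog (exp_moment n \<theta>)"
      by (simp add: log_mgf_def exp_moment_def)
    have "exp_moment n \<theta> \<noteq> 0"
    proof
      assume "exp_moment n \<theta> = 0"
      then have "log_mgf M X S n \<theta> = - \<infinity>" using elim(3) by (simp add: log elog_def)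
      with elim(1) show False by simp
    qed
    moreover have "exp_moment n \<theta> \<noteq> \<infinity>"
    proof
      assume "exp_moment n \<theta> = \<infinity>"
      then have "log_mgf M X S n \<theta> = \<infinity>" using elim(3) by (simp add: log elog_def)
      with elim(2) show False by simp
    qed
    ultimately obtain x where x: "exp_moment n \<theta> = ennreal x" "x > 0"
      by (cases "exp_moment n \<theta>") (auto simp: less_le)
    have "log_mgf M X S n \<theta> = ereal (ln x / real n)"
      using x by (simp add: log elog_def)
    then have "real n * (l - \<eta>) < ln x" "ln x < real n * (l + \<eta>)"
      using elim by (simp_all add: field_simps)
    then have "exp (real n * (l - \<eta>)) < exp (ln x)" "exp (ln x) < exp (real n * (l + \<eta>))"
      by simp_all
    then show ?case using x by (simp add: ennreal_leI)
  qed
qed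

end

section \<open>Almost sure bounds at a single parameter\<close>

lemma log_mgf_tendsto:
  assumes "\<theta> \<in> lim_log_mgf_dom M X S"
  shows "(\<lambda>n. log_mgf M X S n \<theta>) \<longlonglongrightarrow> ereal (lim_log_mgf M X S \<theta>)"
proof -
  obtain l where l: "(\<lambda>n. log_mgf M X S n \<theta>) \<longlonglongrightarrow> ereal l"
    using assms by (auto simp: lim_log_mgf_dom_def)
  then show ?thesis unfolding lim_log_mgf_def by (simp add: limI)
qed

context stationary_sums
begin

definition partition_mean :: "(nat \<Rightarrow> nat) \<Rightarrow> 'v \<Rightarrow> nat \<Rightarrow> 'a \<Rightarrow> real"
  where "partition_mean k \<theta> n \<omega> =
    (\<Sum>j\<in>{1..k n}. exp (\<theta> \<bullet> S n (later_path ((j - 1) * n) \<omega>))) / real (k n)"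

lemma exp_emp_log_mgf:
  assumes "n \<ge> 1" "k n > 0"
  shows "exp (real n * emp_log_mgf X S k n \<omega> \<theta>) = partition_mean k \<theta> n \<omega>"
proof -
  have "real n * (\<theta> \<bullet> emp_point X S n j \<omega>) = \<theta> \<bullet> S n (later_path ((j - 1) * n) \<omega>)" for j
    using assms(1) by (simp add: emp_point_def later_path_def mult.assoc[symmetric])
  then show ?thesis
    using assms by (simp add: emp_log_mgf_eq_free_energy exp_free_energy partition_mean_def)
qed

lemma partition_mean_measurable [measurable]:
  assumes "n \<ge> 1"
  shows "partition_mean k \<theta> n \<in> borel_measurable M"
  unfolding partition_mean_def
  by (intro borel_measurable_divide borel_measurable_sum borel_measurable_const
      measurable_compose[OF later_path_measurable exp_inner_S_measurable[OF assms]])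

lemma nn_integral_partition_mean:
  assumes n: "n \<ge> 1" and k: "k n > 0"
  shows "(\<integral>\<^sup>+\<omega>. ennreal (partition_mean k \<theta> n \<omega>) \<partial>M) = exp_moment n \<theta>"
proof -
  let ?f = "\<lambda>z. ennreal (exp (\<theta> \<bullet> S n z))"
  have f: "?f \<in> borel_measurable (seq_space E)"
    using exp_inner_S_measurable[OF n] by measurable
  have "(\<integral>\<^sup>+\<omega>. ennreal (partition_mean k \<theta> n \<omega>) \<partial>M)
      = (\<integral>\<^sup>+\<omega>. (\<Sum>j\<in>{1..k n}. ennreal (1 / real (k n)) * ?f (later_path ((j - 1) * n) \<omega>)) \<partial>M)"
  proof (rule nn_integral_cong)
    fix \<omega>
    have "partition_mean k \<theta> n \<omega>
        = (\<Sum>j\<in>{1..k n}. 1 / real (k n) * exp (\<theta> \<bullet> S n (later_path ((j - 1) * n) \<omega>)))"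
      by (simp add: partition_mean_def sum_divide_distrib)
    also have "ennreal \<dots> = (\<Sum>j\<in>{1..k n}. ennreal (1 / real (k n) * exp (\<theta> \<bullet> S n (later_path ((j - 1) * n) \<omega>))))"
      by (rule sum_ennreal[symmetric]) simp
    also have "\<dots> = (\<Sum>j\<in>{1..k n}. ennreal (1 / real (k n)) * ?f (later_path ((j - 1) * n) \<omega>))"
      by (intro sum.cong refl ennreal_mult) simp_all
    finally show "ennreal (partition_mean k \<theta> n \<omega>)
        = (\<Sum>j\<in>{1..k n}. ennreal (1 / real (k n)) * ?f (later_path ((j - 1) * n) \<omega>))" .
  qed
  also have "\<dots> = (\<Sum>j\<in>{1..k n}. ennreal (1 / real (k n)) * (\<integral>\<^sup>+\<omega>. ?f (later_path ((j - 1) * n) \<omega>) \<partial>M))"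
    using measurable_compose[OF later_path_measurable f]
    by (subst nn_integral_sum) (auto simp: nn_integral_cmult)
  also have "\<dots> = (\<Sum>j\<in>{1..k n}. ennreal (1 / real (k n)) * exp_moment n \<theta>)"
    by (simp add: nn_integral_later_path[OF f] exp_moment_def)
  also have "\<dots> = ennreal (real (k n)) * ennreal (1 / real (k n)) * exp_moment n \<theta>"
    by (simp add: ennreal_of_nat_eq_real_of_nat mult.assoc)
  also have "ennreal (real (k n)) * ennreal (1 / real (k n)) = 1"
    using k by (simp flip: ennreal_mult)
  finally show ?thesis by simp
qed

lemma AE_emp_log_mgf_upper:
  assumes k: "\<And>n. n \<ge> 1 \<Longrightarrow> k n > 0" and dom: "\<theta> \<in> lim_log_mgf_dom M X S"
  shows "AE \<omega> in M. \<forall>\<eta>>0. \<forall>\<^sub>F n in sequentially.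
    emp_log_mgf X S k n \<omega> \<theta> \<le> lim_log_mgf M X S \<theta> + \<eta>"
proof (rule AE_all_errors)
  let ?l = "lim_log_mgf M X S \<theta>"
  show "\<forall>\<^sub>F n in sequentially. emp_log_mgf X S k n \<omega> \<theta> \<le> ?l + \<eta>'"
    if "\<eta> \<le> \<eta>'" "\<forall>\<^sub>F n in sequentially. emp_log_mgf X S k n \<omega> \<theta> \<le> ?l + \<eta>" for \<eta> \<eta>' \<omega>
    using that(2) by eventually_elim (use that(1) in simp)
  fix \<eta> :: real assume \<eta>: "\<eta> > 0"
  define A where "A n = {\<omega>\<in>space M. n \<ge> 1 \<and> exp (real n * (?l + \<eta>)) \<le> partition_mean k \<theta> n \<omega>}" for n
  have A: "A n \<in> events" for n
    by (cases "n \<ge> 1") (simp_all add: A_def)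
  have \<eta>2: "\<eta> / 2 > 0" using \<eta> by simp
  have "\<forall>\<^sub>F n in sequentially. prob (A n) \<le> 1 * exp (- (real n * (\<eta> / 2)))"
    using exp_moment_bounds[OF log_mgf_tendsto[OF dom] \<eta>2] eventually_ge_at_top[of 1]
  proof eventually_elim
    case (elim n)
    let ?c = "exp (- (real n * (?l + \<eta>)))"
    have "A n \<subseteq> {\<omega>\<in>space M. 1 \<le> ennreal ?c * ennreal (partition_mean k \<theta> n \<omega>)}"
    proof
      fix \<omega> assume \<omega>: "\<omega> \<in> A n"
      then have "?c * exp (real n * (?l + \<eta>)) \<le> ?c * partition_mean k \<theta> n \<omega>"
        by (intro mult_left_mono) (auto simp: A_def)
      then have "1 \<le> ?c * partition_mean k \<theta> n \<omega>" by (simp add: exp_minus)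
      then have "ennreal 1 \<le> ennreal (?c * partition_mean k \<theta> n \<omega>)" by (rule ennreal_leI)
      then show "\<omega> \<in> {\<omega>\<in>space M. 1 \<le> ennreal ?c * ennreal (partition_mean k \<theta> n \<omega>)}"
        using \<omega> by (simp add: A_def ennreal_mult')
    qed
    then have "emeasure M (A n) \<le> emeasure M {\<omega>\<in>space M. 1 \<le> ennreal ?c * ennreal (partition_mean k \<theta> n \<omega>)}"
      using partition_mean_measurable[OF elim(2), of k \<theta>]
      by (intro emeasure_mono borel_measurable_le borel_measurable_times_ennreal) auto
    also have "\<dots> \<le> ennreal ?c * (\<integral>\<^sup>+\<omega>. ennreal (partition_mean k \<theta> n \<omega>) * indicator (space M) \<omega> \<partial>M)"
      by (rule nn_integral_Markov_inequality) (use partition_mean_measurable[OF elim(2), of k \<theta>] in auto)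
    also have "(\<integral>\<^sup>+\<omega>. ennreal (partition_mean k \<theta> n \<omega>) * indicator (space M) \<omega> \<partial>M) = exp_moment n \<theta>"
      using nn_integral_partition_mean[of n k \<theta>, OF elim(2) k[OF elim(2)]]
      by (simp cong: nn_integral_cong)
    also have "ennreal ?c * exp_moment n \<theta> \<le> ennreal ?c * ennreal (exp (real n * (?l + \<eta> / 2)))"
      using elim(1) \<eta> by (intro mult_left_mono) auto
    also have "\<dots> = ennreal (exp (- (real n * (\<eta> / 2))))"
      by (simp add: algebra_simps flip: ennreal_mult exp_add)
    finally show ?case by (simp add: emeasure_eq_measure)
  qed
  from AE_eventually_notin[OF A \<eta>2 this]
  have "AE \<omega> in M. \<forall>\<^sub>F n in sequentially. \<omega> \<notin> A n" .
  then show "AE \<omega> in M. \<forall>\<^sub>F n in sequentially. emp_log_mgf X S k n \<omega> \<theta> \<le> ?l + \<eta>"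
    using AE_space
  proof eventually_elim
    case (elim \<omega>)
    show ?case
      using elim(1) eventually_ge_at_top[of 1]
    proof eventually_elim
      case (elim n)
      have "exp (real n * emp_log_mgf X S k n \<omega> \<theta>) < exp (real n * (?l + \<eta>))"
        unfolding exp_emp_log_mgf[of n k, OF elim(2) k[OF elim(2)]]
        using elim \<open>\<omega> \<in> space M\<close> by (simp add: A_def)
      then show ?case using elim(2) by simp
    qed
  qed
qed

text \<open>
  Under the law tilted by \<open>\<theta>\<close> the sum \<open>\<theta> \<bullet> S\<^sub>n\<close> exceeds \<open>n b\<close> with exponentially small probability,
  because \<open>b\<close> is larger than the slope of \<open>\<Lambda>\<close> along the ray from \<open>\<theta>\<close> to \<open>(1 + \<delta>) \<theta>\<close>. Hence cutting
  off the large values does not change the exponential order of the moment.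
\<close>

lemma truncated_moment_ge:
  fixes U :: "nat \<Rightarrow> (nat \<Rightarrow> 'e) \<Rightarrow> real"
  assumes dom: "\<theta> \<in> lim_log_mgf_dom M X S" "(1 + \<delta>) *\<^sub>R \<theta> \<in> lim_log_mgf_dom M X S"
    and \<delta>: "\<delta> > 0" and b: "lim_log_mgf M X S ((1 + \<delta>) *\<^sub>R \<theta>) - lim_log_mgf M X S \<theta> < \<delta> * b"
    and \<sigma>: "\<And>n. n \<ge> 1 \<Longrightarrow> \<sigma> n \<in> borel_measurable (seq_space E)"
    and close: "\<And>\<eta>. \<eta> > 0 \<Longrightarrow> \<forall>\<^sub>F n in sequentially. \<forall>z\<in>space (seq_space E). \<bar>\<theta> \<bullet> S n z - \<sigma> n z\<bar> \<le> real n * \<eta>"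
    and U: "\<And>n z. U n z = (if \<sigma> n z \<le> real n * b then exp (\<sigma> n z - real n * b) else 0)"
    and \<eta>: "\<eta> > 0"
  shows "\<forall>\<^sub>F n in sequentially.
    exp (- (real n * (b - lim_log_mgf M X S \<theta> + \<eta>))) \<le> expectation (\<lambda>\<omega>. U n (path X \<omega>))"
proof -
  let ?l = "lim_log_mgf M X S \<theta>" and ?l' = "lim_log_mgf M X S ((1 + \<delta>) *\<^sub>R \<theta>)"
  define \<gamma> where "\<gamma> = ?l + \<delta> * b - ?l'"
  have \<gamma>: "\<gamma> > 0" using b by (simp add: \<gamma>_def)
  \<comment> \<open>small enough for the errors made below to stay under \<open>\<eta>\<close> and half the gap \<open>\<gamma>\<close>\<close>
  define \<eta>1 where "\<eta>1 = min (\<eta> / 3) (\<gamma> / (2 * (4 + \<delta>)))"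
  have \<eta>1: "\<eta>1 > 0" "3 * \<eta>1 \<le> \<eta>" "(4 + \<delta>) * \<eta>1 \<le> \<gamma> / 2"
  proof -
    show "\<eta>1 > 0" "3 * \<eta>1 \<le> \<eta>" using \<eta> \<gamma> \<delta> by (auto simp: \<eta>1_def)
    have "(4 + \<delta>) * \<eta>1 \<le> (4 + \<delta>) * (\<gamma> / (2 * (4 + \<delta>)))"
      using \<delta> by (intro mult_left_mono) (auto simp: \<eta>1_def)
    also have "\<dots> = \<gamma> / 2" using \<delta> by (simp add: field_simps)
    finally show "(4 + \<delta>) * \<eta>1 \<le> \<gamma> / 2" .
  qed
  have ev1: "\<forall>\<^sub>F n in sequentially. 2 \<le> exp (real n * (\<gamma> / 2))"
    by (rule eventually_le_exp) (use \<gamma> in simp)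
  have ev2: "\<forall>\<^sub>F n in sequentially. 2 \<le> exp (real n * \<eta>1)"
    by (rule eventually_le_exp) (use \<eta>1 in simp)
  show ?thesis
    using exp_moment_bounds[OF log_mgf_tendsto[OF dom(1)] \<eta>1(1)]
      exp_moment_bounds[OF log_mgf_tendsto[OF dom(2)] \<eta>1(1)] close[OF \<eta>1(1)] ev1 ev2
      eventually_ge_at_top[of 1]
  proof eventually_elim
    case (elim n)
    let ?p = "expectation (\<lambda>\<omega>. U n (path X \<omega>))"
    have [measurable]: "\<sigma> n \<in> borel_measurable (seq_space E)" by (rule \<sigma>) (rule elim(6))
    have U_bound: "0 \<le> U n z" "U n z \<le> 1" for z by (auto simp: U)
    have U_meas [measurable]: "U n \<in> borel_measurable (seq_space E)"
      unfolding U[abs_def] by measurable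
    have iU: "integrable M (\<lambda>\<omega>. U n (path X \<omega>))"
      by (rule integrable_const_bound[where B = 1]) (use U_bound in auto)
    have p_nonneg: "0 \<le> ?p"
      by (rule Bochner_Integration.integral_nonneg) (rule U_bound)
    have "ennreal (exp (real n * (?l - 2 * \<eta>1)))
        = ennreal (exp (- (real n * \<eta>1))) * ennreal (exp (real n * (?l - \<eta>1)))"
      by (simp add: algebra_simps flip: ennreal_mult exp_add)
    also have "\<dots> \<le> ennreal (exp (- (real n * \<eta>1))) * exp_moment n \<theta>"
      using elim(1) by (intro mult_left_mono) auto
    also have "\<dots> = (\<integral>\<^sup>+\<omega>. ennreal (exp (\<theta> \<bullet> S n (path X \<omega>) - real n * \<eta>1)) \<partial>M)"
      unfolding exp_moment_def
      using measurable_compose[OF path_measurable exp_inner_S_measurable[OF elim(6)]]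
      by (subst nn_integral_cmult[symmetric]) (auto simp: exp_diff exp_minus divide_inverse mult.commute simp flip: ennreal_mult)
    also have "\<dots> \<le> (\<integral>\<^sup>+\<omega>. ennreal (exp (real n * b)) * ennreal (U n (path X \<omega>))
        + ennreal (exp (real n * ((1 + \<delta>) * \<eta>1 - \<delta> * b))) * ennreal (exp (((1 + \<delta>) *\<^sub>R \<theta>) \<bullet> S n (path X \<omega>))) \<partial>M)"
    proof (rule nn_integral_mono)
      fix \<omega> assume "\<omega> \<in> space M"
      let ?z = "path X \<omega>"
      let ?t = "exp (real n * ((1 + \<delta>) * \<eta>1 - \<delta> * b)) * exp (((1 + \<delta>) *\<^sub>R \<theta>) \<bullet> S n ?z)"
      have cl: "\<bar>\<theta> \<bullet> S n ?z - \<sigma> n ?z\<bar> \<le> real n * \<eta>1"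
        using elim(3) measurable_space[OF path_measurable \<open>\<omega> \<in> space M\<close>] by blast
      have "exp (\<theta> \<bullet> S n ?z - real n * \<eta>1) \<le> exp (real n * b) * U n ?z + ?t"
      proof (cases "\<sigma> n ?z \<le> real n * b")
        case True
        have "exp (\<theta> \<bullet> S n ?z - real n * \<eta>1) \<le> exp (\<sigma> n ?z)" using cl by simp
        also have "\<dots> = exp (real n * b) * U n ?z" using True by (simp add: U flip: exp_add)
        finally show ?thesis by (simp add: add_increasing2)
      next
        case False
        then have "0 \<le> \<delta> * (\<sigma> n ?z - real n * b)" using \<delta> by simp
        moreover have "(1 + \<delta>) * \<sigma> n ?z \<le> (1 + \<delta>) * (\<theta> \<bullet> S n ?z + real n * \<eta>1)"
          using cl \<delta> by (intro mult_left_mono) auto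
        ultimately have "\<theta> \<bullet> S n ?z - real n * \<eta>1
            \<le> real n * ((1 + \<delta>) * \<eta>1 - \<delta> * b) + ((1 + \<delta>) *\<^sub>R \<theta>) \<bullet> S n ?z"
          using cl unfolding inner_scaleR_left by (simp add: algebra_simps abs_le_iff)
        then show ?thesis using False by (simp add: U flip: exp_add)
      qed
      then have "ennreal (exp (\<theta> \<bullet> S n ?z - real n * \<eta>1)) \<le> ennreal (exp (real n * b) * U n ?z + ?t)"
        by (rule ennreal_leI)
      then show "ennreal (exp (\<theta> \<bullet> S n ?z - real n * \<eta>1)) \<le> ennreal (exp (real n * b)) * ennreal (U n ?z)
          + ennreal (exp (real n * ((1 + \<delta>) * \<eta>1 - \<delta> * b))) * ennreal (exp (((1 + \<delta>) *\<^sub>R \<theta>) \<bullet> S n ?z))"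
        using U_bound(1)[of ?z] by (simp add: ennreal_mult ennreal_plus)
    qed
    also have "\<dots> = ennreal (exp (real n * b)) * (\<integral>\<^sup>+\<omega>. ennreal (U n (path X \<omega>)) \<partial>M)
        + ennreal (exp (real n * ((1 + \<delta>) * \<eta>1 - \<delta> * b))) * exp_moment n ((1 + \<delta>) *\<^sub>R \<theta>)"
      unfolding exp_moment_def
      using measurable_compose[OF path_measurable exp_inner_S_measurable[OF elim(6), of "(1 + \<delta>) *\<^sub>R \<theta>"]]
      by (subst nn_integral_add) (auto simp: nn_integral_cmult)
    also have "(\<integral>\<^sup>+\<omega>. ennreal (U n (path X \<omega>)) \<partial>M) = ennreal ?p"
      by (rule nn_integral_eq_integral[OF iU]) (use U_bound in simp)
    also have "ennreal (exp (real n * b)) * ennreal ?p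
        + ennreal (exp (real n * ((1 + \<delta>) * \<eta>1 - \<delta> * b))) * exp_moment n ((1 + \<delta>) *\<^sub>R \<theta>)
        \<le> ennreal (exp (real n * b)) * ennreal ?p
        + ennreal (exp (real n * ((1 + \<delta>) * \<eta>1 - \<delta> * b))) * ennreal (exp (real n * (?l' + \<eta>1)))"
      using elim(2) by (intro add_left_mono mult_left_mono) auto
    also have "\<dots> = ennreal (exp (real n * b) * ?p + exp (real n * (?l - \<gamma> + (2 + \<delta>) * \<eta>1)))"
    proof -
      have "exp (real n * ((1 + \<delta>) * \<eta>1 - \<delta> * b)) * exp (real n * (?l' + \<eta>1))
          = exp (real n * (?l - \<gamma> + (2 + \<delta>) * \<eta>1))"
        by (simp add: \<gamma>_def algebra_simps flip: exp_add)
      then show ?thesis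
        using p_nonneg by (simp only: ennreal_mult[symmetric] ennreal_plus[symmetric] exp_ge_zero mult_nonneg_nonneg)
    qed
    finally have "exp (real n * (?l - 2 * \<eta>1)) \<le> exp (real n * b) * ?p + exp (real n * (?l - \<gamma> + (2 + \<delta>) * \<eta>1))"
      using p_nonneg by (subst (asm) ennreal_le_iff) auto
    moreover have "exp (real n * (?l - \<gamma> + (2 + \<delta>) * \<eta>1)) \<le> exp (real n * (?l - 2 * \<eta>1)) / 2"
    proof -
      have "2 * exp (real n * (?l - \<gamma> + (2 + \<delta>) * \<eta>1))
          \<le> exp (real n * (\<gamma> / 2)) * exp (real n * (?l - \<gamma> + (2 + \<delta>) * \<eta>1))"
        using elim(4) by (intro mult_right_mono) auto
      also have "\<dots> = exp (real n * (?l - \<gamma> / 2 + (2 + \<delta>) * \<eta>1))"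
        by (simp add: algebra_simps flip: exp_add)
      also have "\<dots> \<le> exp (real n * (?l - 2 * \<eta>1))"
        using \<eta>1(3) by (intro exp_scale_mono) (simp add: algebra_simps)
      finally show ?thesis by simp
    qed
    ultimately have "exp (real n * (?l - 2 * \<eta>1)) / 2 \<le> exp (real n * b) * ?p" by linarith
    moreover have "exp (real n * (?l - 3 * \<eta>1)) \<le> exp (real n * (?l - 2 * \<eta>1)) / 2"
    proof -
      have "2 * exp (real n * (?l - 3 * \<eta>1)) \<le> exp (real n * \<eta>1) * exp (real n * (?l - 3 * \<eta>1))"
        using elim(5) by (intro mult_right_mono) auto
      then show ?thesis by (simp add: algebra_simps flip: exp_add)
    qed
    moreover have "exp (real n * (?l - \<eta>)) \<le> exp (real n * (?l - 3 * \<eta>1))"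
      using \<eta>1(2) by (intro exp_scale_mono) simp
    ultimately have "exp (real n * (?l - \<eta>)) \<le> exp (real n * b) * ?p" by linarith
    then have "exp (- (real n * b)) * exp (real n * (?l - \<eta>)) \<le> exp (- (real n * b)) * (exp (real n * b) * ?p)"
      by (rule mult_left_mono) simp
    also have "\<dots> = ?p" by (simp add: exp_minus)
    finally show ?case by (simp add: algebra_simps flip: exp_add)
  qed
qed

text \<open>
  The second-moment bound applied to the truncated weights: since \<open>b - \<Lambda>(\<theta>)\<close> is smaller than the
  growth rate of \<open>k\<close>, the mean number of blocks that carry the truncated moment is exponentially large.
  Blocks at index distance \<open>exp (n \<eta>)\<close> are so weakly dependent, by the polynomial decay of
  the mixing coefficients of arbitrary order, that their covariances are negligible.
\<close>

lemma AE_emp_log_mgf_lower: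
  fixes S' :: "nat \<Rightarrow> (nat \<Rightarrow> 'e) \<Rightarrow> 'v"
  assumes k: "\<And>n. n \<ge> 1 \<Longrightarrow> k n > 0"
    and mixing: "\<And>h::real. h > 0 \<Longrightarrow> mixing_moment M E X h < \<infinity>"
    and dep: "\<And>n. n \<ge> 1 \<Longrightarrow> depends_on_first E (2 * n) (S' n)"
    and approx: "(\<lambda>n. SUP z \<in> space (seq_space E). ereal (norm (S n z - S' n z) / real n)) \<longlonglongrightarrow> 0"
    and dom: "\<theta> \<in> lim_log_mgf_dom M X S" "(1 + \<delta>) *\<^sub>R \<theta> \<in> lim_log_mgf_dom M X S"
    and \<delta>: "\<delta> > 0"
    and slope: "(lim_log_mgf M X S ((1 + \<delta>) *\<^sub>R \<theta>) - lim_log_mgf M X S \<theta>) / \<delta> - lim_log_mgf M X S \<theta> < c"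
    and growth: "\<forall>\<^sub>F n in sequentially. c \<le> ln (real (k n)) / real n"
  shows "AE \<omega> in M. \<forall>\<eta>>0. \<forall>\<^sub>F n in sequentially.
    lim_log_mgf M X S \<theta> - \<eta> \<le> emp_log_mgf X S k n \<omega> \<theta>"
proof (rule AE_all_errors)
  let ?l = "lim_log_mgf M X S \<theta>"
  show "\<forall>\<^sub>F n in sequentially. ?l - \<eta>' \<le> emp_log_mgf X S k n \<omega> \<theta>"
    if "\<eta> \<le> \<eta>'" "\<forall>\<^sub>F n in sequentially. ?l - \<eta> \<le> emp_log_mgf X S k n \<omega> \<theta>" for \<eta> \<eta>' \<omega>
    using that(2) by eventually_elim (use that(1) in simp)
  fix \<eta>0 :: real assume \<eta>0: "\<eta>0 > 0"
  obtain b where b: "(lim_log_mgf M X S ((1 + \<delta>) *\<^sub>R \<theta>) - ?l) / \<delta> < b" "b - ?l < c"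
  proof -
    have "(lim_log_mgf M X S ((1 + \<delta>) *\<^sub>R \<theta>) - ?l) / \<delta> < c + ?l" using slope by simp
    from dense[OF this] show ?thesis using that by (auto simp: algebra_simps)
  qed
  define q where "q = b - ?l"
  define \<kappa> where "\<kappa> = c - q"
  have \<kappa>: "\<kappa> > 0" using b(2) by (simp add: \<kappa>_def q_def)
  \<comment> \<open>\<open>k n\<close> times the mean \<open>p n\<close> below is at least \<open>exp (n (\<kappa> - \<eta>))\<close>\<close>
  define \<eta> where "\<eta> = min (\<eta>0 / 3) (\<kappa> / 4)"
  have \<eta>: "\<eta> > 0" "3 * \<eta> \<le> \<eta>0" "4 * \<eta> \<le> \<kappa>" using \<eta>0 \<kappa> by (auto simp: \<eta>_def)
  \<comment> \<open>the order of the moment for which \<open>\<alpha>\<^sub>m\<close> at \<open>m = exp (n \<eta>)\<close> is negligible compared to the squared mean\<close>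
  define h where "h = (2 * \<bar>q\<bar> + 2 * \<eta> + 1) / \<eta>"
  have h: "h > 0" "\<eta> * h = 2 * \<bar>q\<bar> + 2 * \<eta> + 1" using \<eta>(1) by (auto simp: h_def intro!: divide_pos_pos add_nonneg_pos)
  obtain C where C: "C \<ge> 0" "\<And>m. m \<ge> 1 \<Longrightarrow> alpha_mixing M E X m \<le> C * real m powr (- h)"
    using alpha_mixing_polynomial_decay[OF h(1) mixing[OF h(1)]] by blast
  obtain \<omega>0 where "\<omega>0 \<in> space M" using not_empty by blast
  then have z0: "path X \<omega>0 \<in> space (seq_space E)" by (rule measurable_space[OF path_measurable])
  define \<tau> where "\<tau> n = truncate_seq (path X \<omega>0) (2 * n)" for n
  define \<sigma> where "\<sigma> n z = \<theta> \<bullet> S n (\<tau> n z)" for n z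
  \<comment> \<open>the truncated exponential, divided by its upper bound \<open>exp (n b)\<close>\<close>
  define f where "f n z = (if \<theta> \<bullet> S n z \<le> real n * b then exp (\<theta> \<bullet> S n z - real n * b) else 0)" for n z
  define U where "U n j \<omega> = f n (\<tau> n (later_path ((j - 1) * n) \<omega>))" for n j \<omega>
  define p where "p n = expectation (\<lambda>\<omega>. f n (\<tau> n (path X \<omega>)))" for n
  \<comment> \<open>a block occupies \<open>2 n\<close> coordinates and the next one starts \<open>n\<close> later, so at index distance
    \<open>L n\<close> there remains a gap of more than \<open>(L n - 2) n\<close>\<close>
  define L where "L n = nat \<lceil>exp (real n * \<eta>)\<rceil> + 3" for n
  define a where "a n = C * exp (- (real n * (2 * \<bar>q\<bar> + 2 * \<eta> + 1)))" for n
  have \<tau>: "\<tau> n \<in> seq_space E \<rightarrow>\<^sub>M seq_space E" for n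
    unfolding \<tau>_def by (rule truncate_seq_measurable[OF z0])
  have f_meas: "f n \<in> borel_measurable (seq_space E)" if "n \<ge> 1" for n
    unfolding f_def using S_measurable[OF that] by measurable
  have f_bound: "0 \<le> f n z" "f n z \<le> 1" for n z by (auto simp: f_def)
  have U_meas: "U n j \<in> borel_measurable M" if "n \<ge> 1" for n j
    unfolding U_def by (rule measurable_compose[OF measurable_compose[OF later_path_measurable \<tau>] f_meas[OF that]])
  have U_bound: "0 \<le> U n j \<omega>" "U n j \<omega> \<le> 1" for n j \<omega> using f_bound by (auto simp: U_def)
  have EU: "expectation (U n j) = p n" if "n \<ge> 1" for n j
    unfolding U_def p_def
    by (rule expectation_later_path[OF measurable_compose[OF \<tau> f_meas[OF that]]])
  have close: "\<forall>\<^sub>F n in sequentially. \<forall>z\<in>space (seq_space E). \<bar>\<theta> \<bullet> S n z - \<sigma> n z\<bar> \<le> real n * e" if "e > 0" for e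
    unfolding \<sigma>_def \<tau>_def by (rule truncate_seq_close[OF dep approx z0 that])
  have p_ge: "\<forall>\<^sub>F n in sequentially. exp (- (real n * (q + \<eta>))) \<le> p n"
    unfolding p_def q_def
  proof (rule truncated_moment_ge[OF dom \<delta> _ _ close _ \<eta>(1)])
    show "lim_log_mgf M X S ((1 + \<delta>) *\<^sub>R \<theta>) - ?l < \<delta> * b"
      using b(1) \<delta> by (simp add: pos_divide_less_eq mult.commute)
    show "\<sigma> n \<in> borel_measurable (seq_space E)" if "n \<ge> 1" for n
      unfolding \<sigma>_def using measurable_compose[OF \<tau> S_measurable[OF that]] by measurable
  qed (auto simp: f_def \<sigma>_def)
  have cov: "expectation (\<lambda>\<omega>. U n i \<omega> * U n j \<omega>) \<le> p n * p n + a n"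
    if n: "n \<ge> 1" and ij: "i \<ge> 1" "i + L n \<le> j" for n i j
  proof -
    define g where "g = L n - 2"
    have g: "g \<ge> 1" "exp (real n * \<eta>) \<le> real g"
    proof -
      have "real g = real (nat \<lceil>exp (real n * \<eta>)\<rceil>) + 1" by (simp add: g_def L_def)
      then show "exp (real n * \<eta>) \<le> real g" by linarith
    qed (simp add: g_def L_def)
    obtain d where d: "j = i + 2 + g + d"
      using ij(2) by (auto simp: g_def L_def le_iff_add)
    have "(i - 1) * n + 2 * n + g \<le> (j - 1) * n + 1"
    proof -
      obtain i' where i': "i = Suc i'" using ij(1) by (cases i) auto
      have "g \<le> g * n" using n by simp
      moreover have "(j - 1) * n = (i - 1) * n + 2 * n + g * n + d * n"
        unfolding d i' by (simp add: algebra_simps)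
      ultimately show ?thesis by linarith
    qed
    then have "expectation (\<lambda>\<omega>. U n i \<omega> * U n j \<omega>) \<le> expectation (U n i) * expectation (U n j) + alpha_mixing M E X g"
      unfolding U_def \<tau>_def using n g(1) z0
      by (intro expectation_mult_blocks_le f_meas f_bound) auto
    also have "\<dots> \<le> p n * p n + C * real g powr (- h)"
      using C(2)[OF g(1)] by (simp add: EU[OF n])
    also have "real g powr (- h) \<le> exp (real n * \<eta>) powr (- h)"
      using g(2) h(1) by (intro powr_mono2') auto
    also have "exp (real n * \<eta>) powr (- h) = exp (- (real n * (\<eta> * h)))"
      by (simp add: powr_def mult_ac)
    finally show ?thesis
      using C(1) by (simp add: a_def h(2) mult_left_mono)
  qed
  define A where "A n = {\<omega>\<in>space M. n \<ge> 1 \<and> (\<Sum>j\<in>{1..k n}. U n j \<omega>) \<le> real (k n) * p n / 2}" for n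
  have A: "A n \<in> events" for n
    using U_meas by (cases "n \<ge> 1") (auto simp: A_def intro!: borel_measurable_le borel_measurable_sum)
  define \<rho> where "\<rho> = min 1 (\<kappa> / 2)"
  have \<rho>: "\<rho> > 0" "\<rho> \<le> 1" "\<rho> \<le> \<kappa> / 2" using \<kappa> by (auto simp: \<rho>_def)
  have "\<forall>\<^sub>F n in sequentially. prob (A n) \<le> (40 + 4 * C) * exp (- (real n * \<rho>))"
    using p_ge growth eventually_ge_at_top[of 1]
  proof eventually_elim
    case (elim n)
    have p: "p n > 0" using elim(1) exp_gt_zero less_le_trans by blast
    have a: "a n \<ge> 0" using C(1) by (simp add: a_def)
    have "prob (A n) \<le> 8 * real (L n) / (real (k n) * p n) + 4 * a n / (p n)\<^sup>2"
    proof -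
      have "A n = {\<omega>\<in>space M. (\<Sum>j\<in>{1..k n}. U n j \<omega>) \<le> real (k n) * p n / 2}"
        using elim(3) by (simp add: A_def)
      then show ?thesis
        using prob_sum_small_le[of "k n" "U n" "p n" "L n" "a n"] U_meas[OF elim(3)] U_bound EU[OF elim(3)] p
          k[OF elim(3)] cov[OF elim(3)] a by auto
    qed
    also have "\<dots> \<le> 40 * exp (- (real n * \<rho>)) + 4 * C * exp (- (real n * \<rho>))"
    proof (rule add_mono)
      have "exp (real n * c) \<le> real (k n)"
      proof -
        have "real n * c \<le> ln (real (k n))" using elim(2,3) by (simp add: field_simps)
        then have "exp (real n * c) \<le> exp (ln (real (k n)))" by simp
        then show ?thesis using k[OF elim(3)] by simp
      qed
      then have "exp (real n * c) * exp (- (real n * (q + \<eta>))) \<le> real (k n) * p n"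
        using elim(1) by (intro mult_mono) auto
      then have kp: "exp (real n * (\<kappa> - \<eta>)) \<le> real (k n) * p n"
        by (simp add: \<kappa>_def algebra_simps flip: exp_add)
      have "real (L n) \<le> exp (real n * \<eta>) + 4"
        unfolding L_def using exp_gt_zero[of "real n * \<eta>"] by (simp add: of_nat_nat) linarith
      also have "\<dots> \<le> 5 * exp (real n * \<eta>)" using \<eta>(1) by simp
      finally have "8 * real (L n) / (real (k n) * p n) \<le> 8 * (5 * exp (real n * \<eta>)) / exp (real n * (\<kappa> - \<eta>))"
        using kp by (intro frac_le) auto
      also have "\<dots> = 40 * exp (- (real n * (\<kappa> - 2 * \<eta>)))"
      proof -
        have "8 * (5 * exp (real n * \<eta>)) / exp (real n * (\<kappa> - \<eta>)) = 40 * (exp (real n * \<eta>) / exp (real n * (\<kappa> - \<eta>)))"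
          by simp
        then show ?thesis unfolding exp_diff[symmetric] by (simp add: algebra_simps)
      qed
      also have "\<dots> \<le> 40 * exp (- (real n * \<rho>))"
        using \<eta>(3) \<rho>(3) by (simp add: mult_left_mono)
      finally show "8 * real (L n) / (real (k n) * p n) \<le> 40 * exp (- (real n * \<rho>))" .
    next
      have "(exp (- (real n * (q + \<eta>))))\<^sup>2 \<le> (p n)\<^sup>2" using elim(1) by (intro power_mono) auto
      then have "4 * a n / (p n)\<^sup>2 \<le> 4 * a n / (exp (- (real n * (q + \<eta>))))\<^sup>2"
        using a by (intro divide_left_mono) (auto intro!: mult_pos_pos p zero_less_power)
      also have "\<dots> = 4 * C * exp (real n * (- (2 * \<bar>q\<bar> + 2 * \<eta> + 1) + 2 * (q + \<eta>)))"
      proof -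
        have "4 * a n / (exp (- (real n * (q + \<eta>))))\<^sup>2
            = 4 * C * (exp (- (real n * (2 * \<bar>q\<bar> + 2 * \<eta> + 1))) / exp (2 * - (real n * (q + \<eta>))))"
          by (simp only: a_def power2_eq_square exp_double) simp
        then show ?thesis unfolding exp_diff[symmetric] by (simp add: algebra_simps)
      qed
      also have "\<dots> \<le> 4 * C * exp (real n * (- \<rho>))"
        using \<rho>(2) C(1) by (intro mult_left_mono exp_scale_mono) auto
      finally show "4 * a n / (p n)\<^sup>2 \<le> 4 * C * exp (- (real n * \<rho>))" by simp
    qed
    finally show ?case by (simp add: algebra_simps)
  qed
  from AE_eventually_notin[OF A \<rho>(1) this]
  show "AE \<omega> in M. \<forall>\<^sub>F n in sequentially. ?l - \<eta>0 \<le> emp_log_mgf X S k n \<omega> \<theta>"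
    using AE_space
  proof eventually_elim
    case (elim \<omega>)
    have two: "\<forall>\<^sub>F n in sequentially. 2 \<le> exp (real n * \<eta>)"
      by (rule eventually_le_exp) (rule \<eta>)
    show ?case
      using elim(1) close[OF \<eta>(1)] p_ge two eventually_ge_at_top[of 1]
    proof eventually_elim
      case (elim n)
      have big: "real (k n) * p n / 2 \<le> (\<Sum>j\<in>{1..k n}. U n j \<omega>)"
        using elim(1,5) \<open>\<omega> \<in> space M\<close> by (simp add: A_def)
      have each: "exp (real n * (b - \<eta>)) * U n j \<omega> \<le> exp (\<theta> \<bullet> S n (later_path ((j - 1) * n) \<omega>))" for j
      proof -
        let ?z = "later_path ((j - 1) * n) \<omega>"
        have "\<sigma> n ?z \<le> \<theta> \<bullet> S n ?z + real n * \<eta>"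
          using bspec[OF elim(2) later_path_space[OF \<open>\<omega> \<in> space M\<close>], of "(j - 1) * n"] by linarith
        then have "exp (real n * (b - \<eta>)) * exp (\<sigma> n ?z - real n * b) \<le> exp (\<theta> \<bullet> S n ?z)"
          by (simp add: algebra_simps flip: exp_add)
        then show ?thesis by (simp add: U_def f_def \<sigma>_def)
      qed
      have "exp (real n * (?l - \<eta>0)) \<le> exp (real n * (b - \<eta>) + - (real n * (q + \<eta>)) - real n * \<eta>)"
        using mult_left_mono[OF \<eta>(2), of "real n"] by (simp add: q_def algebra_simps)
      also have "\<dots> = exp (real n * (b - \<eta>)) * (exp (- (real n * (q + \<eta>))) / exp (real n * \<eta>))"
        by (simp only: exp_add exp_diff times_divide_eq_right)
      also have "\<dots> \<le> exp (real n * (b - \<eta>)) * (p n / 2)"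
        using elim(3,4) by (intro mult_left_mono frac_le) (auto intro: order_trans[OF exp_ge_zero])
      also have "\<dots> = exp (real n * (b - \<eta>)) * (real (k n) * p n / 2) / real (k n)"
        using k[OF elim(5)] by simp
      also have "\<dots> \<le> exp (real n * (b - \<eta>)) * (\<Sum>j\<in>{1..k n}. U n j \<omega>) / real (k n)"
        using big by (intro divide_right_mono mult_left_mono) auto
      also have "\<dots> \<le> partition_mean k \<theta> n \<omega>"
        unfolding partition_mean_def sum_distrib_left by (intro divide_right_mono sum_mono each) simp
      also have "\<dots> = exp (real n * emp_log_mgf X S k n \<omega> \<theta>)"
        by (rule exp_emp_log_mgf[symmetric]) (use elim(5) k in auto)
      finally show ?case using elim(5) by simp
    qed
  qed
qed

end

section \<open>The limiting free energy\<close>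

lemma gderiv_along_line:
  fixes f :: "'v::euclidean_space \<Rightarrow> real"
  assumes "GDERIV f x :> D" "a + t *\<^sub>R h = x"
  shows "((\<lambda>s. f (a + s *\<^sub>R h)) has_real_derivative h \<bullet> D) (at t)"
proof -
  have "((\<lambda>s. a + s *\<^sub>R h) has_derivative (\<lambda>s. s *\<^sub>R h)) (at t)"
    by (auto intro!: derivative_eq_intros)
  moreover have "(f has_derivative (\<lambda>h. h \<bullet> D)) (at (a + t *\<^sub>R h))"
    using assms by (simp add: gderiv_def)
  ultimately have "((\<lambda>s. f (a + s *\<^sub>R h)) has_derivative (\<lambda>s. (s *\<^sub>R h) \<bullet> D)) (at t)"
    by (rule has_derivative_compose)
  then show ?thesis
    by (simp add: has_field_derivative_def mult.commute[of _ "h \<bullet> D"] fun_eq_iff[symmetric] mult_commute_abs)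
qed

lemma emp_log_mgf_fun:
  assumes "\<And>n. n \<ge> 1 \<Longrightarrow> k n > 0"
  shows "emp_log_mgf X S k n \<omega> = free_energy k (\<lambda>n j. emp_point X S n j \<omega>) n"
proof (cases "n = 0")
  case True
  \<comment> \<open>both sides divide by \<open>0\<close>\<close>
  then show ?thesis by (simp add: fun_eq_iff emp_log_mgf_def free_energy_def)
next
  case False
  then show ?thesis
    by (intro ext emp_log_mgf_eq_free_energy) (simp add: assms)
qed

text \<open>Taking \<open>\<eta> = \<epsilon>\<close> leaves an error that vanishes with \<open>\<epsilon>\<close>.\<close>

lemma iterated_limitI:
  assumes "\<And>\<epsilon> \<eta>. \<epsilon> > 0 \<Longrightarrow> \<eta> > 0 \<Longrightarrow> \<forall>\<^sub>F n in sequentially.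
    ereal (l - \<epsilon> * K - \<eta>) \<le> f \<epsilon> n \<and> f \<epsilon> n \<le> ereal (l + \<epsilon> * K + \<eta>)"
  shows "iterated_limit f (ereal l)"
proof -
  have pos: "\<forall>\<^sub>F \<epsilon>::real in at_right 0. \<epsilon> > 0" by (rule eventually_at_right_less)
  have low: "ereal (l - \<epsilon> * (K + 1)) \<le> liminf (f \<epsilon>)" if "\<epsilon> > 0" for \<epsilon>
    using assms[OF that that] by (intro Liminf_bounded) (auto elim!: eventually_mono simp: algebra_simps)
  have up: "limsup (f \<epsilon>) \<le> ereal (l + \<epsilon> * (K + 1))" if "\<epsilon> > 0" for \<epsilon>
    using assms[OF that that] by (intro Limsup_bounded) (auto elim!: eventually_mono simp: algebra_simps)
  have mid: "liminf (f \<epsilon>) \<le> limsup (f \<epsilon>)" for \<epsilon> by (rule Liminf_le_Limsup) simp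
  have "((\<lambda>\<epsilon>. l - \<epsilon> * (K + 1)) \<longlongrightarrow> l - 0 * (K + 1)) (at_right 0)"
    "((\<lambda>\<epsilon>. l + \<epsilon> * (K + 1)) \<longlongrightarrow> l + 0 * (K + 1)) (at_right 0)"
    by (intro tendsto_intros)+
  then have lims: "((\<lambda>\<epsilon>. ereal (l - \<epsilon> * (K + 1))) \<longlongrightarrow> ereal l) (at_right 0)"
    "((\<lambda>\<epsilon>. ereal (l + \<epsilon> * (K + 1))) \<longlongrightarrow> ereal l) (at_right 0)"
    by simp_all
  have "((\<lambda>\<epsilon>. liminf (f \<epsilon>)) \<longlongrightarrow> ereal l) (at_right 0)"
    by (rule tendsto_sandwich[OF eventually_mono[OF pos] eventually_mono[OF pos] lims])
      (fact low, rule order_trans[OF mid up])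
  moreover have "((\<lambda>\<epsilon>. limsup (f \<epsilon>)) \<longlongrightarrow> ereal l) (at_right 0)"
    by (rule tendsto_sandwich[OF eventually_mono[OF pos] eventually_mono[OF pos] lims])
      (rule order_trans[OF low mid], assumption, fact up)
  ultimately show ?thesis unfolding iterated_limit_def ..
qed

lemma local_large_deviations:
  fixes S :: "nat \<Rightarrow> (nat \<Rightarrow> 'e) \<Rightarrow> 'v::euclidean_space"
  assumes k: "\<And>n. n \<ge> 1 \<Longrightarrow> k n > 0" and r: "r > 0"
    and lim: "\<And>\<theta>. \<theta> \<in> cball \<theta>\<^sub>0 r \<Longrightarrow> (\<lambda>n. emp_log_mgf X S k n \<omega> \<theta>) \<longlonglongrightarrow> g \<theta>"
    and D: "GDERIV g \<theta>\<^sub>0 :> x\<^sub>0"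
  shows "iterated_limit
    (\<lambda>\<epsilon> n. ereal (1 / real n) * elog (emeasure (emp_measure X S k n \<omega>) (cball x\<^sub>0 \<epsilon>)))
    (ereal (g \<theta>\<^sub>0 - \<theta>\<^sub>0 \<bullet> x\<^sub>0))"
proof (rule iterated_limitI)
  fix \<epsilon> \<eta> :: real assume \<epsilon>: "\<epsilon> > 0" and \<eta>: "\<eta> > 0"
  let ?x = "\<lambda>n j. emp_point X S n j \<omega>"
  have lim': "(\<lambda>n. free_energy k ?x n \<theta>) \<longlonglongrightarrow> g \<theta>" if "\<theta> \<in> cball \<theta>\<^sub>0 r" for \<theta>
    using lim[OF that] emp_log_mgf_fun[of k X S _ \<omega>, OF k] by simp
  have "\<forall>\<^sub>F n in sequentially. free_energy k ?x n \<theta>\<^sub>0 < g \<theta>\<^sub>0 + \<eta>"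
    by (rule order_tendstoD(2)[OF lim']) (use r \<eta> in auto)
  moreover have "\<forall>\<^sub>F n in sequentially. exp (- (real n * (\<theta>\<^sub>0 \<bullet> x\<^sub>0 - g \<theta>\<^sub>0 + \<epsilon> * norm \<theta>\<^sub>0 + \<eta>)))
      \<le> real (card {j \<in> {1..k n}. ?x n j \<in> cball x\<^sub>0 \<epsilon>}) / real (k n)"
    by (rule card_near_gradient_ge) (fact k r lim' D \<epsilon> \<eta>)+
  ultimately show "\<forall>\<^sub>F n in sequentially.
    ereal (g \<theta>\<^sub>0 - \<theta>\<^sub>0 \<bullet> x\<^sub>0 - \<epsilon> * norm \<theta>\<^sub>0 - \<eta>)
      \<le> ereal (1 / real n) * elog (emeasure (emp_measure X S k n \<omega>) (cball x\<^sub>0 \<epsilon>)) \<and>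
    ereal (1 / real n) * elog (emeasure (emp_measure X S k n \<omega>) (cball x\<^sub>0 \<epsilon>))
      \<le> ereal (g \<theta>\<^sub>0 - \<theta>\<^sub>0 \<bullet> x\<^sub>0 + \<epsilon> * norm \<theta>\<^sub>0 + \<eta>)"
  using eventually_ge_at_top[of 1]
  proof eventually_elim
    case (elim n)
    have n: "n \<ge> 1" by (rule elim(3))
    define y where "y = real (card {j \<in> {1..k n}. ?x n j \<in> cball x\<^sub>0 \<epsilon>}) / real (k n)"
    have y_ge: "exp (- (real n * (\<theta>\<^sub>0 \<bullet> x\<^sub>0 - g \<theta>\<^sub>0 + \<epsilon> * norm \<theta>\<^sub>0 + \<eta>))) \<le> y"
      using elim(2) by (simp add: y_def)
    then have y: "y > 0" using exp_gt_zero less_le_trans by blast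
    have "emeasure (emp_measure X S k n \<omega>) (cball x\<^sub>0 \<epsilon>) = ennreal y"
      unfolding y_def by (rule emeasure_emp_measure) (use k n in auto)
    then have val: "ereal (1 / real n) * elog (emeasure (emp_measure X S k n \<omega>) (cball x\<^sub>0 \<epsilon>)) = ereal (ln y / real n)"
      using y by (simp add: elog_def)
    have "- (real n * (\<theta>\<^sub>0 \<bullet> x\<^sub>0 - g \<theta>\<^sub>0 + \<epsilon> * norm \<theta>\<^sub>0 + \<eta>)) \<le> ln y"
      using y y_ge by (simp add: ln_ge_iff)
    then have lower: "g \<theta>\<^sub>0 - \<theta>\<^sub>0 \<bullet> x\<^sub>0 - \<epsilon> * norm \<theta>\<^sub>0 - \<eta> \<le> ln y / real n"
      using n
      by (subst pos_le_divide_eq) (simp_all add: algebra_simps)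
    have "y \<le> exp (real n * (free_energy k ?x n \<theta>\<^sub>0 - \<theta>\<^sub>0 \<bullet> x\<^sub>0 + \<epsilon> * norm \<theta>\<^sub>0))"
      unfolding y_def by (rule card_near_le) (use k n in auto)
    also have "\<dots> \<le> exp (real n * (g \<theta>\<^sub>0 - \<theta>\<^sub>0 \<bullet> x\<^sub>0 + \<epsilon> * norm \<theta>\<^sub>0 + \<eta>))"
      using elim(1) by (intro exp_scale_mono) simp
    finally have "exp (ln y) \<le> exp (real n * (g \<theta>\<^sub>0 - \<theta>\<^sub>0 \<bullet> x\<^sub>0 + \<epsilon> * norm \<theta>\<^sub>0 + \<eta>))"
      using y by simp
    then have "ln y \<le> real n * (g \<theta>\<^sub>0 - \<theta>\<^sub>0 \<bullet> x\<^sub>0 + \<epsilon> * norm \<theta>\<^sub>0 + \<eta>)"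
      by (simp only: exp_le_cancel_iff)
    then have "ln y / real n \<le> g \<theta>\<^sub>0 - \<theta>\<^sub>0 \<bullet> x\<^sub>0 + \<epsilon> * norm \<theta>\<^sub>0 + \<eta>"
      using n  by (simp add: pos_divide_le_eq mult.commute)
    with lower show ?case unfolding val by simp
  qed
qed

context stationary_sums
begin

abbreviation \<Lambda> :: "'v \<Rightarrow> real" where "\<Lambda> \<equiv> lim_log_mgf M X S"
abbreviation dom\<Lambda> :: "'v set" where "dom\<Lambda> \<equiv> lim_log_mgf_dom M X S"

text \<open>
  As for the empirical free energy, convexity of \<open>exp\<close> replaces Hoelder's inequality once the
  moments at \<open>a\<close> and \<open>b\<close> are divided by their asymptotic upper bounds.
\<close>

lemma lim_log_mgf_convex_ineq:
  assumes dom: "a \<in> dom\<Lambda>" "b \<in> dom\<Lambda>" "(1 - u) *\<^sub>R a + u *\<^sub>R b \<in> dom\<Lambda>" and u: "0 \<le> u" "u \<le> 1"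
  shows "\<Lambda> ((1 - u) *\<^sub>R a + u *\<^sub>R b) \<le> (1 - u) * \<Lambda> a + u * \<Lambda> b"
proof (rule field_le_epsilon)
  fix e :: real assume e: "e > 0"
  define c where "c = (1 - u) *\<^sub>R a + u *\<^sub>R b"
  define \<eta> where "\<eta> = e / 2"
  have \<eta>: "\<eta> > 0" using e by (simp add: \<eta>_def)
  define m where "m = (1 - u) * (\<Lambda> a + \<eta>) + u * (\<Lambda> b + \<eta>)"
  have m_eq: "m = (1 - u) * \<Lambda> a + u * \<Lambda> b + \<eta>" by (simp add: m_def algebra_simps)
  have dc: "c \<in> dom\<Lambda>" using dom(3) by (simp add: c_def)
  have "\<forall>\<^sub>F n in sequentially. exp_moment n a \<le> ennreal (exp (real n * (\<Lambda> a + \<eta>)))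
      \<and> exp_moment n b \<le> ennreal (exp (real n * (\<Lambda> b + \<eta>)))
      \<and> ennreal (exp (real n * (\<Lambda> c - \<eta>))) \<le> exp_moment n c \<and> n \<ge> 1"
    using exp_moment_bounds[OF log_mgf_tendsto[OF dom(1)] \<eta>] exp_moment_bounds[OF log_mgf_tendsto[OF dom(2)] \<eta>]
      exp_moment_bounds[OF log_mgf_tendsto[OF dc] \<eta>] eventually_ge_at_top[of 1]
    by eventually_elim auto
  from eventually_happens[OF this] obtain n where n: "exp_moment n a \<le> ennreal (exp (real n * (\<Lambda> a + \<eta>)))"
    "exp_moment n b \<le> ennreal (exp (real n * (\<Lambda> b + \<eta>)))"
    "ennreal (exp (real n * (\<Lambda> c - \<eta>))) \<le> exp_moment n c" "n \<ge> 1" by auto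
  let ?S = "\<lambda>\<omega>. S n (path X \<omega>)"
  have meas: "(\<lambda>\<omega>. exp (\<theta> \<bullet> ?S \<omega>)) \<in> borel_measurable M" for \<theta>
    by (rule measurable_compose[OF path_measurable exp_inner_S_measurable[OF n(4)]])
  let ?wa = "(1 - u) * exp (- (real n * (\<Lambda> a + \<eta>)))" and ?wb = "u * exp (- (real n * (\<Lambda> b + \<eta>)))"
  have "ennreal (exp (real n * (\<Lambda> c - \<eta> - m))) = ennreal (exp (- (real n * m))) * ennreal (exp (real n * (\<Lambda> c - \<eta>)))"
    by (simp add: algebra_simps flip: ennreal_mult exp_add)
  also have "\<dots> \<le> ennreal (exp (- (real n * m))) * exp_moment n c"
    using n(3) by (intro mult_left_mono) auto
  also have "\<dots> = (\<integral>\<^sup>+\<omega>. ennreal (exp (- (real n * m))) * ennreal (exp (c \<bullet> ?S \<omega>)) \<partial>M)"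
    unfolding exp_moment_def using meas by (subst nn_integral_cmult) auto
  also have "\<dots> \<le> (\<integral>\<^sup>+\<omega>. ennreal ?wa * ennreal (exp (a \<bullet> ?S \<omega>)) + ennreal ?wb * ennreal (exp (b \<bullet> ?S \<omega>)) \<partial>M)"
  proof (rule nn_integral_mono)
    fix \<omega>
    have "exp (- (real n * m)) * exp (c \<bullet> ?S \<omega>)
        = exp ((1 - u) *\<^sub>R (a \<bullet> ?S \<omega> - real n * (\<Lambda> a + \<eta>)) + u *\<^sub>R (b \<bullet> ?S \<omega> - real n * (\<Lambda> b + \<eta>)))"
      unfolding exp_add[symmetric] c_def m_def by (simp add: inner_add_left algebra_simps)
    also have "\<dots> \<le> (1 - u) * exp (a \<bullet> ?S \<omega> - real n * (\<Lambda> a + \<eta>)) + u * exp (b \<bullet> ?S \<omega> - real n * (\<Lambda> b + \<eta>))"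
      by (rule convex_onD[OF exp_convex]) (use u in auto)
    also have "\<dots> = ?wa * exp (a \<bullet> ?S \<omega>) + ?wb * exp (b \<bullet> ?S \<omega>)"
      by (simp add: exp_diff exp_minus divide_inverse mult_ac)
    finally have "ennreal (exp (- (real n * m)) * exp (c \<bullet> ?S \<omega>)) \<le> ennreal (?wa * exp (a \<bullet> ?S \<omega>) + ?wb * exp (b \<bullet> ?S \<omega>))"
      by (rule ennreal_leI)
    then show "ennreal (exp (- (real n * m))) * ennreal (exp (c \<bullet> ?S \<omega>))
        \<le> ennreal ?wa * ennreal (exp (a \<bullet> ?S \<omega>)) + ennreal ?wb * ennreal (exp (b \<bullet> ?S \<omega>))"
      using u by (simp only: ennreal_mult[symmetric] ennreal_plus[symmetric] exp_ge_zero mult_nonneg_nonneg diff_ge_0_iff_ge)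
  qed
  also have "\<dots> = ennreal ?wa * exp_moment n a + ennreal ?wb * exp_moment n b"
    unfolding exp_moment_def using meas[of a] meas[of b]
    by (subst nn_integral_add) (auto simp: nn_integral_cmult)
  also have "\<dots> \<le> ennreal ?wa * ennreal (exp (real n * (\<Lambda> a + \<eta>))) + ennreal ?wb * ennreal (exp (real n * (\<Lambda> b + \<eta>)))"
    using n by (intro add_mono mult_left_mono) auto
  also have "\<dots> = ennreal (1 - u) + ennreal u"
    using u by (simp add: exp_minus mult.assoc flip: ennreal_mult)
  also have "\<dots> = ennreal 1" using u by (simp flip: ennreal_plus)
  finally have "exp (real n * (\<Lambda> c - \<eta> - m)) \<le> 1" by simp
  then have "\<Lambda> c - \<eta> - m \<le> 0" using n(4) by (simp add: mult_le_0_iff)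
  then show "\<Lambda> ((1 - u) *\<^sub>R a + u *\<^sub>R b) \<le> (1 - u) * \<Lambda> a + u * \<Lambda> b + e"
    using m_eq unfolding \<eta>_def c_def by linarith
qed

lemma convex_on_lim_log_mgf:
  assumes "convex D" "D \<subseteq> dom\<Lambda>"
  shows "convex_on D \<Lambda>"
proof (rule convex_onI[OF _ assms(1)])
  fix t :: real and x y assume *: "0 < t" "t < 1" "x \<in> D" "y \<in> D"
  then have "(1 - t) *\<^sub>R x + t *\<^sub>R y \<in> D" using convexD_alt[OF assms(1)] by simp
  then show "\<Lambda> ((1 - t) *\<^sub>R x + t *\<^sub>R y) \<le> (1 - t) * \<Lambda> x + t * \<Lambda> y"
    using * assms(2) by (intro lim_log_mgf_convex_ineq) auto
qed

text \<open>
  The domain of \<open>\<Lambda>\<close> need not be convex, but a segment from \<open>\<theta>\<^sub>0\<close> to any point of it starts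
  inside the open set \<open>D\<close>, and the convexity inequality near \<open>\<theta>\<^sub>0\<close> suffices to compare slopes.
\<close>

lemma lim_log_mgf_above_tangent:
  assumes D: "open D" "D \<subseteq> dom\<Lambda>" "\<theta>\<^sub>0 \<in> D" and grad: "GDERIV \<Lambda> \<theta>\<^sub>0 :> x\<^sub>0" and \<theta>: "\<theta> \<in> dom\<Lambda>"
  shows "\<Lambda> \<theta>\<^sub>0 + (\<theta> - \<theta>\<^sub>0) \<bullet> x\<^sub>0 \<le> \<Lambda> \<theta>"
proof -
  define h where "h = \<theta> - \<theta>\<^sub>0"
  have "((\<lambda>s. \<Lambda> (\<theta>\<^sub>0 + s *\<^sub>R h)) has_real_derivative h \<bullet> x\<^sub>0) (at 0)"
    by (rule gderiv_along_line[OF grad]) simp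
  then have "((\<lambda>s. (\<Lambda> (\<theta>\<^sub>0 + s *\<^sub>R h) - \<Lambda> \<theta>\<^sub>0) / s) \<longlongrightarrow> h \<bullet> x\<^sub>0) (at 0)"
    by (simp add: DERIV_def)
  then have lim: "((\<lambda>s. (\<Lambda> (\<theta>\<^sub>0 + s *\<^sub>R h) - \<Lambda> \<theta>\<^sub>0) / s) \<longlongrightarrow> h \<bullet> x\<^sub>0) (at_right 0)"
    by (rule tendsto_mono[OF at_le[OF subset_UNIV]])
  have "((\<lambda>s. \<theta>\<^sub>0 + s *\<^sub>R h) \<longlongrightarrow> \<theta>\<^sub>0 + 0 *\<^sub>R h) (at_right 0)" by (intro tendsto_intros)
  then have inD: "\<forall>\<^sub>F s in at_right 0. \<theta>\<^sub>0 + s *\<^sub>R h \<in> D"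
    using D by (auto dest: topological_tendstoD)
  have "\<forall>\<^sub>F s::real in at_right 0. s < 1" "\<forall>\<^sub>F s::real in at_right 0. 0 < s"
    by (auto simp: eventually_at_right_less eventually_at_right[of 0 1] intro!: exI[of _ 1])
  with inD have "\<forall>\<^sub>F s in at_right 0. (\<Lambda> (\<theta>\<^sub>0 + s *\<^sub>R h) - \<Lambda> \<theta>\<^sub>0) / s \<le> \<Lambda> \<theta> - \<Lambda> \<theta>\<^sub>0"
  proof eventually_elim
    case (elim s)
    have eq: "\<theta>\<^sub>0 + s *\<^sub>R h = (1 - s) *\<^sub>R \<theta>\<^sub>0 + s *\<^sub>R \<theta>" by (simp add: h_def algebra_simps)
    have "\<Lambda> (\<theta>\<^sub>0 + s *\<^sub>R h) \<le> (1 - s) * \<Lambda> \<theta>\<^sub>0 + s * \<Lambda> \<theta>"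
      using elim D \<theta> unfolding eq by (intro lim_log_mgf_convex_ineq) auto
    then have "\<Lambda> (\<theta>\<^sub>0 + s *\<^sub>R h) - \<Lambda> \<theta>\<^sub>0 \<le> (\<Lambda> \<theta> - \<Lambda> \<theta>\<^sub>0) * s" by (simp add: algebra_simps)
    then show ?case using elim(3) by (simp only: pos_divide_le_eq)
  qed
  then have "h \<bullet> x\<^sub>0 \<le> \<Lambda> \<theta> - \<Lambda> \<theta>\<^sub>0"
    by (rule tendsto_upperbound[OF lim]) simp
  then show ?thesis by (simp add: h_def)
qed

lemma rate_at_gradient:
  assumes D: "open D" "D \<subseteq> dom\<Lambda>" "\<theta>\<^sub>0 \<in> D" and grad: "GDERIV \<Lambda> \<theta>\<^sub>0 :> x\<^sub>0"
  shows "rate M X S x\<^sub>0 = ereal (\<theta>\<^sub>0 \<bullet> x\<^sub>0 - \<Lambda> \<theta>\<^sub>0)"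
  unfolding rate_def legendre_def
proof (rule antisym)
  show "(SUP \<theta>\<in>dom\<Lambda>. ereal (\<theta> \<bullet> x\<^sub>0 - \<Lambda> \<theta>)) \<le> ereal (\<theta>\<^sub>0 \<bullet> x\<^sub>0 - \<Lambda> \<theta>\<^sub>0)"
    using lim_log_mgf_above_tangent[OF assms]
    by (intro SUP_least) (auto simp: inner_diff_left algebra_simps)
  show "ereal (\<theta>\<^sub>0 \<bullet> x\<^sub>0 - \<Lambda> \<theta>\<^sub>0) \<le> (SUP \<theta>\<in>dom\<Lambda>. ereal (\<theta> \<bullet> x\<^sub>0 - \<Lambda> \<theta>))"
    using D by (intro SUP_upper) auto
qed

end

section \<open>Subcritical, critical and supercritical growth\<close>

lemma countable_dense_in_open_sets:
  "\<exists>Q :: 'v::euclidean_space set. countable Q \<and> (\<forall>U. open U \<longrightarrow> U \<subseteq> closure (Q \<inter> U))"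
proof -
  obtain Q :: "'v set" where Q: "countable Q" "\<And>X. open X \<Longrightarrow> X \<noteq> {} \<Longrightarrow> \<exists>d\<in>Q. d \<in> X"
    using countable_dense_setE by blast
  have "U \<subseteq> closure (Q \<inter> U)" if U: "open U" for U
  proof
    fix x assume x: "x \<in> U"
    show "x \<in> closure (Q \<inter> U)"
      unfolding closure_approachable
    proof safe
      fix e :: real assume "e > 0"
      then have "open (ball x e \<inter> U)" "x \<in> ball x e \<inter> U" using U x by auto
      then obtain d where "d \<in> Q" "d \<in> ball x e \<inter> U" using Q(2)[of "ball x e \<inter> U"] by blast
      then show "\<exists>y\<in>Q \<inter> U. dist y x < e" by (auto simp: dist_commute)
    qed
  qed
  with Q(1) show ?thesis by (intro exI[of _ Q] conjI allI impI)
qed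

locale mixing_sums = stationary_sums M E X S
  for M :: "'a measure" and E :: "'e measure" and X :: "nat \<Rightarrow> 'a \<Rightarrow> 'e"
    and S :: "nat \<Rightarrow> (nat \<Rightarrow> 'e) \<Rightarrow> 'v::euclidean_space" +
  fixes S' :: "nat \<Rightarrow> (nat \<Rightarrow> 'e) \<Rightarrow> 'v" and k :: "nat \<Rightarrow> nat" and D :: "'v set" and \<theta>\<^sub>0 x\<^sub>0 :: 'v
  assumes k: "\<And>n. n \<ge> 1 \<Longrightarrow> k n > 0"
    and mixing: "\<And>h::real. h > 0 \<Longrightarrow> mixing_moment M E X h < \<infinity>"
    and dep: "\<And>n. n \<ge> 1 \<Longrightarrow> depends_on_first E (2 * n) (S' n)"
    and approx: "(\<lambda>n. SUP z \<in> space (seq_space E). ereal (norm (S n z - S' n z) / real n)) \<longlonglongrightarrow> 0"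
    and D: "convex D" "open D" "D \<subseteq> lim_log_mgf_dom M X S" "\<theta>\<^sub>0 \<in> D"
    and grad: "GDERIV (lim_log_mgf M X S) \<theta>\<^sub>0 :> x\<^sub>0"
begin

abbreviation growth :: "nat \<Rightarrow> real" where "growth n \<equiv> ln (real (k n)) / real n"

abbreviation I\<^sub>0 :: real where "I\<^sub>0 \<equiv> \<theta>\<^sub>0 \<bullet> x\<^sub>0 - \<Lambda> \<theta>\<^sub>0"

lemma rate_eq: "rate M X S x\<^sub>0 = ereal I\<^sub>0"
  by (rule rate_at_gradient[OF D(2-4) grad])

lemma emp_log_mgf_eq: "emp_log_mgf X S k n \<omega> = free_energy k (\<lambda>n j. emp_point X S n j \<omega>) n"
  by (rule emp_log_mgf_fun) (rule k)

lemma AE_upper: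
  assumes "\<theta> \<in> dom\<Lambda>"
  shows "AE \<omega> in M. \<forall>\<eta>>0. \<forall>\<^sub>F n in sequentially. emp_log_mgf X S k n \<omega> \<theta> \<le> \<Lambda> \<theta> + \<eta>"
  by (rule AE_emp_log_mgf_upper[OF _ assms]) (rule k)

lemma AE_emp_log_mgf_tendsto:
  assumes dom: "\<theta> \<in> dom\<Lambda>" "(1 + \<delta>) *\<^sub>R \<theta> \<in> dom\<Lambda>" and \<delta>: "\<delta> > 0"
    and slope: "(\<Lambda> ((1 + \<delta>) *\<^sub>R \<theta>) - \<Lambda> \<theta>) / \<delta> - \<Lambda> \<theta> < c"
    and c: "\<forall>\<^sub>F n in sequentially. c \<le> growth n"
  shows "AE \<omega> in M. (\<lambda>n. emp_log_mgf X S k n \<omega> \<theta>) \<longlonglongrightarrow> \<Lambda> \<theta>"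
proof -
  have "AE \<omega> in M. \<forall>\<eta>>0. \<forall>\<^sub>F n in sequentially. \<Lambda> \<theta> - \<eta> \<le> emp_log_mgf X S k n \<omega> \<theta>"
    by (rule AE_emp_log_mgf_lower[of k S' \<theta> \<delta> c]) (fact k mixing dep approx dom \<delta> slope c)+
  with AE_upper[OF dom(1)] show ?thesis
  proof eventually_elim
    case (elim \<omega>)
    show ?case
      unfolding tendsto_iff
    proof safe
      fix e :: real assume "e > 0"
      then have "e / 2 > 0" by simp
      with elim have "\<forall>\<^sub>F n in sequentially. emp_log_mgf X S k n \<omega> \<theta> \<le> \<Lambda> \<theta> + e / 2"
        "\<forall>\<^sub>F n in sequentially. \<Lambda> \<theta> - e / 2 \<le> emp_log_mgf X S k n \<omega> \<theta>" by blast+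
      then show "\<forall>\<^sub>F n in sequentially. dist (emp_log_mgf X S k n \<omega> \<theta>) (\<Lambda> \<theta>) < e"
        by eventually_elim (use \<open>e > 0\<close> in \<open>simp add: dist_real_def abs_less_iff\<close>)
    qed
  qed
qed

lemma continuous_on_lim_log_mgf: "continuous_on D \<Lambda>"
  by (rule convex_on_continuous[OF D(2) convex_on_lim_log_mgf[OF D(1,3)]])

text \<open>
  As \<open>\<delta>\<close> tends to \<open>0\<close>, the quotient tends to \<open>\<theta>\<^sub>0 \<bullet> x\<^sub>0\<close> at \<open>\<theta>\<^sub>0\<close>, and for fixed \<open>\<delta>\<close>
  it is continuous in \<open>\<theta>\<close>; so the second-moment criterion persists near \<open>\<theta>\<^sub>0\<close>, where \<open>\<Lambda>\<close> itself
  need not be differentiable.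
\<close>

lemma slope_criterion_near:
  assumes c: "I\<^sub>0 < c"
  obtains \<delta> r where "\<delta> > 0" "r > 0" "ball \<theta>\<^sub>0 r \<subseteq> D" "\<And>\<theta>. \<theta> \<in> ball \<theta>\<^sub>0 r \<Longrightarrow> (1 + \<delta>) *\<^sub>R \<theta> \<in> D"
    "\<And>\<theta>. \<theta> \<in> ball \<theta>\<^sub>0 r \<Longrightarrow> (\<Lambda> ((1 + \<delta>) *\<^sub>R \<theta>) - \<Lambda> \<theta>) / \<delta> - \<Lambda> \<theta> < c"
proof -
  have "((\<lambda>s. \<Lambda> (\<theta>\<^sub>0 + s *\<^sub>R \<theta>\<^sub>0)) has_real_derivative \<theta>\<^sub>0 \<bullet> x\<^sub>0) (at 0)"
    by (rule gderiv_along_line[OF grad]) simp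
  then have "((\<lambda>s. (\<Lambda> (\<theta>\<^sub>0 + s *\<^sub>R \<theta>\<^sub>0) - \<Lambda> \<theta>\<^sub>0) / s) \<longlongrightarrow> \<theta>\<^sub>0 \<bullet> x\<^sub>0) (at 0)"
    by (simp add: DERIV_def)
  then have "((\<lambda>s. (\<Lambda> (\<theta>\<^sub>0 + s *\<^sub>R \<theta>\<^sub>0) - \<Lambda> \<theta>\<^sub>0) / s) \<longlongrightarrow> \<theta>\<^sub>0 \<bullet> x\<^sub>0) (at_right 0)"
    by (rule tendsto_mono[OF at_le[OF subset_UNIV]])
  then have "\<forall>\<^sub>F s in at_right 0. (\<Lambda> (\<theta>\<^sub>0 + s *\<^sub>R \<theta>\<^sub>0) - \<Lambda> \<theta>\<^sub>0) / s < c + \<Lambda> \<theta>\<^sub>0"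
    by (rule order_tendstoD(2)) (use c in simp)
  moreover have "((\<lambda>s. \<theta>\<^sub>0 + s *\<^sub>R \<theta>\<^sub>0) \<longlongrightarrow> \<theta>\<^sub>0 + 0 *\<^sub>R \<theta>\<^sub>0) (at_right 0)" by (intro tendsto_intros)
  then have "\<forall>\<^sub>F s in at_right 0. \<theta>\<^sub>0 + s *\<^sub>R \<theta>\<^sub>0 \<in> D" using D by (auto dest: topological_tendstoD)
  moreover have "\<forall>\<^sub>F s::real in at_right 0. 0 < s" by (rule eventually_at_right_less)
  ultimately have "\<forall>\<^sub>F s in at_right 0. (\<Lambda> (\<theta>\<^sub>0 + s *\<^sub>R \<theta>\<^sub>0) - \<Lambda> \<theta>\<^sub>0) / s < c + \<Lambda> \<theta>\<^sub>0
      \<and> \<theta>\<^sub>0 + s *\<^sub>R \<theta>\<^sub>0 \<in> D \<and> 0 < s"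
    by eventually_elim simp
  from eventually_happens[OF this] obtain \<delta> where \<delta>: "\<delta> > 0" "(1 + \<delta>) *\<^sub>R \<theta>\<^sub>0 \<in> D"
    "(\<Lambda> ((1 + \<delta>) *\<^sub>R \<theta>\<^sub>0) - \<Lambda> \<theta>\<^sub>0) / \<delta> - \<Lambda> \<theta>\<^sub>0 < c"
    by (auto simp: scaleR_add_left)
  have scale: "((\<lambda>\<theta>. (1 + \<delta>) *\<^sub>R \<theta>) \<longlongrightarrow> (1 + \<delta>) *\<^sub>R \<theta>\<^sub>0) (nhds \<theta>\<^sub>0)"
    by (intro tendsto_intros filterlim_ident)
  have cont: "(\<Lambda> \<longlongrightarrow> \<Lambda> y) (nhds y)" if "y \<in> D" for y
    using continuous_on_lim_log_mgf D(2) that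
    by (simp add: continuous_on_eq_continuous_at isCont_def tendsto_at_iff_tendsto_nhds)
  have "((\<lambda>\<theta>. (\<Lambda> ((1 + \<delta>) *\<^sub>R \<theta>) - \<Lambda> \<theta>) / \<delta> - \<Lambda> \<theta>)
      \<longlongrightarrow> (\<Lambda> ((1 + \<delta>) *\<^sub>R \<theta>\<^sub>0) - \<Lambda> \<theta>\<^sub>0) / \<delta> - \<Lambda> \<theta>\<^sub>0) (nhds \<theta>\<^sub>0)"
    using \<delta>(1) by (intro tendsto_intros filterlim_compose[OF cont[OF \<delta>(2)] scale] cont[OF D(4)]) simp
  from order_tendstoD(2)[OF this \<delta>(3)]
  have "\<forall>\<^sub>F \<theta> in nhds \<theta>\<^sub>0. (\<Lambda> ((1 + \<delta>) *\<^sub>R \<theta>) - \<Lambda> \<theta>) / \<delta> - \<Lambda> \<theta> < c" .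
  moreover have "\<forall>\<^sub>F \<theta> in nhds \<theta>\<^sub>0. (1 + \<delta>) *\<^sub>R \<theta> \<in> D"
    by (rule topological_tendstoD[OF scale D(2) \<delta>(2)])
  moreover have "\<forall>\<^sub>F \<theta> in nhds \<theta>\<^sub>0. \<theta> \<in> D" using D(2,4) by (rule eventually_nhds_in_open)
  ultimately have "\<forall>\<^sub>F \<theta> in nhds \<theta>\<^sub>0. (\<Lambda> ((1 + \<delta>) *\<^sub>R \<theta>) - \<Lambda> \<theta>) / \<delta> - \<Lambda> \<theta> < c
      \<and> (1 + \<delta>) *\<^sub>R \<theta> \<in> D \<and> \<theta> \<in> D"
    by eventually_elim simp
  then obtain r where "r > 0" "\<forall>\<theta>. dist \<theta> \<theta>\<^sub>0 < r \<longrightarrow> (\<Lambda> ((1 + \<delta>) *\<^sub>R \<theta>) - \<Lambda> \<theta>) / \<delta> - \<Lambda> \<theta> < c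
      \<and> (1 + \<delta>) *\<^sub>R \<theta> \<in> D \<and> \<theta> \<in> D"
    unfolding eventually_nhds_metric by blast
  moreover from this have "ball \<theta>\<^sub>0 r \<subseteq> D" by (auto simp: dist_commute)
  ultimately show ?thesis using that[OF \<delta>(1), of r] by (auto simp: dist_commute)
qed

text \<open>
  Almost surely, convergence holds at all points of a countable dense set, and convexity makes it
  uniform.
\<close>

lemma convergence_near:
  assumes sup: "ereal I\<^sub>0 < liminf (\<lambda>n. ereal (growth n))"
  shows "\<exists>r>0. cball \<theta>\<^sub>0 r \<subseteq> D \<and>
    (AE \<omega> in M. uniform_limit (cball \<theta>\<^sub>0 r) (\<lambda>n. emp_log_mgf X S k n \<omega>) \<Lambda> sequentially)"
proof -
  obtain c where c: "ereal I\<^sub>0 < ereal c" "ereal c < liminf (\<lambda>n. ereal (growth n))"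
    using ereal_dense2[OF sup] by blast
  have grow: "\<forall>\<^sub>F n in sequentially. c \<le> growth n"
    using less_LiminfD[OF c(2)] by eventually_elim simp
  have "I\<^sub>0 < c" using c(1) by simp
  then obtain \<delta> r where \<delta>: "\<delta> > 0" and r: "r > 0" "ball \<theta>\<^sub>0 r \<subseteq> D"
    "\<And>\<theta>. \<theta> \<in> ball \<theta>\<^sub>0 r \<Longrightarrow> (1 + \<delta>) *\<^sub>R \<theta> \<in> D"
    "\<And>\<theta>. \<theta> \<in> ball \<theta>\<^sub>0 r \<Longrightarrow> (\<Lambda> ((1 + \<delta>) *\<^sub>R \<theta>) - \<Lambda> \<theta>) / \<delta> - \<Lambda> \<theta> < c"
    using slope_criterion_near by blast
  from countable_dense_in_open_sets
  obtain Q :: "'v set" where Q: "countable Q" "\<forall>U. open U \<longrightarrow> U \<subseteq> closure (Q \<inter> U)"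
    by (elim exE conjE) (rule that)
  have half: "cball \<theta>\<^sub>0 (r / 2) \<subseteq> ball \<theta>\<^sub>0 r" using r(1) by auto
  have pointwise: "AE \<omega> in M. \<forall>q\<in>Q \<inter> ball \<theta>\<^sub>0 r. (\<lambda>n. emp_log_mgf X S k n \<omega> q) \<longlonglongrightarrow> \<Lambda> q"
  proof (subst AE_ball_countable)
    show "\<forall>q\<in>Q \<inter> ball \<theta>\<^sub>0 r. AE \<omega> in M. (\<lambda>n. emp_log_mgf X S k n \<omega> q) \<longlonglongrightarrow> \<Lambda> q"
    proof
      fix q assume q: "q \<in> Q \<inter> ball \<theta>\<^sub>0 r"
      show "AE \<omega> in M. (\<lambda>n. emp_log_mgf X S k n \<omega> q) \<longlonglongrightarrow> \<Lambda> q"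
        by (rule AE_emp_log_mgf_tendsto[OF _ _ \<delta> _ grow]) (use q r D(3) in auto)
    qed
  qed (use Q(1) in simp)
  have "AE \<omega> in M. uniform_limit (cball \<theta>\<^sub>0 (r / 2)) (\<lambda>n. emp_log_mgf X S k n \<omega>) \<Lambda> sequentially"
    using pointwise
  proof eventually_elim
    case (elim \<omega>)
    have conv: "convex_on UNIV (emp_log_mgf X S k n \<omega>)" for n
      unfolding emp_log_mgf_eq by (rule convex_on_free_energy) (rule k)
    have cont: "continuous_on (ball \<theta>\<^sub>0 r) \<Lambda>"
      by (rule continuous_on_subset[OF continuous_on_lim_log_mgf r(2)])
    show ?case
    proof (rule convex_converges_uniformly_on_compact[where U = "ball \<theta>\<^sub>0 r" and Q = Q])
      show "cball \<theta>\<^sub>0 (r / 2) \<subseteq> ball \<theta>\<^sub>0 r" by (rule half)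
      show "ball \<theta>\<^sub>0 r \<subseteq> closure (Q \<inter> ball \<theta>\<^sub>0 r)" by (rule Q(2)[rule_format]) simp
      show "(\<lambda>n. emp_log_mgf X S k n \<omega> q) \<longlonglongrightarrow> \<Lambda> q" if "q \<in> Q \<inter> ball \<theta>\<^sub>0 r" for q
        by (rule bspec[OF elim that])
    qed (fact open_ball conv cont compact_cball)+
  qed
  with order_trans[OF half r(2)] show ?thesis
    using half_gt_zero[OF r(1)] by (intro exI[of _ "r / 2"] conjI)
qed

lemma AE_local_large_deviations:
  assumes sup: "ereal I\<^sub>0 < liminf (\<lambda>n. ereal (growth n))"
  shows "AE \<omega> in M. iterated_limit
    (\<lambda>\<epsilon> n. ereal (1 / real n) * elog (emeasure (emp_measure X S k n \<omega>) (cball x\<^sub>0 \<epsilon>))) (- ereal I\<^sub>0)"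
proof -
  from convergence_near[OF sup] obtain r where r: "r > 0"
    "AE \<omega> in M. uniform_limit (cball \<theta>\<^sub>0 r) (\<lambda>n. emp_log_mgf X S k n \<omega>) \<Lambda> sequentially"
    by (elim exE conjE) (rule that)
  show ?thesis
    using r(2)
  proof eventually_elim
    case (elim \<omega>)
    have "iterated_limit
        (\<lambda>\<epsilon> n. ereal (1 / real n) * elog (emeasure (emp_measure X S k n \<omega>) (cball x\<^sub>0 \<epsilon>)))
        (ereal (\<Lambda> \<theta>\<^sub>0 - \<theta>\<^sub>0 \<bullet> x\<^sub>0))"
      by (rule local_large_deviations[OF k r(1) tendsto_uniform_limitI[OF elim] grad])
    then show ?case by simp
  qed
qed

text \<open>
  The upper bound for the empirical free energy at \<open>\<theta>\<^sub>0\<close> alone keeps every \<open>\<theta>\<^sub>0 \<bullet> x\<^sub>n\<^sub>,\<^sub>j\<close> below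
  \<open>\<theta>\<^sub>0 \<bullet> x\<^sub>0\<close> by a fixed amount when there are too few blocks.
\<close>

lemma AE_eventually_no_point_near:
  assumes sub: "limsup (\<lambda>n. ereal (growth n)) < ereal I\<^sub>0"
  shows "\<exists>\<epsilon>>0. AE \<omega> in M. \<forall>\<^sub>F n in sequentially. {j \<in> {1..k n}. emp_point X S n j \<omega> \<in> cball x\<^sub>0 \<epsilon>} = {}"
proof -
  obtain c where c: "limsup (\<lambda>n. ereal (growth n)) < ereal c" "ereal c < ereal I\<^sub>0"
    by (rule exE[OF ereal_dense2[OF sub]], elim conjE) (rule that)
  define g where "g = (I\<^sub>0 - c) / 3"
  have g: "g > 0" using c(2) by (simp add: g_def)
  define \<epsilon> where "\<epsilon> = g / (norm \<theta>\<^sub>0 + 1)"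
  have pos: "norm \<theta>\<^sub>0 + 1 > 0" using norm_ge_zero[of \<theta>\<^sub>0] by linarith
  have \<epsilon>: "\<epsilon> > 0" "norm \<theta>\<^sub>0 * \<epsilon> \<le> g"
    using g pos by (simp_all add: \<epsilon>_def pos_divide_le_eq algebra_simps)
  have grow: "\<forall>\<^sub>F n in sequentially. growth n < c"
    using Limsup_lessD[OF c(1)] by eventually_elim simp
  have "AE \<omega> in M. \<forall>\<^sub>F n in sequentially. {j \<in> {1..k n}. emp_point X S n j \<omega> \<in> cball x\<^sub>0 \<epsilon>} = {}"
    using AE_upper[OF subsetD[OF D(3,4)]]
  proof eventually_elim
    case (elim \<omega>)
    then have "\<forall>\<^sub>F n in sequentially. emp_log_mgf X S k n \<omega> \<theta>\<^sub>0 \<le> \<Lambda> \<theta>\<^sub>0 + g" using g by blast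
    then show ?case
      using grow eventually_ge_at_top[of 1]
    proof eventually_elim
      case (elim n)
      have False if j: "j \<in> {1..k n}" "emp_point X S n j \<omega> \<in> cball x\<^sub>0 \<epsilon>" for j
      proof -
        let ?x = "emp_point X S n j \<omega>"
        have "\<theta>\<^sub>0 \<bullet> (x\<^sub>0 - ?x) \<le> norm \<theta>\<^sub>0 * norm (x\<^sub>0 - ?x)" by (rule norm_cauchy_schwarz)
        also have "\<dots> \<le> norm \<theta>\<^sub>0 * \<epsilon>" using j(2) by (intro mult_left_mono) (auto simp: dist_norm)
        also have "\<dots> \<le> g" by (rule \<epsilon>(2))
        finally have "\<theta>\<^sub>0 \<bullet> x\<^sub>0 - g \<le> \<theta>\<^sub>0 \<bullet> ?x" by (simp add: inner_diff_right)
        moreover have "\<theta>\<^sub>0 \<bullet> ?x \<le> growth n + emp_log_mgf X S k n \<omega> \<theta>\<^sub>0"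
          unfolding emp_log_mgf_eq
          using inner_le_free_energy[of n j k \<theta>\<^sub>0 "\<lambda>n j. emp_point X S n j \<omega>"] elim(3) j(1) by simp
        moreover have "3 * g = I\<^sub>0 - c" by (simp add: g_def)
        ultimately show False using elim(1,2) g by linarith
      qed
      then show ?case by blast
    qed
  qed
  then show ?thesis using \<epsilon>(1) by blast
qed

text \<open>
  Strict convexity at \<open>1\<close> makes the slope of \<open>t \<mapsto> \<Lambda>(t \<theta>\<^sub>0)\<close> between \<open>t < 1\<close> and \<open>1\<close> strictly smaller
  than \<open>\<theta>\<^sub>0 \<bullet> x\<^sub>0\<close>; hence at \<open>t \<theta>\<^sub>0\<close> fewer blocks suffice than at \<open>\<theta>\<^sub>0\<close>, and the second-moment
  criterion holds there at the critical growth rate.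
\<close>

lemma AE_tendsto_below_critical:
  assumes crit: "growth \<longlonglongrightarrow> I\<^sub>0"
    and strict: "strictly_convex_at {t. 0 \<le> t \<and> t *\<^sub>R \<theta>\<^sub>0 \<in> D} (\<lambda>t. \<Lambda> (t *\<^sub>R \<theta>\<^sub>0)) 1"
    and t: "0 < t" "t < 1" "t *\<^sub>R \<theta>\<^sub>0 \<in> D"
  shows "AE \<omega> in M. (\<lambda>n. emp_log_mgf X S k n \<omega> (t *\<^sub>R \<theta>\<^sub>0)) \<longlonglongrightarrow> \<Lambda> (t *\<^sub>R \<theta>\<^sub>0)"
proof -
  let ?v = "\<theta>\<^sub>0 \<bullet> x\<^sub>0"
  define \<delta> where "\<delta> = (1 - t) / t"
  have \<delta>: "\<delta> > 0" "(1 + \<delta>) * t = 1" using t(1,2) by (simp_all add: \<delta>_def field_simps)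
  then have up: "(1 + \<delta>) *\<^sub>R (t *\<^sub>R \<theta>\<^sub>0) = \<theta>\<^sub>0" by simp
  define d where "d = \<Lambda> \<theta>\<^sub>0 - \<Lambda> (t *\<^sub>R \<theta>\<^sub>0)"
  \<comment> \<open>at the midpoint of \<open>t\<close> and \<open>1\<close>, the tangent at \<open>1\<close> lies strictly below the chord\<close>
  have d: "d < (1 - t) * ?v"
  proof -
    let ?u = "(1 - 1 / 2) * 1 + 1 / 2 * t"
    have "\<Lambda> (?u *\<^sub>R \<theta>\<^sub>0) < (1 - 1 / 2) * \<Lambda> (1 *\<^sub>R \<theta>\<^sub>0) + 1 / 2 * \<Lambda> (t *\<^sub>R \<theta>\<^sub>0)"
      by (rule strict[unfolded strictly_convex_at_def, rule_format]) (use t in auto)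
    moreover have "?u *\<^sub>R \<theta>\<^sub>0 \<in> D"
      using convexD_alt[OF D(1,4) t(3), of "1 / 2"] by (simp add: scaleR_add_left)
    then have "\<Lambda> \<theta>\<^sub>0 + (?u *\<^sub>R \<theta>\<^sub>0 - \<theta>\<^sub>0) \<bullet> x\<^sub>0 \<le> \<Lambda> (?u *\<^sub>R \<theta>\<^sub>0)"
      using D(3) by (intro lim_log_mgf_above_tangent[OF D(2-4) grad]) auto
    moreover have "(?u *\<^sub>R \<theta>\<^sub>0 - \<theta>\<^sub>0) \<bullet> x\<^sub>0 = - ((1 - t) * ?v) / 2"
      by (simp add: inner_diff_left field_simps)
    ultimately show ?thesis by (simp add: d_def)
  qed
  have "d / \<delta> - \<Lambda> (t *\<^sub>R \<theta>\<^sub>0) < I\<^sub>0"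
  proof -
    have "d / \<delta> + d = d / (1 - t)" using t by (simp add: \<delta>_def field_simps)
    also have "\<dots> < ?v" using d t by (simp add: pos_divide_less_eq mult.commute)
    finally show ?thesis by (simp add: d_def)
  qed
  then obtain c where c: "d / \<delta> - \<Lambda> (t *\<^sub>R \<theta>\<^sub>0) < c" "c < I\<^sub>0" using dense by blast
  have "\<forall>\<^sub>F n in sequentially. c \<le> growth n"
    using order_tendstoD(1)[OF crit c(2)] by eventually_elim simp
  then show ?thesis
  proof (rule AE_emp_log_mgf_tendsto[OF _ _ \<delta>(1), rotated -1])
    show "t *\<^sub>R \<theta>\<^sub>0 \<in> dom\<Lambda>" "(1 + \<delta>) *\<^sub>R t *\<^sub>R \<theta>\<^sub>0 \<in> dom\<Lambda>"
      unfolding up using t(3) D(3,4) by blast+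
    show "(\<Lambda> ((1 + \<delta>) *\<^sub>R t *\<^sub>R \<theta>\<^sub>0) - \<Lambda> (t *\<^sub>R \<theta>\<^sub>0)) / \<delta> - \<Lambda> (t *\<^sub>R \<theta>\<^sub>0) < c"
      unfolding up using c(1) by (simp only: d_def)
  qed
qed

lemma AE_freezing:
  assumes crit: "growth \<longlonglongrightarrow> I\<^sub>0"
    and strict: "strictly_convex_at {t. 0 \<le> t \<and> t *\<^sub>R \<theta>\<^sub>0 \<in> D} (\<lambda>t. \<Lambda> (t *\<^sub>R \<theta>\<^sub>0)) 1"
  shows "AE \<omega> in M. \<forall>t\<ge>1. (\<lambda>n. emp_log_mgf X S k n \<omega> (t *\<^sub>R \<theta>\<^sub>0)) \<longlonglongrightarrow> \<Lambda> \<theta>\<^sub>0 + (t - 1) * (\<theta>\<^sub>0 \<bullet> x\<^sub>0)"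
proof -
  let ?\<phi> = "\<lambda>t. \<Lambda> (t *\<^sub>R \<theta>\<^sub>0)"
  let ?T = "\<lambda>m::nat. {1 - 1 / real m, 1 - 2 / real m}"
  have below: "AE \<omega> in M. \<forall>m. \<forall>t\<in>?T m. 0 < t \<and> t < 1 \<and> t *\<^sub>R \<theta>\<^sub>0 \<in> D \<longrightarrow>
      (\<lambda>n. emp_log_mgf X S k n \<omega> (t *\<^sub>R \<theta>\<^sub>0)) \<longlonglongrightarrow> ?\<phi> t"
    unfolding AE_all_countable
  proof
    fix m
    have "\<forall>t\<in>?T m. AE \<omega> in M. 0 < t \<and> t < 1 \<and> t *\<^sub>R \<theta>\<^sub>0 \<in> D \<longrightarrow>
        (\<lambda>n. emp_log_mgf X S k n \<omega> (t *\<^sub>R \<theta>\<^sub>0)) \<longlonglongrightarrow> ?\<phi> t"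
    proof
      fix t
      show "AE \<omega> in M. 0 < t \<and> t < 1 \<and> t *\<^sub>R \<theta>\<^sub>0 \<in> D \<longrightarrow>
          (\<lambda>n. emp_log_mgf X S k n \<omega> (t *\<^sub>R \<theta>\<^sub>0)) \<longlonglongrightarrow> ?\<phi> t"
      proof (cases "0 < t \<and> t < 1 \<and> t *\<^sub>R \<theta>\<^sub>0 \<in> D")
        case True
        then have "AE \<omega> in M. (\<lambda>n. emp_log_mgf X S k n \<omega> (t *\<^sub>R \<theta>\<^sub>0)) \<longlonglongrightarrow> ?\<phi> t"
          by (intro AE_tendsto_below_critical[OF assms]) simp_all
        then show ?thesis by eventually_elim (rule impI)
      next
        case False
        then show ?thesis by (intro AE_I2 impI) (rule notE)
      qed
    qed
    moreover have "countable (?T m)" by simp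
    ultimately show "AE \<omega> in M. \<forall>t\<in>?T m. 0 < t \<and> t < 1 \<and> t *\<^sub>R \<theta>\<^sub>0 \<in> D \<longrightarrow>
        (\<lambda>n. emp_log_mgf X S k n \<omega> (t *\<^sub>R \<theta>\<^sub>0)) \<longlonglongrightarrow> ?\<phi> t"
      by (simp only: AE_ball_countable)
  qed
  have near: "\<forall>\<^sub>F m in sequentially. \<forall>t\<in>?T m. 0 < t \<and> t < 1 \<and> t *\<^sub>R \<theta>\<^sub>0 \<in> D"
  proof -
    have ev: "\<forall>\<^sub>F m in sequentially. 0 < 1 - a / real m \<and> 1 - a / real m < 1 \<and> (1 - a / real m) *\<^sub>R \<theta>\<^sub>0 \<in> D"
      if "a > 0" for a :: real
    proof -
      have lim: "(\<lambda>m. 1 - a / real m) \<longlonglongrightarrow> 1"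
        using tendsto_diff[OF tendsto_const[of 1] lim_const_over_n[of a]] by simp
      have "(\<lambda>m. (1 - a / real m) *\<^sub>R \<theta>\<^sub>0) \<longlonglongrightarrow> 1 *\<^sub>R \<theta>\<^sub>0"
        by (rule tendsto_scaleR[OF lim tendsto_const])
      from topological_tendstoD[OF this D(2)]
      have "\<forall>\<^sub>F m in sequentially. (1 - a / real m) *\<^sub>R \<theta>\<^sub>0 \<in> D"
        using D(4) by simp
      moreover have "\<forall>\<^sub>F m in sequentially. 0 < 1 - a / real m"
        by (rule order_tendstoD(1)[OF lim]) simp
      ultimately show ?thesis
        using eventually_gt_at_top[of 0] by eventually_elim (use that in simp)
    qed
    show ?thesis using ev[OF zero_less_one] ev[OF zero_less_two] by eventually_elim simp
  qed
  show ?thesis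
    using below AE_upper[OF subsetD[OF D(3,4)]]
  proof eventually_elim
    case (elim \<omega>)
    let ?x = "\<lambda>n j. emp_point X S n j \<omega>"
    note conv = elim(1)[unfolded emp_log_mgf_eq]
    show ?case
    proof (intro allI impI)
      fix t :: real assume t: "1 \<le> t"
      have "(\<lambda>n. free_energy k ?x n (t *\<^sub>R \<theta>\<^sub>0)) \<longlonglongrightarrow> ?\<phi> 1 + (t - 1) * (\<theta>\<^sub>0 \<bullet> x\<^sub>0)"
      proof (rule free_energy_freezes[where \<phi> = ?\<phi>])
        show "growth \<longlonglongrightarrow> \<theta>\<^sub>0 \<bullet> x\<^sub>0 - ?\<phi> 1" using crit by simp
        show "\<forall>\<^sub>F n in sequentially. free_energy k ?x n \<theta>\<^sub>0 \<le> ?\<phi> 1 + \<eta>" if "\<eta> > 0" for \<eta>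
          using elim(2)[THEN spec, THEN mp, OF that] by (simp only: emp_log_mgf_eq scaleR_one)
        show "\<forall>\<^sub>F m in sequentially. \<forall>t\<in>?T m. (\<lambda>n. free_energy k ?x n (t *\<^sub>R \<theta>\<^sub>0)) \<longlonglongrightarrow> ?\<phi> t"
          using near
        proof eventually_elim
          case (elim m)
          show ?case
          proof
            fix t assume "t \<in> ?T m"
            then show "(\<lambda>n. free_energy k ?x n (t *\<^sub>R \<theta>\<^sub>0)) \<longlonglongrightarrow> ?\<phi> t"
              by (rule conv[THEN spec, THEN bspec, THEN mp]) (use elim \<open>t \<in> ?T m\<close> in \<open>rule bspec\<close>)
          qed
        qed
        show "(?\<phi> has_real_derivative \<theta>\<^sub>0 \<bullet> x\<^sub>0) (at 1)"
          using gderiv_along_line[OF grad, of 0 1 \<theta>\<^sub>0] by simp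
      qed (fact k t)+
      then show "(\<lambda>n. emp_log_mgf X S k n \<omega> (t *\<^sub>R \<theta>\<^sub>0)) \<longlonglongrightarrow> \<Lambda> \<theta>\<^sub>0 + (t - 1) * (\<theta>\<^sub>0 \<bullet> x\<^sub>0)"
        by (simp only: emp_log_mgf_eq scaleR_one)
    qed
  qed
qed

end

theorem theorem2p3:
  fixes M :: "'a measure" and E :: "'e measure" and X :: "nat \<Rightarrow> 'a \<Rightarrow> 'e"
    and S S' :: "nat \<Rightarrow> (nat \<Rightarrow> 'e) \<Rightarrow> real ^ 'd"
    and k :: "nat \<Rightarrow> nat" and \<D> :: "(real ^ 'd) set" and \<theta>\<^sub>0 x\<^sub>0 :: "real ^ 'd"
  assumes "prob_space M"
    and "stationary_process M E X"
    and "\<And>n. n \<ge> 1 \<Longrightarrow> orbit_function E n (S n)"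
    and "\<And>n. n \<ge> 1 \<Longrightarrow> k n > 0"
    and "mono_on {1..} k"
    and "convex \<D>" and "open \<D>"
    and "\<And>\<theta>. \<theta> \<in> \<D> \<Longrightarrow> \<exists>l::real. (\<lambda>n. log_mgf M X S n \<theta>) \<longlonglongrightarrow> ereal l"
    and "\<And>h::real. h > 0 \<Longrightarrow> mixing_moment M E X h < \<infinity>"
    and "\<And>n. n \<ge> 1 \<Longrightarrow> depends_on_first E (2 * n) (S' n)"
    and "(\<lambda>n. SUP z \<in> space (seq_space E). ereal (norm (S n z - S' n z) / real n)) \<longlonglongrightarrow> 0"
    and "\<theta>\<^sub>0 \<in> interior \<D>"
    and "GDERIV (lim_log_mgf M X S) \<theta>\<^sub>0 :> x\<^sub>0"
  shows
    "(liminf (\<lambda>n. ereal (ln (real (k n)) / real n)) > rate M X S x\<^sub>0 \<longrightarrow>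
        (\<exists>r>0. cball \<theta>\<^sub>0 r \<subseteq> \<D> \<and>
          (AE \<omega> in M. uniform_limit (cball \<theta>\<^sub>0 r)
             (\<lambda>n. emp_log_mgf X S k n \<omega>) (lim_log_mgf M X S) sequentially)))
     \<and>
     (liminf (\<lambda>n. ereal (ln (real (k n)) / real n)) > rate M X S x\<^sub>0 \<longrightarrow>
        (AE \<omega> in M. iterated_limit
           (\<lambda>\<epsilon> n. ereal (1 / real n) * elog (emeasure (emp_measure X S k n \<omega>) (cball x\<^sub>0 \<epsilon>)))
           (- rate M X S x\<^sub>0)))
     \<and>
     (limsup (\<lambda>n. ereal (ln (real (k n)) / real n)) < rate M X S x\<^sub>0 \<longrightarrow>
        (\<exists>\<epsilon>>0. AE \<omega> in M. \<forall>\<^sub>F n in sequentially.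
           {j \<in> {1..k n}. emp_point X S n j \<omega> \<in> cball x\<^sub>0 \<epsilon>} = {}))
     \<and>
     ((\<lambda>n. ereal (ln (real (k n)) / real n)) \<longlonglongrightarrow> rate M X S x\<^sub>0 \<and>
      strictly_convex_at {t. 0 \<le> t \<and> t *\<^sub>R \<theta>\<^sub>0 \<in> \<D>} (\<lambda>t. lim_log_mgf M X S (t *\<^sub>R \<theta>\<^sub>0)) 1 \<longrightarrow>
        (AE \<omega> in M. \<forall>t\<ge>1.
           (\<lambda>n. emp_log_mgf X S k n \<omega> (t *\<^sub>R \<theta>\<^sub>0))
             \<longlonglongrightarrow> lim_log_mgf M X S \<theta>\<^sub>0 + (t - 1) * (\<theta>\<^sub>0 \<bullet> x\<^sub>0)))"
proof -
  interpret prob_space M by fact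
  interpret mixing_sums M E X S S' k \<D> \<theta>\<^sub>0 x\<^sub>0
  proof
    show "\<D> \<subseteq> lim_log_mgf_dom M X S" using assms(8) by (auto simp: lim_log_mgf_dom_def)
    show "\<theta>\<^sub>0 \<in> \<D>" using assms(12) interior_subset by blast
  qed (fact assms)+
  show ?thesis
    unfolding rate_eq
  proof (intro conjI impI, goal_cases)
    case 1
    then show ?case by (rule convergence_near)
  next
    case 2
    then show ?case by (rule AE_local_large_deviations)
  next
    case 3
    then show ?case by (rule AE_eventually_no_point_near)
  next
    case 4
    then show ?case by (intro AE_freezing) (simp_all add: lim_ereal)
  qed
qed

end
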